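(* Let $G$ be a connected and simply connected Poisson-Lie group with Lie bialgebra $\mathfrak g$. Let $\mathfrak g^*$ admit two pre-Lie structures $\Xi$ and $\circ$, with $\Xi$ obeying $$\Xi(\phi,\psi)_{(1)}\otimes\Xi(\phi,\psi)_{(2)}=\Xi(\phi,\psi_{(1)})\otimes\psi_{(2)}+\psi_{(1)}\otimes\Xi(\phi,\psi_{(2)}),\qquad\Xi(\phi_{(1)},\psi)\otimes\phi_{(2)}=\psi_{(1)}\otimes\Xi(\psi_{(2)},\phi)$$ for all $\phi,\psi\in\mathfrak g^*$. Let $\mathfrak g$ also admit a pre-Lie structure $\ast$ such that $$\phi\triangleright(x\ast y)=(\phi\triangleright x)\ast y+x\ast(\phi\triangleright y),\quad\forall\phi\in\mathfrak g^*,\ x,y\in\mathfrak g,$$ where $\triangleright$ is the left action of $\mathfrak g^*$ on $\mathfrak g$ defined by $\langle\phi\triangleright x,\psi\rangle=-\Xi(\phi,\psi)(x)$. Then the Lie algebra $\overline{\mathfrak g}\rtimes\mathfrak g^*$ admits the pre-Lie structure $$(x,\phi)\,\tilde\circ\,(y,\psi)=(x\ast y+\phi\triangleright y,\ \phi\circ\psi),$$ and the cotangent bundle $\underline{\mathfrak g^*}\rtimes G$ (with the Poisson-Lie structure induced by $\Xi$ described in the context) admits a Poisson-compatible left-covariant flat preconnection.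
   Context: A Poisson-Lie group is a Lie group with a Poisson bracket on its smooth functions such that multiplication is a Poisson map; its Lie algebra is then a Lie bialgebra with cobracket the derivative at the identity of the right-translated Poisson bivector $D(g)=(R_{g^{-1}})_*P(g)$. For the (finite-dimensional) Lie bialgebra $\mathfrak g$ of $G$, $\langle[\phi,\psi]_{\mathfrak g^*},x\rangle=\langle\phi\otimes\psi,\delta_{\mathfrak g}x\rangle$, $\langle\delta_{\mathfrak g^*}\phi,x\otimes y\rangle=\langle\phi,[x,y]\rangle$, $\delta_{\mathfrak g^*}\phi=\phi_{(1)}\otimes\phi_{(2)}$, $(\mathrm{ad}^*_x\phi)(y)=-\phi([x,y])$. A pre-Lie structure on a Lie algebra $L$ is a bilinear product $\cdot$ with $(x\cdot y)\cdot z-(y\cdot x)\cdot z=x\cdot(y\cdot z)-y\cdot(x\cdot z)$ and $x\cdot y-y\cdot x=[x,y]$; $\Xi(\phi,\psi)$ denotes the product of $\phi,\psi$. The cotangent bundle $T^*G=\underline{\mathfrak g^*}\rtimes G$ is the Lie group with product $(\phi,g)(\psi,h)=(\phi+\mathrm{Ad}^*(g)\psi,gh)$, with $\underline{\mathfrak g^*}$ the additive group of $\mathfrak g^*$. Under the stated conditions on $\Xi$, it is a connected simply connected Poisson-Lie group whose Lie bialgebra is $\mathfrak g^*\oplus\mathfrak g$ with bracket $[(\phi,x),(\psi,y)]=(\mathrm{ad}^*_x\psi-\mathrm{ad}^*_y\phi,[x,y]_{\mathfrak g})$ and cobracket $\delta(\phi,X)=\delta_{\mathfrak g}X+\delta_{\mathfrak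 g^*}\phi+(\mathrm{id}-\tau)\alpha(\phi)$, where $\tau$ is the flip and $\alpha:\mathfrak g^*\to\mathfrak g\otimes\mathfrak g^*$ is given by $\langle\alpha(\phi),\psi\otimes x\rangle=-\Xi(\psi,\phi)(x)$; this is the Poisson-Lie structure used. The Lie algebra dual to this Lie bialgebra is $\overline{\mathfrak g}\rtimes\mathfrak g^*$, i.e. $\mathfrak g\oplus\mathfrak g^*$ with $[x,y]=[x,y]_{\mathfrak g}$, $[\phi,x]=\phi\triangleright x$, $[\phi,\psi]=[\phi,\psi]_{\mathfrak g^*}$. A preconnection on a Poisson-Lie group $K$ is a bilinear map $\gamma:C^\infty(K)\otimes\Omega^1(K)\to\Omega^1(K)$ with $\gamma(ab,\tau)=\gamma(a,\tau)b+a\gamma(b,\tau)$ and $\gamma(a,b\tau)=b\gamma(a,\tau)+\{a,b\}\tau$. It is Poisson-compatible if $d\{a,b\}=\gamma(a,db)-\gamma(b,da)$, and flat if $\gamma(a,\gamma(b,\tau))-\gamma(b,\gamma(a,\tau))=\gamma(\{a,b\},\tau)$. It is left-covariant (the associated first-order differential calculus is left-covariant to lowest deformation order) exactly when there is a linear map $\Theta:\mathfrak k^*\otimes\mathfrak k^*\to\mathfrak k^*$ ($\mathfrak k$ the Lie algebra of $K$) such that $\gamma(a,\sum_k\tau_k\omega^k)=\sum_k(\{a,\tau_k\}+\sum_{i,j}\Theta^{ij}_k(\partial_ia)\tau_j)\omega^k$, where $\{e_i\}$ is a basis of $\mathfrak k$ with dual basis $\{f^i\}$, $\Theta(f^i,f^j)=\sum_k\Theta^{ij}_kf^k$,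 $\{\partial_i\}$ are the left-invariant vector fields generated by $\{e_i\}$ and $\{\omega^i\}$ the dual left-invariant 1-forms; this is taken as the definition here. *)

theory Defs
  imports "HOL-Analysis.Analysis" "HOL-Algebra.Group"
begin

section \<open>Finite-dimensional spaces and smoothness\<close>

text \<open>Unlike \<^class>\<open>euclidean_space\<close>, the following class admits dimension 0. The norm is
  auxiliary: in finite dimension, smoothness does not depend on it.\<close>

class fin_dim_normed_vector = real_normed_vector +
  assumes ex_finite_spanning: "\<exists>B. finite B \<and> (\<forall>x. \<exists>r. x = (\<Sum>b\<in>B. r b *\<^sub>R b))"

lemma ex_finite_span: "\<exists>B::'a::fin_dim_normed_vector set. finite B \<and> span B = UNIV"
proof -
  obtain B :: "'a set" where "finite B" "\<And>x. \<exists>r. x = (\<Sum>b\<in>B. r b *\<^sub>R b)"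
    using ex_finite_spanning by blast
  then have "finite B" "span B = UNIV" by (auto simp: span_finite)
  then show ?thesis by blast
qed

instance fin_dim_normed_vector \<subseteq> second_countable_topology
proof
  obtain B :: "'a set" where B: "finite B" "\<And>x. \<exists>r. x = (\<Sum>b\<in>B. r b *\<^sub>R b)"
    using ex_finite_spanning by blast
  define comb where "comb = (\<lambda>r::'a \<Rightarrow> real. \<Sum>b\<in>B. r b *\<^sub>R b)"
  define D where "D = comb ` (PiE B (\<lambda>_. \<rat>))"
  have cD: "countable D"
    unfolding D_def by (intro countable_image countable_PiE B) (simp add: countable_rat)
  have dense: "\<exists>d\<in>D. dist d x < e" if "e > 0" for x and e :: real
  proof -
    obtain r where r: "x = comb r" using B(2) unfolding comb_def by blast
    define M where "M = (\<Sum>b\<in>B. norm b) + 1"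
    have M: "M > 0" unfolding M_def by (simp add: add_nonneg_pos sum_nonneg)
    have "\<exists>q\<in>\<rat>. \<bar>q - r b\<bar> < e / M" for b
    proof -
      have "r b < r b + e / M" using that M by simp
      then obtain q where "q \<in> \<rat>" "r b < q" "q < r b + e / M" using Rats_dense_in_real by blast
      then show ?thesis by (intro bexI[of _ q]) auto
    qed
    then obtain q where q: "\<And>b. q b \<in> \<rat>" "\<And>b. \<bar>q b - r b\<bar> < e / M" by metis
    have "comb (restrict q B) - x = (\<Sum>b\<in>B. (q b - r b) *\<^sub>R b)"
      unfolding r comb_def by (simp add: scaleR_diff_left sum_subtractf)
    also have "norm \<dots> \<le> (\<Sum>b\<in>B. (e / M) * norm b)"
      by (rule sum_norm_le) (auto intro!: mult_right_mono less_imp_le[OF q(2)] simp del: times_divide_eq_left)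
    also have "\<dots> = (e / M) * (M - 1)" by (simp only: sum_distrib_left[symmetric] M_def add_diff_cancel_right')
    also have "\<dots> < (e / M) * M" using that M by (intro mult_strict_left_mono) auto
    also have "\<dots> = e" using M by simp
    finally have "dist (comb (restrict q B)) x < e" by (simp add: dist_norm)
    moreover have "comb (restrict q B) \<in> D" unfolding D_def using q by auto
    ultimately show ?thesis by blast
  qed
  define \<B> where "\<B> = (\<lambda>(d, n::nat). ball d (inverse (real (Suc n)))) ` (D \<times> UNIV)"
  have "topological_basis \<B>"
  proof (rule topological_basisI)
    fix U :: "'a set" and x assume U: "open U" "x \<in> U"
    obtain e where e: "e > 0" "ball x e \<subseteq> U" using U open_contains_ball by blast
    obtain n where n: "inverse (real (Suc n)) < e / 2" using e reals_Archimedean[of "e / 2"] by auto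
    obtain d where d: "d \<in> D" "dist d x < inverse (real (Suc n))"
      using dense[of "inverse (real (Suc n))" x] by auto
    have "ball d (inverse (real (Suc n))) \<subseteq> ball x e"
    proof
      fix y assume y: "y \<in> ball d (inverse (real (Suc n)))"
      have "dist x y \<le> dist d x + dist d y" by (simp add: dist_triangle3)
      then show "y \<in> ball x e" using y d(2) n by (simp del: of_nat_Suc)
    qed
    then have "x \<in> ball d (inverse (real (Suc n)))" "ball d (inverse (real (Suc n))) \<subseteq> U"
      using d e by auto
    then show "\<exists>V\<in>\<B>. x \<in> V \<and> V \<subseteq> U" using d(1) unfolding \<B>_def by (intro bexI[of _ "ball d (inverse (real (Suc n)))"]) auto
  qed (auto simp: \<B>_def)
  moreover have "countable \<B>" unfolding \<B>_def by (intro countable_image countable_SIGMA cD) auto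
  ultimately show "\<exists>\<B>::'a set set. countable \<B> \<and> open = generate_topology \<B>"
    using topological_basis_imp_subbasis by blast
qed

instance prod :: (fin_dim_normed_vector, fin_dim_normed_vector) fin_dim_normed_vector
proof
  obtain B :: "'a set" where B: "finite B" "span B = UNIV" using ex_finite_span by blast
  obtain C :: "'b set" where C: "finite C" "span C = UNIV" using ex_finite_span by blast
  let ?i = "\<lambda>x::'a. (x, 0::'b)" and ?j = "\<lambda>y::'b. (0::'a, y)"
  have li: "linear ?i" "linear ?j" by (auto intro!: linearI)
  have "(x, y) \<in> span (?i ` B \<union> ?j ` C)" for x y
  proof -
    have "?i x \<in> ?i ` span B" "?j y \<in> ?j ` span C" using B C by auto
    then have "?i x \<in> span (?i ` B)" "?j y \<in> span (?j ` C)"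
      using linear_span_image[OF li(1)] linear_span_image[OF li(2)] by auto
    then have "?i x \<in> span (?i ` B \<union> ?j ` C)" "?j y \<in> span (?i ` B \<union> ?j ` C)"
      using span_mono[of "?i ` B" "?i ` B \<union> ?j ` C"] span_mono[of "?j ` C" "?i ` B \<union> ?j ` C"]
      by auto
    then have "?i x + ?j y \<in> span (?i ` B \<union> ?j ` C)" by (rule span_add)
    then show ?thesis by simp
  qed
  then have "span (?i ` B \<union> ?j ` C) = UNIV" by auto
  moreover have "finite (?i ` B \<union> ?j ` C)" using B C by auto
  ultimately show "\<exists>D::('a \<times> 'b) set. finite D \<and> (\<forall>z. \<exists>r. z = (\<Sum>d\<in>D. r d *\<^sub>R d))"
    using span_finite by (intro exI[of _ "?i ` B \<union> ?j ` C"]) blast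
qed

instance euclidean_space \<subseteq> fin_dim_normed_vector
proof
  have "\<forall>x::'a. \<exists>r. x = (\<Sum>b\<in>Basis. r b *\<^sub>R b)" by (metis euclidean_representation)
  then show "\<exists>B::'a set. finite B \<and> (\<forall>x. \<exists>r. x = (\<Sum>b\<in>B. r b *\<^sub>R b))" using finite_Basis by blast
qed

definition is_basis :: "'v::real_vector set \<Rightarrow> bool" where
  "is_basis B \<longleftrightarrow> finite B \<and> independent B \<and> span B = UNIV"

text \<open>On an open subset of a finite-dimensional space this is the usual $C^k$ condition.\<close>

fun Ck_on :: "nat \<Rightarrow> ('v::real_normed_vector \<Rightarrow> 'w::real_normed_vector) \<Rightarrow> 'v set \<Rightarrow> bool" where
  "Ck_on 0 f S \<longleftrightarrow> continuous_on S f"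
| "Ck_on (Suc k) f S \<longleftrightarrow> (\<forall>x\<in>S. f differentiable at x) \<and>
      (\<forall>v. Ck_on k (\<lambda>x. frechet_derivative f (at x) v) S)"

definition smooth_on :: "('v::real_normed_vector \<Rightarrow> 'w::real_normed_vector) \<Rightarrow> 'v set \<Rightarrow> bool" where
  "smooth_on f S \<longleftrightarrow> (\<forall>k. Ck_on k f S)"


section \<open>Manifolds and Lie groups\<close>

type_synonym ('m, 'v) chart = "'m set \<times> ('m \<Rightarrow> 'v)"

definition is_chart :: "('m::topological_space, 'v::real_normed_vector) chart \<Rightarrow> bool" where
  "is_chart = (\<lambda>(U, c). open U \<and> open (c ` U) \<and> inj_on c U \<and>
      homeomorphism U (c ` U) c (inv_into U c))"

definition smooth_atlas :: "('m::topological_space, 'v::real_normed_vector) chart set \<Rightarrow> bool" where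
  "smooth_atlas A \<longleftrightarrow> (\<forall>C\<in>A. is_chart C) \<and> (\<Union>C\<in>A. fst C) = UNIV \<and>
     (\<forall>(U, c)\<in>A. \<forall>(V, d)\<in>A. smooth_on (d \<circ> inv_into U c) (c ` (U \<inter> V)))"

definition std_atlas :: "('v, 'v) chart set" where
  "std_atlas = {(UNIV, id)}"

definition prod_atlas :: "('m, 'v) chart set \<Rightarrow> ('n, 'w) chart set \<Rightarrow> ('m \<times> 'n, 'v \<times> 'w) chart set" where
  "prod_atlas A B = {(U \<times> V, map_prod c d) | U c V d. (U, c) \<in> A \<and> (V, d) \<in> B}"

definition smooth_map :: "('m::topological_space, 'v::real_normed_vector) chart set \<Rightarrow>
    ('n::topological_space, 'w::real_normed_vector) chart set \<Rightarrow> ('m \<Rightarrow> 'n) \<Rightarrow> bool" where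
  "smooth_map A B F \<longleftrightarrow> continuous_on UNIV F \<and>
     (\<forall>(U, c)\<in>A. \<forall>(V, d)\<in>B. smooth_on (d \<circ> F \<circ> inv_into U c) (c ` (U \<inter> F -` V)))"

definition C_inf :: "('m::topological_space, 'v::real_normed_vector) chart set \<Rightarrow> ('m \<Rightarrow> real) set" where
  "C_inf A = {f. smooth_map A std_atlas f}"

text \<open>The underlying manifold is the whole topological type of group elements.\<close>

record ('m, 'v) lie_group_data = "'m monoid" +
  atlas :: "('m, 'v) chart set"

definition lie_group ::
  "('m::{t2_space, second_countable_topology}, 'v::fin_dim_normed_vector) lie_group_data \<Rightarrow> bool" where
  "lie_group G \<longleftrightarrow> group G \<and> carrier G = UNIV \<and> smooth_atlas (atlas G) \<and>
     smooth_map (prod_atlas (atlas G) (atlas G)) (atlas G) (\<lambda>(g, h). g \<otimes>\<^bsub>G\<^esub> h) \<and>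
     smooth_map (atlas G) (atlas G) (\<lambda>g. inv\<^bsub>G\<^esub> g)"


section \<open>Tangent vectors, vector fields and 1-forms\<close>

text \<open>Tangent vectors are point derivations, vector fields are derivations of the algebra of smooth
  functions, and 1-forms are the function-linear maps from vector fields to smooth functions. All of
  these are set to 0 outside their domain, so that equality of the HOL functions is equality of the
  geometric objects.\<close>

type_synonym 'm vfield = "('m \<Rightarrow> real) \<Rightarrow> 'm \<Rightarrow> real"
type_synonym 'm form = "'m vfield \<Rightarrow> 'm \<Rightarrow> real"

definition tangent_space :: "('m::topological_space, 'v::real_normed_vector) chart set \<Rightarrow> 'm \<Rightarrow>
    (('m \<Rightarrow> real) \<Rightarrow> real) set" where
  "tangent_space A p = {D.
     (\<forall>f\<in>C_inf A. \<forall>h\<in>C_inf A. D (\<lambda>q. f q + h q) = D f + D h) \<and>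
     (\<forall>c. \<forall>f\<in>C_inf A. D (\<lambda>q. c * f q) = c * D f) \<and>
     (\<forall>f\<in>C_inf A. \<forall>h\<in>C_inf A. D (\<lambda>q. f q * h q) = D f * h p + f p * D h) \<and>
     (\<forall>f. f \<notin> C_inf A \<longrightarrow> D f = 0)}"

definition vector_field :: "('m::topological_space, 'v::real_normed_vector) chart set \<Rightarrow>
    'm vfield \<Rightarrow> bool" where
  "vector_field A X \<longleftrightarrow>
     (\<forall>f\<in>C_inf A. X f \<in> C_inf A) \<and>
     (\<forall>f\<in>C_inf A. \<forall>h\<in>C_inf A. X (\<lambda>q. f q + h q) = (\<lambda>q. X f q + X h q)) \<and>
     (\<forall>c. \<forall>f\<in>C_inf A. X (\<lambda>q. c * f q) = (\<lambda>q. c * X f q)) \<and>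
     (\<forall>f\<in>C_inf A. \<forall>h\<in>C_inf A. X (\<lambda>q. f q * h q) = (\<lambda>q. X f q * h q + f q * X h q)) \<and>
     (\<forall>f. f \<notin> C_inf A \<longrightarrow> X f = (\<lambda>q. 0))"

definition one_form :: "('m::topological_space, 'v::real_normed_vector) chart set \<Rightarrow>
    'm form \<Rightarrow> bool" where
  "one_form A \<tau> \<longleftrightarrow>
     (\<forall>X. vector_field A X \<longrightarrow> \<tau> X \<in> C_inf A) \<and>
     (\<forall>X Y. vector_field A X \<longrightarrow> vector_field A Y \<longrightarrow>
        \<tau> (\<lambda>f q. X f q + Y f q) = (\<lambda>q. \<tau> X q + \<tau> Y q)) \<and>
     (\<forall>a\<in>C_inf A. \<forall>X. vector_field A X \<longrightarrow> \<tau> (\<lambda>f q. a q * X f q) = (\<lambda>q. a q * \<tau> X q)) \<and>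
     (\<forall>X. \<not> vector_field A X \<longrightarrow> \<tau> X = (\<lambda>q. 0))"

definition form_add :: "'m form \<Rightarrow> 'm form \<Rightarrow> 'm form" where
  "form_add \<tau> \<sigma> = (\<lambda>X q. \<tau> X q + \<sigma> X q)"

definition form_diff :: "'m form \<Rightarrow> 'm form \<Rightarrow> 'm form" where
  "form_diff \<tau> \<sigma> = (\<lambda>X q. \<tau> X q - \<sigma> X q)"

definition form_scale :: "('m \<Rightarrow> real) \<Rightarrow> 'm form \<Rightarrow> 'm form" where
  "form_scale a \<tau> = (\<lambda>X q. a q * \<tau> X q)"

definition ext_d :: "('m::topological_space, 'v::real_normed_vector) chart set \<Rightarrow>
    ('m \<Rightarrow> real) \<Rightarrow> 'm form" where
  "ext_d A f = (\<lambda>X. if vector_field A X then X f else (\<lambda>q. 0))"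


section \<open>Dual pairs\<close>

text \<open>The dual of \<open>'v\<close> is a type \<open>'d\<close> with a nondegenerate pairing \<open>\<langle>\<phi>,x\<rangle> = pair \<phi> x\<close>.\<close>

definition dual_pairing :: "('d::fin_dim_normed_vector \<Rightarrow> 'v::fin_dim_normed_vector \<Rightarrow> real) \<Rightarrow> bool" where
  "dual_pairing pair \<longleftrightarrow> bilinear pair \<and> (\<forall>\<phi>. (\<forall>x. pair \<phi> x = 0) \<longrightarrow> \<phi> = 0) \<and>
     (\<forall>x. (\<forall>\<phi>. pair \<phi> x = 0) \<longrightarrow> x = 0)"

definition of_functional :: "('d \<Rightarrow> 'v \<Rightarrow> real) \<Rightarrow> ('v \<Rightarrow> real) \<Rightarrow> 'd" where
  "of_functional pair l = (THE \<phi>. \<forall>x. pair \<phi> x = l x)"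

definition dual_basis :: "('d \<Rightarrow> 'v::real_vector \<Rightarrow> real) \<Rightarrow> 'v set \<Rightarrow> 'v \<Rightarrow> 'd" where
  "dual_basis pair B b = of_functional pair (\<lambda>x. representation B x b)"

text \<open>An element \<open>t\<close> of a tensor product \<open>V \<otimes> W\<close> is represented by the bilinear form
  \<open>(u, v) \<mapsto> \<langle>t, u \<otimes> v\<rangle>\<close> on the duals. For a list \<open>[(a\<^sub>1,b\<^sub>1),\<dots>]\<close>, the tensor
  \<open>a\<^sub>1 \<otimes> b\<^sub>1 + \<dots>\<close> in \<open>\<gg>\<^sup>* \<otimes> \<gg>\<^sup>*\<close> is thus:\<close>

definition tensor_sum :: "('d \<Rightarrow> 'v \<Rightarrow> real) \<Rightarrow> ('d \<times> 'd) list \<Rightarrow> 'v \<Rightarrow> 'v \<Rightarrow> real" where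
  "tensor_sum pair ts = (\<lambda>x y. \<Sum>(a, b)\<leftarrow>ts. pair a x * pair b y)"


section \<open>Lie algebras, pre-Lie structures, duals of Lie bialgebras\<close>

definition lie_algebra :: "('v::real_vector \<Rightarrow> 'v \<Rightarrow> 'v) \<Rightarrow> bool" where
  "lie_algebra br \<longleftrightarrow> bilinear br \<and> (\<forall>x. br x x = 0) \<and>
     (\<forall>x y z. br x (br y z) + br y (br z x) + br z (br x y) = 0)"

definition pre_lie_structure :: "('v::real_vector \<Rightarrow> 'v \<Rightarrow> 'v) \<Rightarrow> ('v \<Rightarrow> 'v \<Rightarrow> 'v) \<Rightarrow> bool" where
  "pre_lie_structure br m \<longleftrightarrow> lie_algebra br \<and> bilinear m \<and>
     (\<forall>x y z. m (m x y) z - m (m y x) z = m x (m y z) - m y (m x z)) \<and>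
     (\<forall>x y. m x y - m y x = br x y)"

definition dual_bracket :: "('d \<Rightarrow> 'v \<Rightarrow> real) \<Rightarrow> ('v \<Rightarrow> 'd \<Rightarrow> 'd \<Rightarrow> real) \<Rightarrow> 'd \<Rightarrow> 'd \<Rightarrow> 'd" where
  "dual_bracket pair \<delta> \<phi> \<psi> = of_functional pair (\<lambda>x. \<delta> x \<phi> \<psi>)"

definition dual_cobracket :: "('d \<Rightarrow> 'v \<Rightarrow> real) \<Rightarrow> ('v \<Rightarrow> 'v \<Rightarrow> 'v) \<Rightarrow> 'd \<Rightarrow> 'v \<Rightarrow> 'v \<Rightarrow> real" where
  "dual_cobracket pair br \<phi> x y = pair \<phi> (br x y)"

definition coad :: "('d \<Rightarrow> 'v \<Rightarrow> real) \<Rightarrow> ('v \<Rightarrow> 'v \<Rightarrow> 'v) \<Rightarrow> 'v \<Rightarrow> 'd \<Rightarrow> 'd" where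
  "coad pair br x \<phi> = of_functional pair (\<lambda>y. - pair \<phi> (br x y))"


section \<open>Poisson-Lie groups and their Lie bialgebras\<close>

type_synonym 'm fn_bracket = "('m \<Rightarrow> real) \<Rightarrow> ('m \<Rightarrow> real) \<Rightarrow> 'm \<Rightarrow> real"

definition poisson_bracket :: "('m::topological_space, 'v::real_normed_vector) chart set \<Rightarrow>
    'm fn_bracket \<Rightarrow> bool" where
  "poisson_bracket A P \<longleftrightarrow>
     (\<forall>f\<in>C_inf A. \<forall>h\<in>C_inf A. P f h \<in> C_inf A) \<and>
     (\<forall>f\<in>C_inf A. \<forall>h\<in>C_inf A. P f h = (\<lambda>q. - P h f q)) \<and>
     (\<forall>f\<in>C_inf A. \<forall>h\<in>C_inf A. \<forall>k\<in>C_inf A. P f (\<lambda>q. h q + k q) = (\<lambda>q. P f h q + P f k q)) \<and>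
     (\<forall>c. \<forall>f\<in>C_inf A. \<forall>h\<in>C_inf A. P f (\<lambda>q. c * h q) = (\<lambda>q. c * P f h q)) \<and>
     (\<forall>f\<in>C_inf A. \<forall>h\<in>C_inf A. \<forall>k\<in>C_inf A.
        P f (\<lambda>q. h q * k q) = (\<lambda>q. P f h q * k q + h q * P f k q)) \<and>
     (\<forall>f\<in>C_inf A. \<forall>h\<in>C_inf A. \<forall>k\<in>C_inf A.
        (\<lambda>q. P f (P h k) q + P h (P k f) q + P k (P f h) q) = (\<lambda>q. 0))"

definition prod_poisson :: "'m fn_bracket \<Rightarrow> 'n fn_bracket \<Rightarrow> ('m \<times> 'n) fn_bracket" where
  "prod_poisson P Q F H = (\<lambda>(p, q).
     P (\<lambda>p'. F (p', q)) (\<lambda>p'. H (p', q)) p + Q (\<lambda>q'. F (p, q')) (\<lambda>q'. H (p, q')) q)"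

definition poisson_lie_group ::
  "('m::{t2_space, second_countable_topology}, 'v::fin_dim_normed_vector) lie_group_data \<Rightarrow>
    'm fn_bracket \<Rightarrow> bool" where
  "poisson_lie_group G P \<longleftrightarrow> lie_group G \<and> poisson_bracket (atlas G) P \<and>
     (\<forall>f\<in>C_inf (atlas G). \<forall>h\<in>C_inf (atlas G).
        (\<lambda>(g, k). P f h (g \<otimes>\<^bsub>G\<^esub> k)) =
        prod_poisson P P (\<lambda>(g, k). f (g \<otimes>\<^bsub>G\<^esub> k)) (\<lambda>(g, k). h (g \<otimes>\<^bsub>G\<^esub> k)))"

text \<open>The vector space of the Lie algebra is a type \<open>'v\<close> which a linear isomorphism \<open>T\<close> identifies
  with the tangent space at the identity.\<close>

definition tangent_identification ::
  "('m::topological_space, 'v::real_normed_vector) lie_group_data \<Rightarrow>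
    ('v \<Rightarrow> ('m \<Rightarrow> real) \<Rightarrow> real) \<Rightarrow> bool" where
  "tangent_identification G T \<longleftrightarrow> bij_betw T UNIV (tangent_space (atlas G) \<one>\<^bsub>G\<^esub>) \<and>
     (\<forall>x y f. T (x + y) f = T x f + T y f) \<and> (\<forall>c x f. T (c *\<^sub>R x) f = c * T x f)"

definition left_inv_field :: "('m::topological_space, 'v::real_normed_vector) lie_group_data \<Rightarrow>
    ('v \<Rightarrow> ('m \<Rightarrow> real) \<Rightarrow> real) \<Rightarrow> 'v \<Rightarrow> 'm vfield" where
  "left_inv_field G T x f =
     (if f \<in> C_inf (atlas G) then (\<lambda>g. T x (\<lambda>h. f (g \<otimes>\<^bsub>G\<^esub> h))) else (\<lambda>g. 0))"

text \<open>\<open>br\<close> is the commutator of left-invariant vector fields (evaluated at the identity), and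
  \<open>\<delta>\<close> the derivative at the identity of the right-translated bivector \<open>D\<close>, which is given by
  \<open>\<langle>D(g), d\<^sub>ef \<otimes> d\<^sub>eh\<rangle> = {f \<circ> R\<^bsub>g'\<^esub>, h \<circ> R\<^bsub>g'\<^esub>}(g)\<close> where \<open>g'\<close> is the inverse of \<open>g\<close>.
  In the last clause \<open>\<phi>\<close> and \<open>\<psi>\<close> are the differentials of \<open>f\<close> and \<open>h\<close> at the identity.\<close>

definition has_lie_bialgebra ::
  "('m::{t2_space, second_countable_topology}, 'v::fin_dim_normed_vector) lie_group_data \<Rightarrow>
    'm fn_bracket \<Rightarrow> ('v \<Rightarrow> ('m \<Rightarrow> real) \<Rightarrow> real) \<Rightarrow>
    ('d::fin_dim_normed_vector \<Rightarrow> 'v \<Rightarrow> real) \<Rightarrow>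
    ('v \<Rightarrow> 'v \<Rightarrow> 'v) \<Rightarrow> ('v \<Rightarrow> 'd \<Rightarrow> 'd \<Rightarrow> real) \<Rightarrow> bool" where
  "has_lie_bialgebra G P T pair br \<delta> \<longleftrightarrow>
     tangent_identification G T \<and> dual_pairing pair \<and>
     (\<forall>x y. \<forall>f\<in>C_inf (atlas G).
        T (br x y) f = T x (left_inv_field G T y f) - T y (left_inv_field G T x f)) \<and>
     (\<forall>x \<phi> \<psi>. \<forall>f\<in>C_inf (atlas G). \<forall>h\<in>C_inf (atlas G).
        (\<forall>y. pair \<phi> y = T y f) \<longrightarrow> (\<forall>y. pair \<psi> y = T y h) \<longrightarrow>
        \<delta> x \<phi> \<psi> = T x (\<lambda>g. P (\<lambda>k. f (k \<otimes>\<^bsub>G\<^esub> inv\<^bsub>G\<^esub> g)) (\<lambda>k. h (k \<otimes>\<^bsub>G\<^esub> inv\<^bsub>G\<^esub> g)) g))"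


section \<open>Preconnections\<close>

type_synonym 'm preconn = "('m \<Rightarrow> real) \<Rightarrow> 'm form \<Rightarrow> 'm form"

definition preconnection :: "('m::topological_space, 'v::real_normed_vector) chart set \<Rightarrow>
    'm fn_bracket \<Rightarrow> 'm preconn \<Rightarrow> bool" where
  "preconnection A P \<gamma> \<longleftrightarrow>
     (\<forall>a\<in>C_inf A. \<forall>\<tau>. one_form A \<tau> \<longrightarrow> one_form A (\<gamma> a \<tau>)) \<and>
     (\<forall>a\<in>C_inf A. \<forall>b\<in>C_inf A. \<forall>\<tau>. one_form A \<tau> \<longrightarrow>
        \<gamma> (\<lambda>q. a q + b q) \<tau> = form_add (\<gamma> a \<tau>) (\<gamma> b \<tau>)) \<and>
     (\<forall>c. \<forall>a\<in>C_inf A. \<forall>\<tau>. one_form A \<tau> \<longrightarrow>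
        \<gamma> (\<lambda>q. c * a q) \<tau> = form_scale (\<lambda>q. c) (\<gamma> a \<tau>)) \<and>
     (\<forall>a\<in>C_inf A. \<forall>\<tau> \<sigma>. one_form A \<tau> \<longrightarrow> one_form A \<sigma> \<longrightarrow>
        \<gamma> a (form_add \<tau> \<sigma>) = form_add (\<gamma> a \<tau>) (\<gamma> a \<sigma>)) \<and>
     (\<forall>c. \<forall>a\<in>C_inf A. \<forall>\<tau>. one_form A \<tau> \<longrightarrow>
        \<gamma> a (form_scale (\<lambda>q. c) \<tau>) = form_scale (\<lambda>q. c) (\<gamma> a \<tau>)) \<and>
     (\<forall>a\<in>C_inf A. \<forall>b\<in>C_inf A. \<forall>\<tau>. one_form A \<tau> \<longrightarrow>
        \<gamma> (\<lambda>q. a q * b q) \<tau> = form_add (form_scale b (\<gamma> a \<tau>)) (form_scale a (\<gamma> b \<tau>))) \<and>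
     (\<forall>a\<in>C_inf A. \<forall>b\<in>C_inf A. \<forall>\<tau>. one_form A \<tau> \<longrightarrow>
        \<gamma> a (form_scale b \<tau>) = form_add (form_scale b (\<gamma> a \<tau>)) (form_scale (P a b) \<tau>))"

definition poisson_compatible :: "('m::topological_space, 'v::real_normed_vector) chart set \<Rightarrow>
    'm fn_bracket \<Rightarrow> 'm preconn \<Rightarrow> bool" where
  "poisson_compatible A P \<gamma> \<longleftrightarrow> (\<forall>a\<in>C_inf A. \<forall>b\<in>C_inf A.
     ext_d A (P a b) = form_diff (\<gamma> a (ext_d A b)) (\<gamma> b (ext_d A a)))"

definition flat_preconnection :: "('m::topological_space, 'v::real_normed_vector) chart set \<Rightarrow>
    'm fn_bracket \<Rightarrow> 'm preconn \<Rightarrow> bool" where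
  "flat_preconnection A P \<gamma> \<longleftrightarrow> (\<forall>a\<in>C_inf A. \<forall>b\<in>C_inf A. \<forall>\<tau>. one_form A \<tau> \<longrightarrow>
     form_diff (\<gamma> a (\<gamma> b \<tau>)) (\<gamma> b (\<gamma> a \<tau>)) = \<gamma> (P a b) \<tau>)"

text \<open>The 1-forms \<open>\<omega>\<^sup>b\<close> dual to the left-invariant vector fields \<open>\<partial>\<^sub>b\<close>, for \<open>b\<close> in a basis \<open>B\<close> of the
  Lie algebra.\<close>

definition left_coframe :: "('m::topological_space, 'v::real_normed_vector) lie_group_data \<Rightarrow>
    ('v \<Rightarrow> ('m \<Rightarrow> real) \<Rightarrow> real) \<Rightarrow> 'v set \<Rightarrow> 'v \<Rightarrow> 'm form" where
  "left_coframe G T B b = (THE \<omega>. one_form (atlas G) \<omega> \<and>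
     (\<forall>c\<in>B. \<omega> (left_inv_field G T c) = (\<lambda>g. if c = b then 1 else 0)))"

text \<open>The coefficient \<open>\<Theta>\<^sup>i\<^sup>j\<^sub>k\<close> is \<open>\<langle>\<Theta>(f\<^sup>i,f\<^sup>j), e\<^sub>k\<rangle>\<close>; a basis is indexed by its own elements.\<close>

definition left_covariant :: "('m::topological_space, 'v::real_normed_vector) lie_group_data \<Rightarrow>
    'm fn_bracket \<Rightarrow> ('v \<Rightarrow> ('m \<Rightarrow> real) \<Rightarrow> real) \<Rightarrow>
    ('d::real_vector \<Rightarrow> 'v \<Rightarrow> real) \<Rightarrow> 'm preconn \<Rightarrow> bool" where
  "left_covariant G P T pair \<gamma> \<longleftrightarrow> (\<exists>\<Theta>::'d \<Rightarrow> 'd \<Rightarrow> 'd. bilinear \<Theta> \<and>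
     (\<forall>B. is_basis B \<longrightarrow>
       (let f = dual_basis pair B; \<omega> = left_coframe G T B; E = left_inv_field G T in
        \<forall>a\<in>C_inf (atlas G). \<forall>\<tau>. (\<forall>k\<in>B. \<tau> k \<in> C_inf (atlas G)) \<longrightarrow>
          \<gamma> a (\<lambda>X q. \<Sum>k\<in>B. \<tau> k q * \<omega> k X q) =
          (\<lambda>X q. \<Sum>k\<in>B. (P a (\<tau> k) q +
             (\<Sum>i\<in>B. \<Sum>j\<in>B. pair (\<Theta> (f i) (f j)) k * E i a q * \<tau> j q)) * \<omega> k X q))))"


section \<open>The action induced by \<open>\<Xi>\<close>, and the cotangent bundle\<close>

definition Xi_act :: "('d \<Rightarrow> 'v \<Rightarrow> real) \<Rightarrow> ('d \<Rightarrow> 'd \<Rightarrow> 'd) \<Rightarrow> 'd \<Rightarrow> 'v \<Rightarrow> 'v" where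
  "Xi_act pair \<Xi> \<phi> x = (THE y. \<forall>\<psi>. pair \<psi> y = - pair (\<Xi> \<phi> \<psi>) x)"

text \<open>The two identities for \<open>\<Xi>\<close>: \<open>s\<close> and \<open>t\<close> are arbitrary expansions
  \<open>\<phi>\<^sub>1 \<otimes> \<phi>\<^sub>2\<close>, \<open>\<psi>\<^sub>1 \<otimes> \<psi>\<^sub>2\<close> of the cobrackets of \<open>\<phi>\<close> and \<open>\<psi>\<close> (Sweedler notation).\<close>

definition Xi_conditions :: "('d \<Rightarrow> 'v \<Rightarrow> real) \<Rightarrow> ('v \<Rightarrow> 'v \<Rightarrow> 'v) \<Rightarrow> ('d \<Rightarrow> 'd \<Rightarrow> 'd) \<Rightarrow> bool" where
  "Xi_conditions pair br \<Xi> \<longleftrightarrow>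
     (\<forall>\<phi> \<psi> t. dual_cobracket pair br \<psi> = tensor_sum pair t \<longrightarrow>
        dual_cobracket pair br (\<Xi> \<phi> \<psi>) =
        tensor_sum pair (map (\<lambda>(a, b). (\<Xi> \<phi> a, b)) t @ map (\<lambda>(a, b). (a, \<Xi> \<phi> b)) t)) \<and>
     (\<forall>\<phi> \<psi> s t. dual_cobracket pair br \<phi> = tensor_sum pair s \<longrightarrow>
        dual_cobracket pair br \<psi> = tensor_sum pair t \<longrightarrow>
        tensor_sum pair (map (\<lambda>(a, b). (\<Xi> a \<psi>, b)) s) =
        tensor_sum pair (map (\<lambda>(a, b). (a, \<Xi> b \<phi>)) t))"

text \<open>The Lie algebra \<open>\<gg> \<rtimes> \<gg>\<^sup>*\<close> dual to the Lie bialgebra of the cotangent bundle.\<close>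

definition dual_semidirect_bracket :: "('d::ab_group_add \<Rightarrow> 'v::ab_group_add \<Rightarrow> real) \<Rightarrow>
    ('v \<Rightarrow> 'v \<Rightarrow> 'v) \<Rightarrow> ('v \<Rightarrow> 'd \<Rightarrow> 'd \<Rightarrow> real) \<Rightarrow> ('d \<Rightarrow> 'd \<Rightarrow> 'd) \<Rightarrow>
    'v \<times> 'd \<Rightarrow> 'v \<times> 'd \<Rightarrow> 'v \<times> 'd" where
  "dual_semidirect_bracket pair br \<delta> \<Xi> = (\<lambda>(x, \<phi>) (y, \<psi>).
     (br x y + Xi_act pair \<Xi> \<phi> y - Xi_act pair \<Xi> \<psi> x, dual_bracket pair \<delta> \<phi> \<psi>))"

definition Ad :: "('m::topological_space, 'v::real_normed_vector) lie_group_data \<Rightarrow>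
    ('v \<Rightarrow> ('m \<Rightarrow> real) \<Rightarrow> real) \<Rightarrow> 'm \<Rightarrow> 'v \<Rightarrow> 'v" where
  "Ad G T g x = (THE y. \<forall>f\<in>C_inf (atlas G).
     T y f = T x (\<lambda>h. f (g \<otimes>\<^bsub>G\<^esub> h \<otimes>\<^bsub>G\<^esub> inv\<^bsub>G\<^esub> g)))"

text \<open>The left action whose derivative at the identity is \<^const>\<open>coad\<close>.\<close>

definition coAd :: "('m::topological_space, 'v::real_normed_vector) lie_group_data \<Rightarrow>
    ('v \<Rightarrow> ('m \<Rightarrow> real) \<Rightarrow> real) \<Rightarrow> ('d \<Rightarrow> 'v \<Rightarrow> real) \<Rightarrow> 'm \<Rightarrow> 'd \<Rightarrow> 'd" where
  "coAd G T pair g \<phi> = of_functional pair (\<lambda>x. pair \<phi> (Ad G T (inv\<^bsub>G\<^esub> g) x))"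

definition cotangent_group :: "('m::topological_space, 'v::real_normed_vector) lie_group_data \<Rightarrow>
    ('v \<Rightarrow> ('m \<Rightarrow> real) \<Rightarrow> real) \<Rightarrow> ('d::real_normed_vector \<Rightarrow> 'v \<Rightarrow> real) \<Rightarrow>
    ('d \<times> 'm, 'd \<times> 'v) lie_group_data" where
  "cotangent_group G T pair =
     \<lparr> carrier = UNIV,
       monoid.mult = (\<lambda>(\<phi>, g) (\<psi>, h). (\<phi> + coAd G T pair g \<psi>, g \<otimes>\<^bsub>G\<^esub> h)),
       one = (0, \<one>\<^bsub>G\<^esub>),
       atlas = prod_atlas std_atlas (atlas G) \<rparr>"

text \<open>The identification of \<open>\<gg>\<^sup>* \<oplus> \<gg>\<close> with the tangent space of the cotangent bundle at \<open>(0, 1)\<close>: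
  \<open>(\<phi>, x)\<close> acts as \<open>\<phi>\<close> in the direction of the fibre and as \<open>x\<close> in the direction of the base.\<close>

definition cotangent_tangent :: "('m::topological_space, 'v::real_normed_vector) lie_group_data \<Rightarrow>
    ('v \<Rightarrow> ('m \<Rightarrow> real) \<Rightarrow> real) \<Rightarrow> 'd::real_normed_vector \<times> 'v \<Rightarrow> ('d \<times> 'm \<Rightarrow> real) \<Rightarrow> real" where
  "cotangent_tangent G T = (\<lambda>(\<phi>, x) F.
     if F \<in> C_inf (prod_atlas std_atlas (atlas G))
     then frechet_derivative (\<lambda>\<psi>. F (\<psi>, \<one>\<^bsub>G\<^esub>)) (at 0) \<phi> + T x (\<lambda>g. F (0, g))
     else 0)"

definition cotangent_pair :: "('d \<Rightarrow> 'v \<Rightarrow> real) \<Rightarrow> 'v \<times> 'd \<Rightarrow> 'd \<times> 'v \<Rightarrow> real" where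
  "cotangent_pair pair = (\<lambda>(x, \<psi>) (\<phi>, y). pair \<phi> x + pair \<psi> y)"

definition cotangent_bracket :: "('d::ab_group_add \<Rightarrow> 'v \<Rightarrow> real) \<Rightarrow> ('v \<Rightarrow> 'v \<Rightarrow> 'v) \<Rightarrow>
    'd \<times> 'v \<Rightarrow> 'd \<times> 'v \<Rightarrow> 'd \<times> 'v" where
  "cotangent_bracket pair br = (\<lambda>(\<phi>, x) (\<psi>, y).
     (coad pair br x \<psi> - coad pair br y \<phi>, br x y))"

definition Xi_alpha :: "('d \<Rightarrow> 'v \<Rightarrow> real) \<Rightarrow> ('d \<Rightarrow> 'd \<Rightarrow> 'd) \<Rightarrow> 'd \<Rightarrow> 'd \<Rightarrow> 'v \<Rightarrow> real" where
  "Xi_alpha pair \<Xi> \<phi> \<psi> x = - pair (\<Xi> \<psi> \<phi>) x"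

text \<open>As a bilinear form on \<open>\<gg> \<oplus> \<gg>\<^sup>*\<close>, a tensor in \<open>\<gg> \<otimes> \<gg>\<close>, \<open>\<gg>\<^sup>* \<otimes> \<gg>\<^sup>*\<close> or
  \<open>\<gg> \<otimes> \<gg>\<^sup>*\<close> pairs with the components of its arguments in the respective duals. The
  cotangent bundle is connected, so at most one Poisson bracket makes it a Poisson-Lie group with
  this cobracket: this is the Poisson-Lie structure induced by \<open>\<Xi>\<close>.\<close>

definition cotangent_cobracket :: "('d \<Rightarrow> 'v \<Rightarrow> real) \<Rightarrow> ('v \<Rightarrow> 'v \<Rightarrow> 'v) \<Rightarrow>
    ('v \<Rightarrow> 'd \<Rightarrow> 'd \<Rightarrow> real) \<Rightarrow> ('d \<Rightarrow> 'd \<Rightarrow> 'd) \<Rightarrow>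
    'd \<times> 'v \<Rightarrow> 'v \<times> 'd \<Rightarrow> 'v \<times> 'd \<Rightarrow> real" where
  "cotangent_cobracket pair br \<delta> \<Xi> = (\<lambda>(\<phi>, X) (x1, \<psi>1) (x2, \<psi>2).
     \<delta> X \<psi>1 \<psi>2 + dual_cobracket pair br \<phi> x1 x2 +
     (Xi_alpha pair \<Xi> \<phi> \<psi>1 x2 - Xi_alpha pair \<Xi> \<phi> \<psi>2 x1))"

end

theory Submission
  imports Defs
begin

text \<open>Let \<open>K\<close> be a Poisson-Lie group and \<open>\<Theta>\<close> a pre-Lie structure on the dual of its Lie algebra.
  Left-invariant vector fields trivialise the cotangent bundle, so that 1-forms are functions
  \<open>s : K \<rightarrow> \<kk>\<^sup>*\<close>, and the preconnection is \<open>\<gamma>(a, s) = {a, s} + \<Theta>(da, s)\<close> with \<open>da : K \<rightarrow> \<kk>\<^sup>*\<close> the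
  left-trivialised differential. Differentiating the multiplicativity of the bracket in the second
  factor gives \<open>d{a,b} = {da,b} + {a,db} + [da,db]\<close> for the dual Lie bracket; hence
  \<open>\<Theta>(x,y) - \<Theta>(y,x) = [x,y]\<close> is Poisson compatibility, and the pre-Lie identity together with the
  Jacobi identity of the bracket is flatness. For the cotangent bundle, the dual Lie algebra is the
  semidirect product, and the commutator of any product satisfying the pre-Lie identity is a Lie bracket.\<close>

section \<open>Calculus of smooth maps\<close>

text \<open>Tangent vectors and vector fields are derivations of global smooth functions, and
  1-forms are functionals on vector fields; no coordinates are given. Two passages therefore carry
  the analytic weight. Global functions must imitate chart coordinates near a point, which is what
  bump functions are for. And each derivation at the identity must be a directional derivative in a
  chart; here it matters that the charts take values in the very space that \<open>T\<close>
  identifies with the tangent space. Left translation carries this to every other point, so that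
  fields, forms and the Poisson tensor get smooth coefficients in the left-invariant frame. The
  cobracket is defined by right translations while the trivialisation is on the left. The two meet
  at the identity, where multiplicativity makes the Poisson tensor vanish, so that the dual bracket
  of the differentials of f and h there is the differential of {f,h}. The bracket term in the
  formula for d{a,b} at g is this fact for the functions translated by g.\<close>

text \<open>By induction on the basis: the bound for \<open>B\<close> makes the coordinates of a
  convergent sequence of combinations Cauchy, so the span of \<open>B\<close> is closed and the new
  vector keeps a positive distance d from it. This is the equivalence of an arbitrary norm with the
  coordinate norm, as far as it is used.\<close>

lemma coordinates_bounded_by_norm:
  fixes B :: "'a::real_normed_vector set"
  assumes "finite B" "independent B"
  shows "\<exists>M\<ge>0. \<forall>r. (\<Sum>b\<in>B. \<bar>r b\<bar>) \<le> M * norm (\<Sum>b\<in>B. r b *\<^sub>R b)"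
  using assms
proof (induction B rule: finite_induct)
  case empty
  then show ?case by (intro exI[of _ 0]) auto
next
  case (insert a B)
  have indB: "independent B" and aB: "a \<notin> span B"
    using insert.prems insert.hyps by (auto simp: independent_insert)
  obtain M where M: "M \<ge> 0" "\<And>r. (\<Sum>b\<in>B. \<bar>r b\<bar>) \<le> M * norm (\<Sum>b\<in>B. r b *\<^sub>R b)"
    using insert.IH[OF indB] by blast
  let ?c = "\<lambda>r. \<Sum>b\<in>B. r b *\<^sub>R b"
  have "\<exists>d>0. \<forall>r. d \<le> norm (a - ?c r)"
  proof (rule ccontr)
    assume "\<not> ?thesis"
    then have "\<exists>r. norm (a - ?c r) < inverse (real (Suc n))" for n
      by (meson inverse_positive_iff_positive not_le of_nat_0_less_iff zero_less_Suc)
    then obtain r where r: "\<And>n. norm (a - ?c (r n)) < inverse (real (Suc n))" by metis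
    have lim: "(\<lambda>n. ?c (r n)) \<longlonglongrightarrow> a"
    proof (rule Lim_null_comparison[THEN LIM_zero_cancel])
      show "\<forall>\<^sub>F n in sequentially. norm (?c (r n) - a) \<le> inverse (real (Suc n))"
        using r by (intro always_eventually allI less_imp_le) (metis norm_minus_commute)
      show "(\<lambda>n. inverse (real (Suc n))) \<longlonglongrightarrow> 0" by (rule LIMSEQ_inverse_real_of_nat)
    qed
    have "\<exists>l. (\<lambda>n. r n b) \<longlonglongrightarrow> l" if b: "b \<in> B" for b
    proof -
      have "Cauchy (\<lambda>n. ?c (r n))" using lim by (auto intro: LIMSEQ_imp_Cauchy)
      have "Cauchy (\<lambda>n. r n b)"
      proof (rule CauchyI)
        fix e :: real assume e: "0 < e"
        \<comment> \<open>\<open>M\<close> may be 0, so the bound is weakened to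
          \<open>M + 1\<close> to permit division.\<close>
        have e': "e / (M + 1) > 0" using e M(1) by auto
        obtain N where N: "\<And>m n. m \<ge> N \<Longrightarrow> n \<ge> N \<Longrightarrow> norm (?c (r m) - ?c (r n)) < e / (M + 1)"
          using CauchyD[OF \<open>Cauchy _\<close> e'] by blast
        have "norm (r m b - r n b) < e" if "m \<ge> N" "n \<ge> N" for m n
        proof -
          have "\<bar>r m b - r n b\<bar> \<le> (\<Sum>b\<in>B. \<bar>r m b - r n b\<bar>)"
            using b insert.hyps(1) by (intro member_le_sum) auto
          also have "\<dots> \<le> M * norm (?c (\<lambda>b. r m b - r n b))" by (rule M(2))
          also have "?c (\<lambda>b. r m b - r n b) = ?c (r m) - ?c (r n)"
            by (simp add: scaleR_diff_left sum_subtractf)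
          also have "M * norm (?c (r m) - ?c (r n)) \<le> (M + 1) * norm (?c (r m) - ?c (r n))"
            by (simp add: mult_right_mono)
          also have "\<dots> < (M + 1) * (e / (M + 1))"
            using N[OF that] M(1) by (intro mult_strict_left_mono) auto
          finally show ?thesis using M(1) by simp
        qed
        then show "\<exists>N. \<forall>m\<ge>N. \<forall>n\<ge>N. norm (r m b - r n b) < e" by blast
      qed
      then show ?thesis by (simp add: Cauchy_convergent_iff convergent_def)
    qed
    then obtain l where l: "\<And>b. b \<in> B \<Longrightarrow> (\<lambda>n. r n b) \<longlonglongrightarrow> l b" by metis
    have "(\<lambda>n. ?c (r n)) \<longlonglongrightarrow> ?c l" by (intro tendsto_intros l)
    then have "a = ?c l" using lim LIMSEQ_unique by blast
    then show False using aB by (metis (no_types, lifting) span_base span_scale span_sum)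
  qed
  then obtain d where d: "d > 0" "\<And>r. d \<le> norm (a - ?c r)" by blast
  \<comment> \<open>Dividing the combination by \<open>r a\<close> exhibits it as \<open>a\<close>
    minus an element of the span of \<open>B\<close>.\<close>
  have main: "\<bar>r a\<bar> \<le> norm (r a *\<^sub>R a + ?c r) / d" for r
  proof (cases "r a = 0")
    case True then show ?thesis using d(1) by simp
  next
    case False
    have "r a *\<^sub>R a + ?c r = r a *\<^sub>R (a - ?c (\<lambda>b. - (r b / r a)))"
      using False by (simp add: scaleR_diff_right scaleR_add_right scaleR_sum_right sum_negf)
    then have "norm (r a *\<^sub>R a + ?c r) = \<bar>r a\<bar> * norm (a - ?c (\<lambda>b. - (r b / r a)))" by simp
    also have "\<dots> \<ge> \<bar>r a\<bar> * d" by (rule mult_left_mono[OF d(2)]) simp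
    finally show ?thesis using d(1) by (simp add: pos_le_divide_eq)
  qed
  \<comment> \<open>The summand 1 / d pays for \<open>\<bar>r a\<bar>\<close>; the part over
    \<open>B\<close> has norm at most norm x + \<open>\<bar>r a\<bar>\<close> norm a, where again
    \<open>\<bar>r a\<bar>\<close> is at most norm x / d.\<close>
  let ?M = "1 / d + M * (1 + norm a / d)"
  have "(\<Sum>b\<in>insert a B. \<bar>r b\<bar>) \<le> ?M * norm (\<Sum>b\<in>insert a B. r b *\<^sub>R b)" for r
  proof -
    let ?x = "r a *\<^sub>R a + ?c r"
    have "norm (?c r) \<le> norm ?x + norm (r a *\<^sub>R a)"
      by (metis add_diff_cancel_left' add.commute norm_triangle_ineq4)
    also have "\<dots> \<le> norm ?x + norm ?x / d * norm a" using mult_right_mono[OF main[of r], of "norm a"] by simp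
    finally have "M * norm (?c r) \<le> M * (norm ?x + norm ?x / d * norm a)" using M(1) by (rule mult_left_mono)
    then have "\<bar>r a\<bar> + (\<Sum>b\<in>B. \<bar>r b\<bar>) \<le> norm ?x / d + M * (norm ?x + norm ?x / d * norm a)"
      using main[of r] M(2)[of r] by linarith
    also have "\<dots> = ?M * norm ?x" by (simp add: algebra_simps)
    finally show ?thesis using insert.hyps by simp
  qed
  moreover have "?M \<ge> 0" using d(1) M(1) by simp
  ultimately show ?case by blast
qed

lemma ex_is_basis: "\<exists>B::'a::fin_dim_normed_vector set. is_basis B"
proof -
  obtain S :: "'a set" where S: "finite S" "span S = UNIV" using ex_finite_span by blast
  obtain B where B: "B \<subseteq> S" "independent B" "S \<subseteq> span B"
    using maximal_independent_subset[of S] by blast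
  have "span B = UNIV"
    using S(2) span_mono[OF B(3)] by (simp add: span_span top.extremum_unique)
  then show ?thesis using B(2) finite_subset[OF B(1) S(1)] by (intro exI[of _ B]) (simp add: is_basis_def)
qed

lemma is_basis_sum_representation:
  assumes "is_basis B" shows "(\<Sum>b\<in>B. representation B x b *\<^sub>R b) = x"
  using assms unfolding is_basis_def by (intro sum_representation_eq) auto

lemma linear_is_basis_eq:
  assumes "is_basis B" "linear f" shows "f x = (\<Sum>b\<in>B. representation B x b *\<^sub>R f b)"
  using is_basis_sum_representation[OF assms(1), of x] assms(2)
  by (metis (no_types, lifting) linear_sum linear_scale sum.cong)

lemma linear_representation:
  assumes "is_basis B" shows "linear (\<lambda>x. representation B x b)"
  using assms unfolding is_basis_def
  by (intro linearI) (simp_all add: representation_add representation_scale)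

text \<open>The image is a combination of the finitely many \<open>f b\<close> whose coefficients
  the coordinate bound controls.\<close>

lemma linear_imp_bounded_linear:
  fixes f :: "'a::fin_dim_normed_vector \<Rightarrow> 'b::real_normed_vector"
  assumes "linear f" shows "bounded_linear f"
proof -
  obtain B :: "'a set" where B: "is_basis B" using ex_is_basis by blast
  obtain M where M: "M \<ge> 0" "\<And>r. (\<Sum>b\<in>B. \<bar>r b\<bar>) \<le> M * norm (\<Sum>b\<in>B. r b *\<^sub>R b)"
    using coordinates_bounded_by_norm[of B] B unfolding is_basis_def by blast
  have fin: "finite B" using B by (simp add: is_basis_def)
  let ?K = "\<Sum>b\<in>B. norm (f b)"
  have "norm (f x) \<le> norm x * (M * ?K)" for x
  proof -
    have "norm (f x) \<le> (\<Sum>b\<in>B. \<bar>representation B x b\<bar> * norm (f b))"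
      unfolding linear_is_basis_eq[OF B assms, of x] by (rule sum_norm_le) simp
    also have "\<dots> \<le> (\<Sum>b\<in>B. \<bar>representation B x b\<bar> * ?K)"
      using fin by (intro sum_mono mult_left_mono member_le_sum) auto
    also have "\<dots> = (\<Sum>b\<in>B. \<bar>representation B x b\<bar>) * ?K" by (simp add: sum_distrib_right)
    also have "\<dots> \<le> (M * norm x) * ?K"
      using M(2)[of "representation B x"] is_basis_sum_representation[OF B, of x]
      by (intro mult_right_mono) (auto intro: sum_nonneg)
    finally show ?thesis by (simp add: mult_ac)
  qed
  then show ?thesis using assms by (intro bounded_linear_intro[where K = "M * ?K"]) (auto simp: linear_add linear_scale)
qed

section \<open>Closure properties of C^k and smooth maps\<close>

lemma Ck_on_Suc_has_derivative:
  "Ck_on (Suc k) f S \<Longrightarrow> x \<in> S \<Longrightarrow> (f has_derivative frechet_derivative f (at x)) (at x)"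
  unfolding Ck_on.simps using frechet_derivative_works by blast

lemma Ck_on_Suc_derivative: "Ck_on (Suc k) f S \<Longrightarrow> Ck_on k (\<lambda>x. frechet_derivative f (at x) v) S"
  by simp

text \<open>Openness matters because \<open>frechet_derivative\<close> is taken in the whole space:
  the two functions have to agree on a neighbourhood of each point.\<close>

lemma Ck_on_cong:
  assumes "open S" "\<And>x. x \<in> S \<Longrightarrow> f x = g x" "Ck_on k f S"
  shows "Ck_on k g S"
  using assms(2,3)
proof (induction k arbitrary: f g)
  case 0 then show ?case by (simp cong: continuous_on_cong)
next
  case (Suc k)
  have d: "(g has_derivative frechet_derivative f (at x)) (at x)" if "x \<in> S" for x
    by (rule has_derivative_transform_within_open[OF Ck_on_Suc_has_derivative[OF Suc.prems(2) that] assms(1) that Suc.prems(1)])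
  have e: "frechet_derivative f (at x) = frechet_derivative g (at x)" if "x \<in> S" for x
    by (rule frechet_derivative_at[OF d[OF that]])
  have "Ck_on k (\<lambda>x. frechet_derivative g (at x) v) S" for v
    by (rule Suc.IH[OF _ Ck_on_Suc_derivative[OF Suc.prems(2)]]) (simp only: e)
  moreover have "\<forall>x\<in>S. g differentiable at x" using d differentiable_def by blast
  ultimately show ?case by (simp only: Ck_on.simps) blast
qed

lemma Ck_on_subset: "Ck_on k f S \<Longrightarrow> S' \<subseteq> S \<Longrightarrow> Ck_on k f S'"
  by (induction k arbitrary: f) (auto intro: continuous_on_subset)

lemma Ck_on_local:
  "(\<And>x. x \<in> S \<Longrightarrow> \<exists>W. open W \<and> x \<in> W \<and> Ck_on k f W) \<Longrightarrow> Ck_on k f S"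
proof (induction k arbitrary: f)
  case 0
  have "isCont f x" if x: "x \<in> S" for x
    using 0[OF x] by (auto simp: continuous_on_eq_continuous_at)
  then show ?case by (simp add: continuous_at_imp_continuous_on)
next
  case (Suc k)
  have "f differentiable at x" if "x \<in> S" for x using Suc.prems[OF that] by auto
  moreover have "Ck_on k (\<lambda>x. frechet_derivative f (at x) v) S" for v
    using Suc.prems by (intro Suc.IH) fastforce
  ultimately show ?case by simp
qed

lemma Ck_on_Suc_D: "Ck_on (Suc k) f S \<Longrightarrow> Ck_on k f S"
proof (induction k arbitrary: f)
  case 0
  then show ?case
    by (auto intro!: continuous_at_imp_continuous_on dest: differentiable_imp_continuous_within)
next
  case (Suc k)
  have "Ck_on k (\<lambda>x. frechet_derivative f (at x) v) S" for v
    using Suc.prems by (intro Suc.IH) simp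
  then show ?case using Suc.prems by simp
qed

lemma Ck_on_SucI:
  assumes "open S" "\<And>x. x \<in> S \<Longrightarrow> (f has_derivative f' x) (at x)" "\<And>v. Ck_on k (\<lambda>x. f' x v) S"
  shows "Ck_on (Suc k) f S"
proof -
  have "frechet_derivative f (at x) = f' x" if "x \<in> S" for x
    using assms(2)[OF that] frechet_derivative_at by metis
  then have "Ck_on k (\<lambda>x. frechet_derivative f (at x) v) S" for v
    by (intro Ck_on_cong[OF assms(1) _ assms(3)[of v]]) simp
  then show ?thesis using assms(2) by (auto simp: differentiable_def)
qed

lemma Ck_on_const: "open S \<Longrightarrow> Ck_on k (\<lambda>x. c) S"
proof (induction k arbitrary: c)
  case (Suc k)
  then show ?case by (intro Ck_on_SucI[where f' = "\<lambda>x v. 0"]) auto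
qed auto

lemma Ck_on_bounded_linear:
  assumes "open S" "bounded_linear L" shows "Ck_on k L S"
proof (cases k)
  case 0 then show ?thesis using assms(2) by (simp add: linear_continuous_on)
next
  case (Suc n)
  have "Ck_on (Suc n) L S"
    by (rule Ck_on_SucI[where f' = "\<lambda>x. L"])
       (simp_all only: assms Ck_on_const bounded_linear_imp_has_derivative)
  then show ?thesis by (simp only: Suc)
qed

lemma Ck_on_linear_compose:
  "open S \<Longrightarrow> bounded_linear L \<Longrightarrow> Ck_on k f S \<Longrightarrow> Ck_on k (\<lambda>x. L (f x)) S"
proof (induction k arbitrary: f)
  case 0
  then show ?case by (simp add: bounded_linear.continuous_on)
next
  case (Suc k)
  show ?case
  proof (rule Ck_on_SucI[OF Suc.prems(1), where f' = "\<lambda>x v. L (frechet_derivative f (at x) v)"])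
    show "((\<lambda>x. L (f x)) has_derivative (\<lambda>v. L (frechet_derivative f (at x) v))) (at x)" if "x \<in> S" for x
      by (rule bounded_linear.has_derivative[OF Suc.prems(2) Ck_on_Suc_has_derivative[OF Suc.prems(3) that]])
    show "Ck_on k (\<lambda>x. L (frechet_derivative f (at x) v)) S" for v
      by (rule Suc.IH[OF Suc.prems(1,2) Ck_on_Suc_derivative[OF Suc.prems(3)]])
  qed
qed

lemma Ck_on_add:
  "open S \<Longrightarrow> Ck_on k f S \<Longrightarrow> Ck_on k g S \<Longrightarrow> Ck_on k (\<lambda>x. f x + g x) S"
proof (induction k arbitrary: f g)
  case 0
  then show ?case by (simp add: continuous_on_add)
next
  case (Suc k)
  show ?case
  proof (rule Ck_on_SucI[OF Suc.prems(1), where f' = "\<lambda>x v. frechet_derivative f (at x) v + frechet_derivative g (at x) v"])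
    show "((\<lambda>x. f x + g x) has_derivative (\<lambda>v. frechet_derivative f (at x) v + frechet_derivative g (at x) v)) (at x)"
      if "x \<in> S" for x
      by (rule has_derivative_add[OF Ck_on_Suc_has_derivative[OF Suc.prems(2) that] Ck_on_Suc_has_derivative[OF Suc.prems(3) that]])
    show "Ck_on k (\<lambda>x. frechet_derivative f (at x) v + frechet_derivative g (at x) v) S" for v
      by (rule Suc.IH[OF Suc.prems(1) Ck_on_Suc_derivative[OF Suc.prems(2)] Ck_on_Suc_derivative[OF Suc.prems(3)]])
  qed
qed

lemma Ck_on_scaleR:
  fixes f :: "'a::real_normed_vector \<Rightarrow> real"
  shows "open S \<Longrightarrow> Ck_on k f S \<Longrightarrow> Ck_on k g S \<Longrightarrow> Ck_on k (\<lambda>x. f x *\<^sub>R g x) S"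
proof (induction k arbitrary: f g)
  case 0
  then show ?case by (auto intro!: continuous_intros)
next
  case (Suc k)
  show ?case
  proof (rule Ck_on_SucI[OF Suc.prems(1), where f' =
        "\<lambda>x v. f x *\<^sub>R frechet_derivative g (at x) v + frechet_derivative f (at x) v *\<^sub>R g x"])
    show "((\<lambda>x. f x *\<^sub>R g x) has_derivative
      (\<lambda>v. f x *\<^sub>R frechet_derivative g (at x) v + frechet_derivative f (at x) v *\<^sub>R g x)) (at x)" if "x \<in> S" for x
      by (rule has_derivative_scaleR[OF Ck_on_Suc_has_derivative[OF Suc.prems(2) that] Ck_on_Suc_has_derivative[OF Suc.prems(3) that]])
    show "Ck_on k (\<lambda>x. f x *\<^sub>R frechet_derivative g (at x) v + frechet_derivative f (at x) v *\<^sub>R g x) S" for v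
      by (rule Ck_on_add[OF Suc.prems(1)
            Suc.IH[OF Suc.prems(1) Ck_on_Suc_D[OF Suc.prems(2)] Ck_on_Suc_derivative[OF Suc.prems(3)]]
            Suc.IH[OF Suc.prems(1) Ck_on_Suc_derivative[OF Suc.prems(2)] Ck_on_Suc_D[OF Suc.prems(3)]]])
  qed
qed

lemma Ck_on_sum:
  "open S \<Longrightarrow> (\<And>i. i \<in> I \<Longrightarrow> Ck_on k (f i) S) \<Longrightarrow> Ck_on k (\<lambda>x. \<Sum>i\<in>I. f i x) S"
  by (induction I rule: infinite_finite_induct) (simp_all add: Ck_on_const Ck_on_add)

text \<open>The chain rule differentiates g in a direction that varies with x, whereas
  \<open>Ck_on\<close> speaks of fixed directions only. Expanding the varying direction in a basis
  gives a sum of products to which the induction hypothesis applies; this is why the middle space is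
  finite-dimensional.\<close>

lemma Ck_on_compose:
  fixes f :: "'a::real_normed_vector \<Rightarrow> 'b::fin_dim_normed_vector" and g :: "'b \<Rightarrow> 'c::real_normed_vector"
  shows "open S \<Longrightarrow> open S' \<Longrightarrow> f ` S \<subseteq> S' \<Longrightarrow> Ck_on k f S \<Longrightarrow> Ck_on k g S' \<Longrightarrow> Ck_on k (\<lambda>x. g (f x)) S"
proof (induction k arbitrary: g)
  case 0
  then show ?case by (auto intro: continuous_on_compose2)
next
  case (Suc k)
  obtain B :: "'b set" where B: "is_basis B" using ex_is_basis by blast
  let ?D = "\<lambda>x v. \<Sum>b\<in>B. representation B (frechet_derivative f (at x) v) b *\<^sub>R frechet_derivative g (at (f x)) b"
  show ?case
  proof (rule Ck_on_SucI[OF Suc.prems(1), where f' = ?D])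
    fix x assume x: "x \<in> S"
    have g: "(g has_derivative frechet_derivative g (at (f x))) (at (f x))"
      using Ck_on_Suc_has_derivative[OF Suc.prems(5)] Suc.prems(3) x by blast
    have "((\<lambda>x. g (f x)) has_derivative (\<lambda>v. frechet_derivative g (at (f x)) (frechet_derivative f (at x) v))) (at x)"
      using has_derivative_compose[OF Ck_on_Suc_has_derivative[OF Suc.prems(4) x] g] .
    also have "(\<lambda>v. frechet_derivative g (at (f x)) (frechet_derivative f (at x) v)) = ?D x"
      by (intro ext linear_is_basis_eq[OF B] has_derivative_linear[OF g])
    finally show "((\<lambda>x. g (f x)) has_derivative ?D x) (at x)" .
  next
    fix v
    show "Ck_on k (\<lambda>x. ?D x v) S"
    proof (rule Ck_on_sum[OF Suc.prems(1)], rule Ck_on_scaleR[OF Suc.prems(1)])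
      fix b
      show "Ck_on k (\<lambda>x. representation B (frechet_derivative f (at x) v) b) S"
        by (rule Ck_on_linear_compose[OF Suc.prems(1) linear_imp_bounded_linear[OF linear_representation[OF B]]
              Ck_on_Suc_derivative[OF Suc.prems(4)]])
      show "Ck_on k (\<lambda>x. frechet_derivative g (at (f x)) b) S"
        by (rule Suc.IH[OF Suc.prems(1-3) Ck_on_Suc_D[OF Suc.prems(4)] Ck_on_Suc_derivative[OF Suc.prems(5)]])
    qed
  qed
qed

lemma Ck_on_inverse: "Ck_on k (inverse :: real \<Rightarrow> real) (- {0})"
proof (induction k)
  case 0 show ?case by (auto intro!: continuous_intros)
next
  case (Suc k)
  show ?case
  proof (rule Ck_on_SucI[where f' = "\<lambda>x v. (inverse x *\<^sub>R inverse x) *\<^sub>R (- v)"])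
    show "(inverse has_derivative (\<lambda>v. (inverse x *\<^sub>R inverse x) *\<^sub>R (- v))) (at x)" if "x \<in> - {0}" for x :: real
      using that by (auto intro!: derivative_eq_intros)
    have o: "open (- {0::real})" by auto
    show "Ck_on k (\<lambda>x. (inverse x *\<^sub>R inverse x) *\<^sub>R (- v)) (- {0})" for v :: real
      by (rule Ck_on_scaleR[OF o Ck_on_scaleR[OF o Suc.IH Suc.IH] Ck_on_const[OF o]])
  qed auto
qed

lemma smooth_on_cong:
  assumes "open S" "\<And>x. x \<in> S \<Longrightarrow> f x = g x" "smooth_on f S"
  shows "smooth_on g S"
  unfolding smooth_on_def
  by (intro allI, rule Ck_on_cong[OF assms(1,2)]) (use assms(3) in \<open>simp_all add: smooth_on_def\<close>)

lemma smooth_on_subset: "smooth_on f S \<Longrightarrow> S' \<subseteq> S \<Longrightarrow> smooth_on f S'"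
  unfolding smooth_on_def by (intro allI, rule Ck_on_subset) auto

lemma smooth_on_local:
  "(\<And>x. x \<in> S \<Longrightarrow> \<exists>W. open W \<and> x \<in> W \<and> smooth_on f W) \<Longrightarrow> smooth_on f S"
  unfolding smooth_on_def by (intro allI, rule Ck_on_local) blast

lemma smooth_on_continuous: "smooth_on f S \<Longrightarrow> continuous_on S f"
  unfolding smooth_on_def by (drule spec[of _ 0]) simp

lemma smooth_on_Suc: "smooth_on f S \<Longrightarrow> Ck_on (Suc k) f S"
  unfolding smooth_on_def by blast

lemma smooth_on_has_derivative:
  "smooth_on f S \<Longrightarrow> x \<in> S \<Longrightarrow> (f has_derivative frechet_derivative f (at x)) (at x)"
  by (rule Ck_on_Suc_has_derivative[OF smooth_on_Suc[of f S 0]])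

lemma smooth_on_derivative: "smooth_on f S \<Longrightarrow> smooth_on (\<lambda>x. frechet_derivative f (at x) v) S"
  unfolding smooth_on_def by (intro allI Ck_on_Suc_derivative) blast

lemma smooth_on_const: "open S \<Longrightarrow> smooth_on (\<lambda>x. c) S"
  by (simp add: smooth_on_def Ck_on_const)

lemma smooth_on_bounded_linear: "open S \<Longrightarrow> bounded_linear L \<Longrightarrow> smooth_on L S"
  by (simp add: smooth_on_def Ck_on_bounded_linear)

lemma smooth_on_linear_compose:
  "open S \<Longrightarrow> bounded_linear L \<Longrightarrow> smooth_on f S \<Longrightarrow> smooth_on (\<lambda>x. L (f x)) S"
  by (simp add: smooth_on_def Ck_on_linear_compose)

lemma smooth_on_add: "open S \<Longrightarrow> smooth_on f S \<Longrightarrow> smooth_on g S \<Longrightarrow> smooth_on (\<lambda>x. f x + g x) S"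
  by (simp add: smooth_on_def Ck_on_add)

lemma smooth_on_mult:
  fixes f g :: "'a::real_normed_vector \<Rightarrow> real"
  shows "open S \<Longrightarrow> smooth_on f S \<Longrightarrow> smooth_on g S \<Longrightarrow> smooth_on (\<lambda>x. f x * g x) S"
  using Ck_on_scaleR[of S _ f g] by (simp add: smooth_on_def)

lemma smooth_on_sum:
  "open S \<Longrightarrow> (\<And>i. i \<in> I \<Longrightarrow> smooth_on (f i) S) \<Longrightarrow> smooth_on (\<lambda>x. \<Sum>i\<in>I. f i x) S"
  by (simp add: smooth_on_def Ck_on_sum)

lemma smooth_on_compose:
  fixes f :: "'a::real_normed_vector \<Rightarrow> 'b::fin_dim_normed_vector" and g :: "'b \<Rightarrow> 'c::real_normed_vector"
  shows "open S \<Longrightarrow> open S' \<Longrightarrow> f ` S \<subseteq> S' \<Longrightarrow> smooth_on f S \<Longrightarrow> smooth_on g S' \<Longrightarrow> smooth_on (\<lambda>x. g (f x)) S"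
  unfolding smooth_on_def by (intro allI, rule Ck_on_compose[of S S']) simp_all

lemma smooth_on_inverse: "smooth_on (inverse :: real \<Rightarrow> real) (- {0})"
  by (simp add: smooth_on_def Ck_on_inverse)

lemma smooth_on_Pair:
  assumes "open S" "smooth_on f S" "smooth_on g S" shows "smooth_on (\<lambda>x. (f x, g x)) S"
proof -
  have L: "bounded_linear (\<lambda>y. (y, 0))" "bounded_linear (\<lambda>y. (0, y))"
    by (intro bounded_linear_Pair bounded_linear_ident bounded_linear_zero)+
  have "smooth_on (\<lambda>x. (f x, 0) + (0, g x)) S"
    by (rule smooth_on_add[OF assms(1) smooth_on_linear_compose[OF assms(1) L(1) assms(2)]
          smooth_on_linear_compose[OF assms(1) L(2) assms(3)]])
  then show ?thesis by simp
qed

text \<open>The second difference on the left is symmetric in \<open>v\<close> and \<open>w\<close>, which yields the symmetry of second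
  derivatives.\<close>

lemma second_difference_mvt:
  fixes f :: "'a::real_normed_vector \<Rightarrow> real"
  assumes "Ck_on (Suc (Suc 0)) f S" "0 < h"
    and S: "\<And>s t. 0 \<le> s \<Longrightarrow> s \<le> h \<Longrightarrow> 0 \<le> t \<Longrightarrow> t \<le> h \<Longrightarrow> p + s *\<^sub>R v + t *\<^sub>R w \<in> S"
  shows "\<exists>s t. 0 \<le> s \<and> s \<le> h \<and> 0 \<le> t \<and> t \<le> h \<and>
    f (p + h *\<^sub>R v + h *\<^sub>R w) - f (p + h *\<^sub>R v) - f (p + h *\<^sub>R w) + f p =
    h\<^sup>2 * frechet_derivative (\<lambda>x. frechet_derivative f (at x) v) (at (p + s *\<^sub>R v + t *\<^sub>R w)) w"
proof -
  let ?Df = "\<lambda>x. frechet_derivative f (at x) v"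
  let ?q = "\<lambda>s t. p + s *\<^sub>R v + t *\<^sub>R w"
  have df: "(f has_derivative frechet_derivative f (at x)) (at x)" if "x \<in> S" for x
    using Ck_on_Suc_has_derivative[OF assms(1) that] .
  have d2f: "(?Df has_derivative frechet_derivative ?Df (at x)) (at x)" if "x \<in> S" for x
    using Ck_on_Suc_has_derivative[OF Ck_on_Suc_derivative[OF assms(1)] that] .
  have 1: "((\<lambda>s. f (?q s t)) has_real_derivative ?Df (?q s t)) (at s)"
    if "0 \<le> s" "s \<le> h" "0 \<le> t" "t \<le> h" for s t
  proof -
    have "((\<lambda>s. ?q s t) has_derivative (\<lambda>r. r *\<^sub>R v)) (at s)" by (auto intro!: derivative_eq_intros)
    from has_derivative_compose[OF this df[OF S[OF that]]]
    have "((\<lambda>s. f (?q s t)) has_derivative (\<lambda>r. frechet_derivative f (at (?q s t)) (r *\<^sub>R v))) (at s)" .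
    then show ?thesis
      using has_derivative_linear[OF df[OF S[OF that]]]
      by (simp add: has_field_derivative_def linear_scale mult_commute_abs)
  qed
  have 2: "((\<lambda>t. ?Df (?q s t)) has_real_derivative frechet_derivative ?Df (at (?q s t)) w) (at t)"
    if "0 \<le> s" "s \<le> h" "0 \<le> t" "t \<le> h" for s t
  proof -
    have "((\<lambda>t. ?q s t) has_derivative (\<lambda>r. r *\<^sub>R w)) (at t)" by (auto intro!: derivative_eq_intros)
    from has_derivative_compose[OF this d2f[OF S[OF that]]]
    have "((\<lambda>t. ?Df (?q s t)) has_derivative (\<lambda>r. frechet_derivative ?Df (at (?q s t)) (r *\<^sub>R w))) (at t)" .
    then show ?thesis
      using has_derivative_linear[OF d2f[OF S[OF that]]]
      by (simp add: has_field_derivative_def linear_scale mult_commute_abs)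
  qed
  \<comment> \<open>The mean value theorem along \<open>v\<close> is applied to the increment of f
    over \<open>h *\<^sub>R w\<close>; a second application along \<open>w\<close> then treats the
    resulting increment of \<open>?Df\<close>.\<close>
  have "\<exists>s>0. s < h \<and> (f (?q h h) - f (?q h 0)) - (f (?q 0 h) - f (?q 0 0)) = (h - 0) * (?Df (?q s h) - ?Df (?q s 0))"
    by (rule MVT2[OF assms(2)]) (rule DERIV_diff[OF 1 1], use assms(2) in auto)
  then obtain s where s: "0 < s" "s < h"
    "(f (?q h h) - f (?q h 0)) - (f (?q 0 h) - f (?q 0 0)) = h * (?Df (?q s h) - ?Df (?q s 0))" by auto
  have "\<exists>t>0. t < h \<and> ?Df (?q s h) - ?Df (?q s 0) = (h - 0) * frechet_derivative ?Df (at (?q s t)) w"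
    by (rule MVT2[OF assms(2)]) (rule 2, use assms(2) s in auto)
  then obtain t where t: "0 < t" "t < h" "?Df (?q s h) - ?Df (?q s 0) = h * frechet_derivative ?Df (at (?q s t)) w" by auto
  show ?thesis
    using s t by (intro exI[of _ s] exI[of _ t]) (simp add: power2_eq_square algebra_simps)
qed

text \<open>The same second difference divided by h^2 equals one mixed derivative at some point of a
  small parallelogram at p and the other one at another point; continuity at p forces the two values
  there to coincide. This is Schwarz's theorem.\<close>

lemma frechet_derivative_commute:
  fixes f :: "'a::real_normed_vector \<Rightarrow> real"
  assumes "Ck_on (Suc (Suc 0)) f S" "open S" "p \<in> S"
  shows "frechet_derivative (\<lambda>x. frechet_derivative f (at x) v) (at p) w =
         frechet_derivative (\<lambda>x. frechet_derivative f (at x) w) (at p) v"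
proof -
  let ?F = "\<lambda>v w x. frechet_derivative (\<lambda>x. frechet_derivative f (at x) v) (at x) w"
  have "\<bar>?F v w p - ?F w v p\<bar> \<le> e" if e: "e > 0" for e
  proof -
    have cont: "continuous (at p) (?F v w)" for v w
      using assms by (simp add: continuous_on_eq_continuous_at)
    have "\<exists>d>0. \<forall>x. dist x p < d \<longrightarrow> \<bar>?F v w x - ?F v w p\<bar> < e / 2" for v w
      using cont[of v w] e unfolding continuous_at_eps_delta
      by (metis dist_real_def half_gt_zero)
    then obtain d1 d2 where d: "d1 > 0" "\<And>x. dist x p < d1 \<Longrightarrow> \<bar>?F v w x - ?F v w p\<bar> < e / 2"
      "d2 > 0" "\<And>x. dist x p < d2 \<Longrightarrow> \<bar>?F w v x - ?F w v p\<bar> < e / 2" by metis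
    obtain d3 where d3: "d3 > 0" "ball p d3 \<subseteq> S" using assms(2,3) open_contains_ball by blast
    define m where "m = min d3 (min d1 d2)"
    \<comment> \<open>The summand 1 keeps \<open>N\<close> positive when both directions vanish; the
      choice of \<open>h\<close> below then keeps the parallelogram within m / 2 of p.\<close>
    define N where "N = norm v + norm w + 1"
    define h where "h = m / (2 * N)"
    have m: "m > 0" using d d3 by (simp add: m_def)
    have nz: "N > 0" by (simp add: add_nonneg_pos N_def)
    have h: "h > 0" using m nz by (simp add: h_def)
    have near: "dist (p + s *\<^sub>R v + t *\<^sub>R w) p < m" if "0 \<le> s" "s \<le> h" "0 \<le> t" "t \<le> h" for s t
    proof -
      have "dist (p + s *\<^sub>R v + t *\<^sub>R w) p = norm (s *\<^sub>R v + t *\<^sub>R w)" by (simp add: dist_norm)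
      also have "\<dots> \<le> s * norm v + t * norm w"
        using that by (intro norm_triangle_le) simp
      also have "\<dots> \<le> h * norm v + h * norm w" using that by (intro add_mono mult_right_mono) auto
      also have "\<dots> \<le> h * N" using h by (simp add: algebra_simps N_def)
      also have "\<dots> = m / 2" using nz by (simp add: h_def)
      also have "\<dots> < m" using m by simp
      finally show ?thesis .
    qed
    have inS: "p + s *\<^sub>R v + t *\<^sub>R w \<in> S" if "0 \<le> s" "s \<le> h" "0 \<le> t" "t \<le> h" for s t
      using near[OF that] d3(2) by (auto simp: m_def dist_commute)
    obtain s t where st: "0 \<le> s" "s \<le> h" "0 \<le> t" "t \<le> h"
      "f (p + h *\<^sub>R v + h *\<^sub>R w) - f (p + h *\<^sub>R v) - f (p + h *\<^sub>R w) + f p = h\<^sup>2 * ?F v w (p + s *\<^sub>R v + t *\<^sub>R w)"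
      using second_difference_mvt[OF assms(1) h inS] by blast
    have inS': "p + s *\<^sub>R w + t *\<^sub>R v \<in> S" if "0 \<le> s" "s \<le> h" "0 \<le> t" "t \<le> h" for s t
      using inS[of t s] that by (simp add: add_ac)
    obtain s' t' where st': "0 \<le> s'" "s' \<le> h" "0 \<le> t'" "t' \<le> h"
      "f (p + h *\<^sub>R w + h *\<^sub>R v) - f (p + h *\<^sub>R w) - f (p + h *\<^sub>R v) + f p = h\<^sup>2 * ?F w v (p + s' *\<^sub>R w + t' *\<^sub>R v)"
      using second_difference_mvt[OF assms(1) h inS'] by blast
    have "h\<^sup>2 * ?F v w (p + s *\<^sub>R v + t *\<^sub>R w) = h\<^sup>2 * ?F w v (p + s' *\<^sub>R w + t' *\<^sub>R v)"
    proof -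
      have "p + h *\<^sub>R v + h *\<^sub>R w = p + h *\<^sub>R w + h *\<^sub>R v" by (simp only: add_ac)
      then show ?thesis using st(5) st'(5) by (smt (verit))
    qed
    then have eq: "?F v w (p + s *\<^sub>R v + t *\<^sub>R w) = ?F w v (p + s' *\<^sub>R w + t' *\<^sub>R v)" using h by simp
    have "\<bar>?F v w (p + s *\<^sub>R v + t *\<^sub>R w) - ?F v w p\<bar> < e / 2"
      using near[OF st(1-4)] by (intro d(2)) (simp add: m_def)
    moreover have "\<bar>?F w v (p + s' *\<^sub>R w + t' *\<^sub>R v) - ?F w v p\<bar> < e / 2"
      using near[OF st'(3,4,1,2)] by (intro d(4)) (simp add: m_def add_ac)
    ultimately show ?thesis using eq by linarith
  qed
  then have "\<bar>?F v w p - ?F w v p\<bar> \<le> 0" by (rule field_le_epsilon[OF _, where y = 0, unfolded add_0])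
  then show ?thesis by simp
qed

section \<open>Bump functions\<close>

text \<open>The powers of 1/t make the family closed under differentiation up to linear
  combinations, so a single induction, general in n, yields smoothness of exp (-1/t) extended by
  0.\<close>

definition flat_exp :: "nat \<Rightarrow> real \<Rightarrow> real" where
  "flat_exp n t = (if t > 0 then inverse t ^ n * exp (- inverse t) else 0)"

lemma flat_exp_tendsto_0: "(flat_exp n \<longlongrightarrow> 0) (at 0)"
proof (rule filterlim_split_at)
  show "(flat_exp n \<longlongrightarrow> 0) (at_left 0)"
    by (rule tendsto_eventually) (auto simp: eventually_at_left_field flat_exp_def intro: exI[of _ "-1"])
  have "((\<lambda>t. inverse t ^ n / exp (inverse t)) \<longlongrightarrow> 0) (at_right (0::real))"
    by (rule filterlim_compose[OF tendsto_power_div_exp_0 filterlim_inverse_at_top_right])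
  then show "(flat_exp n \<longlongrightarrow> 0) (at_right 0)"
    by (rule Lim_transform_eventually)
       (auto simp: eventually_at_right_field flat_exp_def exp_minus field_simps intro!: exI[of _ 1])
qed

lemma flat_exp_DERIV: "(flat_exp n has_real_derivative flat_exp (n + 2) t - real n * flat_exp (n + 1) t) (at t)"
proof -
  consider "t < 0" | "t = 0" | "t > 0" by linarith
  then show ?thesis
  proof cases
    case 1
    have "((\<lambda>x. 0) has_real_derivative flat_exp (n + 2) t - real n * flat_exp (n + 1) t) (at t)"
      using 1 by (simp add: flat_exp_def)
    then show ?thesis
      by (rule has_field_derivative_transform_within_open[where S = "{..<0}"]) (use 1 in \<open>auto simp: flat_exp_def\<close>)
  next
    case 2
    \<comment> \<open>Since \<open>flat_exp n 0 = 0\<close>, the difference quotient at 0 is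
      \<open>flat_exp (Suc n)\<close>, which tends to 0.\<close>
    have "((\<lambda>h. (flat_exp n (0 + h) - flat_exp n 0) / h) \<longlongrightarrow> 0) (at 0)"
      by (rule Lim_transform_eventually[OF flat_exp_tendsto_0[of "Suc n"]])
         (auto simp: flat_exp_def eventually_at_filter divide_inverse)
    then show ?thesis using 2 by (simp add: DERIV_def flat_exp_def)
  next
    case 3
    have "((\<lambda>t. inverse t ^ n * exp (- inverse t)) has_real_derivative
        flat_exp (n + 2) t - real n * flat_exp (n + 1) t) (at t)"
    proof -
      have "((\<lambda>t. inverse t ^ n * exp (- inverse t)) has_real_derivative
         real n * (- (inverse t * inverse t) * inverse t ^ (n - Suc 0)) * exp (- inverse t) +
         (exp (- inverse t) * (inverse t * inverse t)) * inverse t ^ n) (at t)"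
        using 3 by (auto intro!: derivative_eq_intros)
      \<comment> \<open>The truncated exponent \<open>n - Suc 0\<close> does no harm for n = 0,
        where the factor \<open>real n\<close> vanishes.\<close>
      moreover have "real n * (- (inverse t * inverse t) * inverse t ^ (n - Suc 0)) = - (real n * inverse t ^ (n + 1))"
        by (cases n) simp_all
      ultimately show ?thesis using 3 by (cases n) (simp_all add: flat_exp_def algebra_simps)
    qed
    then show ?thesis
      by (rule has_field_derivative_transform_within_open[where S = "{0<..}"]) (use 3 in \<open>auto simp: flat_exp_def\<close>)
  qed
qed

lemma Ck_on_flat_exp: "Ck_on k (flat_exp n) UNIV"
proof (induction k arbitrary: n)
  case 0
  show ?case
    using DERIV_isCont[OF flat_exp_DERIV] by (simp add: continuous_at_imp_continuous_on)
next
  case (Suc k)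
  show ?case
  proof (rule Ck_on_SucI[where f' = "\<lambda>t v. (flat_exp (n + 2) t + (- real n) *\<^sub>R flat_exp (n + 1) t) *\<^sub>R v"])
    show "(flat_exp n has_derivative (\<lambda>v. (flat_exp (n + 2) t + (- real n) *\<^sub>R flat_exp (n + 1) t) *\<^sub>R v)) (at t)" for t
      using flat_exp_DERIV[of n t] by (simp add: has_field_derivative_def)
    show "Ck_on k (\<lambda>t. (flat_exp (n + 2) t + (- real n) *\<^sub>R flat_exp (n + 1) t) *\<^sub>R v) UNIV" for v
      by (rule Ck_on_scaleR[OF open_UNIV Ck_on_add[OF open_UNIV Suc.IH
            Ck_on_scaleR[OF open_UNIV Ck_on_const[OF open_UNIV] Suc.IH]] Ck_on_const[OF open_UNIV]])
  qed simp
qed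

text \<open>The usual smooth transition function. The denominator is positive everywhere because 2 -
  s and s - 1 are never both nonpositive.\<close>

definition smooth_step :: "real \<Rightarrow> real" where
  "smooth_step s = flat_exp 0 (2 - s) * inverse (flat_exp 0 (2 - s) + flat_exp 0 (s - 1))"

lemma smooth_step_eq_1: "s \<le> 1 \<Longrightarrow> smooth_step s = 1"
  and smooth_step_eq_0: "s \<ge> 2 \<Longrightarrow> smooth_step s = 0"
  by (auto simp: smooth_step_def flat_exp_def)

lemma smooth_on_smooth_step: "smooth_on smooth_step UNIV"
proof -
  have fe: "smooth_on (flat_exp 0) UNIV" by (simp add: smooth_on_def Ck_on_flat_exp)
  have "smooth_on (\<lambda>s::real. 2 + - s) UNIV" "smooth_on (\<lambda>s::real. s + - 1) UNIV"
    by (intro smooth_on_add[OF open_UNIV] smooth_on_const[OF open_UNIV]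
        smooth_on_bounded_linear[OF open_UNIV] bounded_linear_minus bounded_linear_ident)+
  then have "smooth_on (\<lambda>s. flat_exp 0 (2 + - s)) UNIV" "smooth_on (\<lambda>s. flat_exp 0 (s + - 1)) UNIV"
    by (auto intro: smooth_on_compose[OF open_UNIV open_UNIV subset_UNIV _ fe])
  then have a: "smooth_on (\<lambda>s. flat_exp 0 (2 - s)) UNIV" "smooth_on (\<lambda>s. flat_exp 0 (s - 1)) UNIV" by simp_all
  have "flat_exp 0 (2 - s) + flat_exp 0 (s - 1) > 0" for s
    by (auto simp: flat_exp_def add_pos_nonneg add_pos_pos)
  then have "smooth_on (\<lambda>s. inverse (flat_exp 0 (2 - s) + flat_exp 0 (s - 1))) UNIV"
    by (intro smooth_on_compose[OF open_UNIV _ _ smooth_on_add[OF open_UNIV a] smooth_on_inverse])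
       (auto simp: less_le)
  from smooth_on_mult[OF open_UNIV a(1) this] show ?thesis
    unfolding smooth_step_def[abs_def] .
qed

text \<open>Each further vector replaces the box by a continuous image of an interval times the box.
  Such boxes are the compact supports of the bump functions.\<close>

lemma compact_coord_box:
  fixes B :: "'a::real_normed_vector set"
  assumes "finite B"
  shows "compact {(\<Sum>b\<in>B. r b *\<^sub>R b) | r. \<forall>b\<in>B. \<bar>r b\<bar> \<le> R}"
  using assms
proof (induction B rule: finite_induct)
  case (insert a B)
  let ?K = "\<lambda>B. {(\<Sum>b\<in>B. r b *\<^sub>R b) | r. \<forall>b\<in>B. \<bar>r b\<bar> \<le> R}"
  have "?K (insert a B) = (\<lambda>(t, x). t *\<^sub>R a + x) ` ({- R..R} \<times> ?K B)" (is "?L = ?M")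
  proof
    show "?L \<subseteq> ?M"
    proof
      fix x assume "x \<in> ?L"
      then obtain r where r: "x = (\<Sum>b\<in>insert a B. r b *\<^sub>R b)" "\<forall>b\<in>insert a B. \<bar>r b\<bar> \<le> R" by blast
      have "x = (\<lambda>(t, x). t *\<^sub>R a + x) (r a, \<Sum>b\<in>B. r b *\<^sub>R b)" using insert.hyps r(1) by simp
      moreover have "(r a, \<Sum>b\<in>B. r b *\<^sub>R b) \<in> {- R..R} \<times> ?K B" using r(2) by (auto simp: abs_le_iff)
      ultimately show "x \<in> ?M" by (rule image_eqI)
    qed
    show "?M \<subseteq> ?L"
    proof
      fix x assume "x \<in> ?M"
      then obtain t r where tr: "x = t *\<^sub>R a + (\<Sum>b\<in>B. r b *\<^sub>R b)" "t \<in> {- R..R}" "\<forall>b\<in>B. \<bar>r b\<bar> \<le> R"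
        by clarsimp
      have "(\<Sum>b\<in>B. (r(a := t)) b *\<^sub>R b) = (\<Sum>b\<in>B. r b *\<^sub>R b)"
        using insert.hyps by (intro sum.cong) auto
      then have "x = (\<Sum>b\<in>insert a B. (r(a := t)) b *\<^sub>R b)" using insert.hyps tr(1) by simp
      moreover have "\<forall>b\<in>insert a B. \<bar>(r(a := t)) b\<bar> \<le> R" using tr by auto
      ultimately show "x \<in> ?L" by blast
    qed
  qed
  moreover have "compact \<dots>"
    using insert.IH by (intro compact_continuous_image compact_Times)
      (auto simp: case_prod_unfold intro!: continuous_intros)
  ultimately show ?case by simp
qed simp

text \<open>The norm need not be smooth, so the distance from p is measured by a sum of squared
  coordinates \<open>Q\<close>, to which the step is applied; the support lies in a coordinate box
  rather than in a ball.\<close>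

lemma ex_bump:
  fixes p :: "'a::fin_dim_normed_vector"
  assumes "open S" "p \<in> S"
  shows "\<exists>\<beta>::'a \<Rightarrow> real. \<exists>K W. smooth_on \<beta> UNIV \<and> compact K \<and> K \<subseteq> S \<and> open W \<and> p \<in> W \<and>
    (\<forall>x\<in>W. \<beta> x = 1) \<and> (\<forall>x. x \<notin> K \<longrightarrow> \<beta> x = 0)"
proof -
  obtain B :: "'a set" where B: "is_basis B" using ex_is_basis by blast
  then have fin: "finite B" by (simp add: is_basis_def)
  obtain d where d: "d > 0" "ball p d \<subseteq> S" using assms open_contains_ball by blast
  define N where "N = (\<Sum>b\<in>B. norm b) + 1"
  have N: "N > 0" by (simp add: N_def add_nonneg_pos sum_nonneg)
  \<comment> \<open>Coordinates bounded by \<open>R\<close> give a vector of norm at most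
    \<open>R * N\<close>, which is below d, so the box fits into the ball around p.\<close>
  define R where "R = d / (2 * N)"
  have R: "R > 0" "R * N < d" using d(1) N by (auto simp: R_def)
  define box where "box = {(\<Sum>b\<in>B. r b *\<^sub>R b) | r. \<forall>b\<in>B. \<bar>r b\<bar> \<le> R}"
  define K where "K = (\<lambda>x. p + x) ` box"
  have "compact K"
    unfolding K_def box_def by (intro compact_translation compact_coord_box fin)
  have "K \<subseteq> S"
  proof
    fix x assume "x \<in> K"
    then obtain r where r: "x = p + (\<Sum>b\<in>B. r b *\<^sub>R b)" "\<forall>b\<in>B. \<bar>r b\<bar> \<le> R" by (auto simp: K_def box_def)
    have "norm (\<Sum>b\<in>B. r b *\<^sub>R b) \<le> (\<Sum>b\<in>B. R * norm b)"
      using r(2) by (intro sum_norm_le) (auto intro!: mult_right_mono)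
    also have "\<dots> = R * (N - 1)" by (simp add: N_def sum_distrib_left)
    also have "\<dots> \<le> R * N" using R by simp
    finally have "dist p x < d" using r(1) R by (simp add: dist_norm)
    then show "x \<in> S" using d(2) by auto
  qed
  define q where "q = (\<lambda>x::'a. \<Sum>b\<in>B. (representation B x b * inverse R) * (representation B x b * inverse R))"
  have bl: "bounded_linear (\<lambda>x. representation B x b * inverse R)" for b
    by (intro bounded_linear_mult_const linear_imp_bounded_linear linear_representation B)
  have sq: "smooth_on q UNIV"
    unfolding q_def
    by (intro smooth_on_sum[OF open_UNIV] smooth_on_mult[OF open_UNIV] smooth_on_bounded_linear[OF open_UNIV] bl)
  have trans: "smooth_on (\<lambda>x::'a. x + - p) UNIV"
    by (intro smooth_on_add[OF open_UNIV] smooth_on_const[OF open_UNIV] smooth_on_bounded_linear[OF open_UNIV] bounded_linear_ident)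
  \<comment> \<open>Outside the box some scaled coordinate exceeds 1, so the factor 2 lifts
    \<open>Q\<close> to at least 2, where \<open>smooth_step\<close> vanishes; at p the value is
    0.\<close>
  define Q where "Q = (\<lambda>x. 2 * q (x + - p))"
  have sQ: "smooth_on Q UNIV"
    unfolding Q_def
    by (rule smooth_on_mult[OF open_UNIV smooth_on_const[OF open_UNIV]
          smooth_on_compose[OF open_UNIV open_UNIV subset_UNIV trans sq]])
  define \<beta> where "\<beta> = (\<lambda>x. smooth_step (Q x))"
  have "smooth_on \<beta> UNIV"
    unfolding \<beta>_def by (rule smooth_on_compose[OF open_UNIV open_UNIV subset_UNIV sQ smooth_on_smooth_step])
  define W where "W = Q -` {..<1}"
  have "open W"
    unfolding W_def using smooth_on_continuous[OF sQ] by (intro open_vimage) auto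
  moreover have "p \<in> W"
    by (simp add: W_def Q_def q_def representation_zero)
  moreover have "\<forall>x\<in>W. \<beta> x = 1"
    by (auto simp: W_def \<beta>_def smooth_step_eq_1)
  moreover have "\<beta> x = 0" if x: "x \<notin> K" for x
  proof -
    have "\<exists>b\<in>B. \<bar>representation B (x + - p) b\<bar> > R"
    proof (rule ccontr)
      assume "\<not> ?thesis"
      then have "(\<Sum>b\<in>B. representation B (x + - p) b *\<^sub>R b) \<in> box" unfolding box_def by (auto simp: not_less)
      then have "x + - p \<in> box" by (simp only: is_basis_sum_representation[OF B])
      then have "x \<in> K" unfolding K_def by (intro image_eqI[of _ _ "x + - p"]) auto
      then show False using x by simp
    qed
    then obtain b where b: "b \<in> B" "\<bar>representation B (x + - p) b\<bar> > R" by blast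
    let ?t = "representation B (x + - p) b * inverse R"
    have "1 < \<bar>?t\<bar>" using b(2) R by (simp add: abs_mult field_simps)
    then have "1 \<le> ?t * ?t" by (metis abs_le_square_iff abs_one less_imp_le one_power2 power2_eq_square)
    also have "\<dots> \<le> q (x + - p)"
      unfolding q_def using member_le_sum[OF b(1), of "\<lambda>b. (representation B (x + - p) b * inverse R) * (representation B (x + - p) b * inverse R)"] fin
      by simp
    finally show ?thesis by (simp add: \<beta>_def Q_def smooth_step_eq_0)
  qed
  ultimately show ?thesis using \<open>smooth_on \<beta> UNIV\<close> \<open>compact K\<close> \<open>K \<subseteq> S\<close> by blast
qed

section \<open>Smooth functions on a manifold\<close>

lemma smooth_atlas_is_chart:
  assumes "smooth_atlas A" "(U, c) \<in> A"
  shows "open U" "open (c ` U)" "inj_on c U" "continuous_on U c" "continuous_on (c ` U) (inv_into U c)"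
  using assms unfolding smooth_atlas_def is_chart_def homeomorphism_def by fastforce+

lemma smooth_atlas_cover:
  assumes "smooth_atlas A" obtains U c where "(U, c) \<in> A" "p \<in> U"
proof -
  have "p \<in> (\<Union>C\<in>A. fst C)" using assms by (simp add: smooth_atlas_def)
  then obtain C where "C \<in> A" "p \<in> fst C" by blast
  then show ?thesis using that[of "fst C" "snd C"] by simp
qed

lemma smooth_atlas_transition:
  assumes "smooth_atlas A" "(U, c) \<in> A" "(V, d) \<in> A"
  shows "smooth_on (d \<circ> inv_into U c) (c ` (U \<inter> V))"
  using assms unfolding smooth_atlas_def by fast

lemma chart_open_image:
  assumes "smooth_atlas A" "(U, c) \<in> A" "open W" "W \<subseteq> U"
  shows "open (c ` W)"
proof -
  note ch = smooth_atlas_is_chart[OF assms(1,2)]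
  have "c ` W = inv_into U c -` W \<inter> c ` U"
    using assms(4) ch(3) by (auto simp: inv_into_f_f)
  then show ?thesis using continuous_open_preimage[OF ch(5,2) assms(3)] by (simp add: Int_commute)
qed

lemma C_inf_iff:
  "f \<in> C_inf A \<longleftrightarrow> continuous_on UNIV f \<and> (\<forall>(U, c)\<in>A. smooth_on (\<lambda>x. f (inv_into U c x)) (c ` U))"
  by (simp add: C_inf_def smooth_map_def std_atlas_def comp_def)

text \<open>One suitable chart around each point is enough, because the smooth transition maps carry
  the local smoothness over to every other chart. Continuity comes along.\<close>

lemma C_infI_local:
  fixes A :: "('m::t2_space, 'v::fin_dim_normed_vector) chart set"
  assumes A: "smooth_atlas A"
    and loc: "\<And>p. \<exists>U c W. (U, c) \<in> A \<and> p \<in> U \<and> open W \<and> c p \<in> W \<and> W \<subseteq> c ` U \<and>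
      smooth_on (\<lambda>x. f (inv_into U c x)) W"
  shows "f \<in> C_inf A"
  unfolding C_inf_iff
proof (intro conjI ballI)
  show "continuous_on UNIV f"
  proof -
    have "isCont f p" for p
    proof -
    obtain U c W where U: "(U, c) \<in> A" "p \<in> U" "open W" "c p \<in> W" "W \<subseteq> c ` U" "smooth_on (\<lambda>x. f (inv_into U c x)) W"
      using loc[of p] by blast
    note ch = smooth_atlas_is_chart[OF A U(1)]
    let ?N = "U \<inter> c -` W"
    have N: "open ?N" "p \<in> ?N" using continuous_open_preimage[OF ch(4,1) U(3)] U by auto
    have "continuous_on ?N (\<lambda>q. f (inv_into U c (c q)))"
      by (rule continuous_on_compose2[OF smooth_on_continuous[OF U(6)] continuous_on_subset[OF ch(4)]]) auto
    then have "continuous_on ?N f"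
      by (rule continuous_on_eq) (use ch(3) in simp)
    then show ?thesis using N continuous_on_eq_continuous_at by blast
    qed
    then show ?thesis by (simp add: continuous_at_imp_continuous_on)
  qed
next
  fix C assume C: "C \<in> A"
  obtain V d where Vd: "C = (V, d)" by (cases C)
  have V: "(V, d) \<in> A" using C Vd by simp
  note chV = smooth_atlas_is_chart[OF A V]
  have "smooth_on (\<lambda>x. f (inv_into V d x)) (d ` V)"
  proof (rule smooth_on_local)
    fix x assume x: "x \<in> d ` V"
    let ?p = "inv_into V d x"
    have p: "?p \<in> V" "d ?p = x" using x by (auto intro: inv_into_into f_inv_into_f)
    obtain U c W where U: "(U, c) \<in> A" "?p \<in> U" "open W" "c ?p \<in> W" "W \<subseteq> c ` U" "smooth_on (\<lambda>x. f (inv_into U c x)) W"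
      using loc[of ?p] by blast
    note ch = smooth_atlas_is_chart[OF A U(1)]
    let ?N = "V \<inter> (U \<inter> c -` W)"
    have N: "open ?N" using continuous_open_preimage[OF ch(4,1) U(3)] chV(1) by auto
    have oN: "open (d ` ?N)" by (rule chart_open_image[OF A V N]) auto
    have s: "smooth_on (\<lambda>x. c (inv_into V d x)) (d ` ?N)"
      by (rule smooth_on_subset[OF smooth_atlas_transition[OF A V U(1), unfolded comp_def]]) auto
    have "smooth_on (\<lambda>x. f (inv_into U c (c (inv_into V d x)))) (d ` ?N)"
      by (rule smooth_on_compose[OF oN U(3) _ s U(6)]) (use chV(3) in auto)
    then have "smooth_on (\<lambda>x. f (inv_into V d x)) (d ` ?N)"
      by (rule smooth_on_cong[OF oN, rotated]) (use ch(3) chV(3) in auto)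
    moreover have "x \<in> d ` ?N" using p U by (intro image_eqI[of _ _ ?p]) auto
    ultimately show "\<exists>W. open W \<and> x \<in> W \<and> smooth_on (\<lambda>x. f (inv_into V d x)) W" using oN by blast
  qed
  then show "case C of (U, c) \<Rightarrow> smooth_on (\<lambda>x. f (inv_into U c x)) (c ` U)" by (simp add: Vd)
qed

lemma C_infI:
  fixes A :: "('m::t2_space, 'v::fin_dim_normed_vector) chart set"
  assumes A: "smooth_atlas A"
    and "\<And>U c. (U, c) \<in> A \<Longrightarrow> smooth_on (\<lambda>x. f (inv_into U c x)) (c ` U)"
  shows "f \<in> C_inf A"
proof (rule C_infI_local[OF A])
  fix p
  obtain U c where U: "(U, c) \<in> A" "p \<in> U" using smooth_atlas_cover[OF A] by blast
  show "\<exists>U c W. (U, c) \<in> A \<and> p \<in> U \<and> open W \<and> c p \<in> W \<and> W \<subseteq> c ` U \<and>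
      smooth_on (\<lambda>x. f (inv_into U c x)) W"
    using assms(2)[OF U(1)] smooth_atlas_is_chart(2)[OF A U(1)] U
    by (intro exI[of _ U] exI[of _ c] exI[of _ "c ` U"]) auto
qed

lemma C_inf_smooth_on:
  "f \<in> C_inf A \<Longrightarrow> (U, c) \<in> A \<Longrightarrow> smooth_on (\<lambda>x. f (inv_into U c x)) (c ` U)"
  unfolding C_inf_iff by fast

context
  fixes A :: "('m::t2_space, 'v::fin_dim_normed_vector) chart set"
  assumes A: "smooth_atlas A"
begin

lemma C_inf_const: "(\<lambda>q. r) \<in> C_inf A"
  by (rule C_infI[OF A], rule smooth_on_const, rule smooth_atlas_is_chart(2)[OF A])

lemma C_inf_add: "f \<in> C_inf A \<Longrightarrow> h \<in> C_inf A \<Longrightarrow> (\<lambda>q. f q + h q) \<in> C_inf A"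
  by (rule C_infI[OF A], rule smooth_on_add, rule smooth_atlas_is_chart(2)[OF A]) (simp_all only: C_inf_smooth_on)

lemma C_inf_mult: "f \<in> C_inf A \<Longrightarrow> h \<in> C_inf A \<Longrightarrow> (\<lambda>q. f q * h q) \<in> C_inf A"
  by (rule C_infI[OF A], rule smooth_on_mult, rule smooth_atlas_is_chart(2)[OF A]) (simp_all only: C_inf_smooth_on)

lemma C_inf_cmult: "f \<in> C_inf A \<Longrightarrow> (\<lambda>q. r * f q) \<in> C_inf A"
  by (rule C_inf_mult[OF C_inf_const])

lemma C_inf_sum: "(\<And>i. i \<in> I \<Longrightarrow> f i \<in> C_inf A) \<Longrightarrow> (\<lambda>q. \<Sum>i\<in>I. f i q) \<in> C_inf A"
  by (induction I rule: infinite_finite_induct) (simp_all add: C_inf_const C_inf_add)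

end

text \<open>Testing smoothness along such maps avoids charts of products of the manifold: expressions built
  from plots by the group operations are plots again.\<close>

definition plot :: "('m::topological_space, 'v::real_normed_vector) chart set \<Rightarrow>
    ('u::real_normed_vector \<Rightarrow> 'm) \<Rightarrow> 'u set \<Rightarrow> bool" where
  "plot A \<sigma> S \<longleftrightarrow> open S \<and> continuous_on S \<sigma> \<and> (\<forall>(W, e)\<in>A. smooth_on (\<lambda>x. e (\<sigma> x)) (S \<inter> \<sigma> -` W))"

lemma plot_open_preimage: "plot A \<sigma> S \<Longrightarrow> open W \<Longrightarrow> open (S \<inter> \<sigma> -` W)"
  unfolding plot_def by (intro continuous_open_preimage) auto

lemma plot_open: "plot A \<sigma> S \<Longrightarrow> open S"
  by (simp add: plot_def)

lemma plot_smooth: "plot A \<sigma> S \<Longrightarrow> (W, e) \<in> A \<Longrightarrow> smooth_on (\<lambda>x. e (\<sigma> x)) (S \<inter> \<sigma> -` W)"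
  unfolding plot_def by fast

lemma plotI:
  assumes A: "smooth_atlas A" and "open S" "continuous_on S \<sigma>"
    and "\<And>x W e. x \<in> S \<Longrightarrow> (W, e) \<in> A \<Longrightarrow> \<sigma> x \<in> W \<Longrightarrow>
      \<exists>N. open N \<and> x \<in> N \<and> N \<subseteq> S \<and> N \<subseteq> \<sigma> -` W \<and> smooth_on (\<lambda>x. e (\<sigma> x)) N"
  shows "plot A \<sigma> S"
proof -
  have "smooth_on (\<lambda>x. e (\<sigma> x)) (S \<inter> \<sigma> -` W)" if "(W, e) \<in> A" for W e
    by (rule smooth_on_local) (use assms(4)[OF _ that] in blast)
  then show ?thesis unfolding plot_def using assms(2,3) by blast
qed

lemma plot_inv_chart:
  assumes A: "smooth_atlas A" and U: "(U, c) \<in> A"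
  shows "plot A (inv_into U c) (c ` U)"
proof -
  note ch = smooth_atlas_is_chart[OF A U]
  have "smooth_on (\<lambda>x. e (inv_into U c x)) (c ` U \<inter> inv_into U c -` W)" if "(W, e) \<in> A" for W e
    by (rule smooth_on_subset[OF smooth_atlas_transition[OF A U that, unfolded comp_def]]) (use ch(3) in auto)
  then show ?thesis unfolding plot_def using ch by blast
qed

lemma plot_const:
  assumes "open S" shows "plot A (\<lambda>x. p) S"
proof -
  have "open (S \<inter> (\<lambda>x. p) -` W)" for W using assms by (cases "p \<in> W") auto
  then show ?thesis unfolding plot_def using assms by (auto intro: smooth_on_const)
qed

lemma plot_compose:
  fixes \<phi> :: "'u::real_normed_vector \<Rightarrow> 'w::fin_dim_normed_vector"
  assumes A: "smooth_atlas A" and p: "plot A \<sigma> S" and "open S'" "smooth_on \<phi> S'" "\<phi> ` S' \<subseteq> S"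
  shows "plot A (\<lambda>x. \<sigma> (\<phi> x)) S'"
proof -
  have op: "open (S' \<inter> (\<lambda>x. \<sigma> (\<phi> x)) -` W)" if "open W" for W
  proof -
    have "S' \<inter> (\<lambda>x. \<sigma> (\<phi> x)) -` W = S' \<inter> \<phi> -` (S \<inter> \<sigma> -` W)" using assms(5) by auto
    then show ?thesis
      using continuous_open_preimage[OF smooth_on_continuous[OF assms(4)] assms(3) plot_open_preimage[OF p that]] by simp
  qed
  have "smooth_on (\<lambda>x. e (\<sigma> (\<phi> x))) (S' \<inter> (\<lambda>x. \<sigma> (\<phi> x)) -` W)" if W: "(W, e) \<in> A" for W e
    by (rule smooth_on_compose[OF op plot_open_preimage[OF p] _ smooth_on_subset[OF assms(4)] plot_smooth[OF p W]])
       (use assms(5) smooth_atlas_is_chart(1)[OF A W] in auto)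
  moreover have "continuous_on S' (\<lambda>x. \<sigma> (\<phi> x))"
    using p smooth_on_continuous[OF assms(4)] assms(5) unfolding plot_def by (auto intro: continuous_on_compose2)
  ultimately show ?thesis unfolding plot_def using assms(3) by blast
qed

lemma C_inf_plot:
  fixes A :: "('m::t2_space, 'v::fin_dim_normed_vector) chart set"
  assumes A: "smooth_atlas A" and f: "f \<in> C_inf A" and p: "plot A \<sigma> S"
  shows "smooth_on (\<lambda>x. f (\<sigma> x)) S"
proof (rule smooth_on_local)
  fix x assume x: "x \<in> S"
  obtain U c where U: "(U, c) \<in> A" "\<sigma> x \<in> U" using smooth_atlas_cover[OF A] by blast
  note ch = smooth_atlas_is_chart[OF A U(1)]
  let ?N = "S \<inter> \<sigma> -` U"
  have N: "open ?N" by (rule plot_open_preimage[OF p ch(1)])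
  have "smooth_on (\<lambda>x. f (inv_into U c (c (\<sigma> x)))) ?N"
    by (rule smooth_on_compose[OF N ch(2) _ plot_smooth[OF p U(1)] C_inf_smooth_on[OF f U(1)]]) auto
  then have "smooth_on (\<lambda>x. f (\<sigma> x)) ?N"
    by (rule smooth_on_cong[OF N, rotated]) (use ch(3) in auto)
  then show "\<exists>W. open W \<and> x \<in> W \<and> smooth_on (\<lambda>x. f (\<sigma> x)) W" using N x U(2) by blast
qed

lemma plot_smooth_map:
  fixes A :: "('m::t2_space, 'v::fin_dim_normed_vector) chart set"
  assumes A: "smooth_atlas A" and A': "smooth_atlas A'" and F: "smooth_map A A' F" and p: "plot A \<sigma> S"
  shows "plot A' (\<lambda>x. F (\<sigma> x)) S"
proof (rule plotI[OF A'])
  have cF: "continuous_on UNIV F" using F by (simp add: smooth_map_def)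
  show "open S" using p by (simp add: plot_def)
  show "continuous_on S (\<lambda>x. F (\<sigma> x))"
    using p cF unfolding plot_def by (auto intro: continuous_on_compose2)
  fix x W e assume x: "x \<in> S" and W: "(W, e) \<in> A'" "F (\<sigma> x) \<in> W"
  obtain U c where U: "(U, c) \<in> A" "\<sigma> x \<in> U" using smooth_atlas_cover[OF A] by blast
  note ch = smooth_atlas_is_chart[OF A U(1)]
  let ?D = "U \<inter> F -` W" and ?N = "S \<inter> \<sigma> -` (U \<inter> F -` W)"
  have D: "open ?D" using open_vimage[OF _ cF] smooth_atlas_is_chart(1)[OF A' W(1)] ch(1) by auto
  have N: "open ?N" by (rule plot_open_preimage[OF p D])
  have cD: "open (c ` ?D)" by (rule chart_open_image[OF A U(1) D]) auto
  have sF: "smooth_on (\<lambda>y. e (F (inv_into U c y))) (c ` ?D)"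
    using F U(1) W(1) unfolding smooth_map_def comp_def by fast
  have "smooth_on (\<lambda>x. e (F (inv_into U c (c (\<sigma> x))))) ?N"
    by (rule smooth_on_compose[OF N cD _ smooth_on_subset[OF plot_smooth[OF p U(1)]] sF]) auto
  then have "smooth_on (\<lambda>x. e (F (\<sigma> x))) ?N"
    by (rule smooth_on_cong[OF N, rotated]) (use ch(3) in auto)
  then show "\<exists>N. open N \<and> x \<in> N \<and> N \<subseteq> S \<and> N \<subseteq> (\<lambda>x. F (\<sigma> x)) -` W \<and> smooth_on (\<lambda>x. e (F (\<sigma> x))) N"
    using N x U(2) W(2) by (intro exI[of _ ?N]) auto
qed

text \<open>Multiplying by a bump supported in a compact part of the chart allows extension by 0. In
  this way chart expressions near a point become global smooth functions, the only ones on which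
  derivations act.\<close>

lemma ex_C_inf_extension:
  fixes A :: "('m::t2_space, 'v::fin_dim_normed_vector) chart set"
  assumes A: "smooth_atlas A" and U: "(U, c) \<in> A" "p \<in> U" and u: "smooth_on u UNIV"
  shows "\<exists>f\<in>C_inf A. \<exists>W. open W \<and> c p \<in> W \<and> W \<subseteq> c ` U \<and> (\<forall>x\<in>W. f (inv_into U c x) = u x)"
proof -
  note ch = smooth_atlas_is_chart[OF A U(1)]
  obtain \<beta> :: "'v \<Rightarrow> real" and K W where b: "smooth_on \<beta> UNIV" "compact K" "K \<subseteq> c ` U" "open W" "c p \<in> W"
    "\<And>x. x \<in> W \<Longrightarrow> \<beta> x = 1" "\<And>x. x \<notin> K \<Longrightarrow> \<beta> x = 0"
    using ex_bump[OF ch(2), of "c p"] U(2) by (metis imageI)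
  have WK: "W \<subseteq> K" using b(6,7) by force
  define f where "f = (\<lambda>q. if q \<in> U then \<beta> (c q) * u (c q) else 0)"
  \<comment> \<open>The manifold is Hausdorff, so the compact support is closed in it; its
    complement is an open set on which f is 0, and this covers all points outside the chart.\<close>
  have cl: "closed (inv_into U c ` K)"
    by (rule compact_imp_closed[OF compact_continuous_image[OF continuous_on_subset[OF ch(5) b(3)] b(2)]])
  have fU: "f (inv_into U c x) = \<beta> x * u x" if "x \<in> c ` U" for x
    using that by (auto simp: f_def inv_into_into f_inv_into_f)
  have "f \<in> C_inf A"
  proof (rule C_infI_local[OF A])
    fix q
    show "\<exists>U c W. (U, c) \<in> A \<and> q \<in> U \<and> open W \<and> c q \<in> W \<and> W \<subseteq> c ` U \<and> smooth_on (\<lambda>x. f (inv_into U c x)) W"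
    proof (cases "q \<in> U")
      case True
      have "smooth_on (\<lambda>x. \<beta> x * u x) (c ` U)"
        by (rule smooth_on_mult[OF ch(2) smooth_on_subset[OF b(1)] smooth_on_subset[OF u]]) auto
      then have "smooth_on (\<lambda>x. f (inv_into U c x)) (c ` U)"
        by (rule smooth_on_cong[OF ch(2), rotated]) (simp add: fU)
      then show ?thesis using U(1) True ch(2) by (intro exI[of _ U] exI[of _ c] exI[of _ "c ` U"]) auto
    next
      case False
      obtain V d where V: "(V, d) \<in> A" "q \<in> V" using smooth_atlas_cover[OF A] by blast
      note chV = smooth_atlas_is_chart[OF A V(1)]
      let ?N = "V - inv_into U c ` K"
      have N: "open ?N" using chV(1) cl by (rule open_Diff)
      have oN: "open (d ` ?N)" by (rule chart_open_image[OF A V(1) N]) auto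
      have q: "q \<in> ?N" using False V(2) b(3) inv_into_into[of _ c U] by auto
      have z: "f r = 0" if "r \<notin> inv_into U c ` K" for r
      proof (cases "r \<in> U")
        case True
        then have "c r \<notin> K" using that ch(3) by (metis imageI inv_into_f_f)
        then show ?thesis by (simp add: f_def b(7))
      qed (simp add: f_def)
      have "smooth_on (\<lambda>x. f (inv_into V d x)) (d ` ?N)"
        by (rule smooth_on_cong[OF oN _ smooth_on_const[OF oN, of 0]]) (use z chV(3) in auto)
      then show ?thesis
        by (intro exI[of _ V] exI[of _ d] exI[of _ "d ` ?N"]) (use V oN q in \<open>simp add: image_mono\<close>)
    qed
  qed
  moreover have "f (inv_into U c x) = u x" if "x \<in> W" for x
    using that fU[of x] b(3,6) WK by auto
  ultimately show ?thesis using b(3-5) WK by (intro bexI[of _ f] exI[of _ W]) auto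
qed

lemma linear_inj_imp_surj_fin_dim:
  fixes \<phi> :: "'v::fin_dim_normed_vector \<Rightarrow> 'v"
  assumes "linear \<phi>" "inj \<phi>" shows "surj \<phi>"
proof -
  obtain B :: "'v set" where B: "finite B" "independent B" "span B = UNIV"
    using ex_is_basis unfolding is_basis_def by blast
  have ind: "independent (\<phi> ` B)"
    using linear_independent_injective_image[OF assms(1) B(2)] assms(2) by (simp add: inj_on_subset)
  have card: "card (\<phi> ` B) = card B" by (rule card_image) (rule inj_on_subset[OF assms(2)], simp)
  have "a \<in> span (\<phi> ` B)" for a
  proof (rule ccontr)
    assume a: "a \<notin> span (\<phi> ` B)"
    then have "independent (insert a (\<phi> ` B))" using ind by (rule independent_insertI)
    from independent_span_bound[OF B(1) this] have "card (insert a (\<phi> ` B)) \<le> card B"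
      by (simp only: B(3) subset_UNIV simp_thms)
    moreover have "a \<notin> \<phi> ` B" using a by (auto intro: span_base)
    ultimately show False using card B(1) by (simp add: card_insert_if)
  qed
  then have "span (\<phi> ` B) = UNIV" by (intro equalityI subsetI UNIV_I)
  then have "\<phi> ` span B = UNIV" by (simp add: linear_span_image[OF assms(1)])
  then show ?thesis using B(3) by simp
qed

lemma frechet_derivative_eqI: "(f has_derivative f') (at x) \<Longrightarrow> frechet_derivative f (at x) v = f' v"
  by (metis frechet_derivative_at)

text \<open>A partial derivative is the total one in the direction (0, v). In this form a tangent
  vector acting on one of two arguments becomes a directional derivative of a smooth function of
  both.\<close>

lemma frechet_derivative_Pair_snd:
  assumes "(H has_derivative frechet_derivative H (at (u, w))) (at (u, w))"
  shows "frechet_derivative (\<lambda>w. H (u, w)) (at w) v = frechet_derivative H (at (u, w)) (0, v)"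
proof -
  have "((\<lambda>w. (u, w)) has_derivative (\<lambda>v. (0, v))) (at w)" by (auto intro!: derivative_eq_intros)
  from has_derivative_compose[OF this assms] show ?thesis by (rule frechet_derivative_eqI)
qed

lemma frechet_derivative_Pair_fst:
  assumes "(H has_derivative frechet_derivative H (at (u, w))) (at (u, w))"
  shows "frechet_derivative (\<lambda>u. H (u, w)) (at u) v = frechet_derivative H (at (u, w)) (v, 0)"
proof -
  have "((\<lambda>u. (u, w)) has_derivative (\<lambda>v. (v, 0))) (at u)" by (auto intro!: derivative_eq_intros)
  from has_derivative_compose[OF this assms] show ?thesis by (rule frechet_derivative_eqI)
qed

lemma smooth_on_fst: "open S \<Longrightarrow> smooth_on fst S"
  by (rule smooth_on_bounded_linear[OF _ bounded_linear_fst])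

lemma smooth_on_snd: "open S \<Longrightarrow> smooth_on snd S"
  by (rule smooth_on_bounded_linear[OF _ bounded_linear_snd])

section \<open>Left-invariant calculus on a Lie group\<close>

locale lie_group_tangent =
  fixes G :: "('m::{t2_space, second_countable_topology}, 'v::fin_dim_normed_vector) lie_group_data"
    and T :: "'v \<Rightarrow> ('m \<Rightarrow> real) \<Rightarrow> real"
  assumes lie: "lie_group G" and tangent: "tangent_identification G T"
begin

abbreviation A where "A \<equiv> atlas G"
abbreviation C where "C \<equiv> C_inf (atlas G)"
abbreviation mul (infixl "\<cdot>" 70) where "g \<cdot> h \<equiv> g \<otimes>\<^bsub>G\<^esub> h"
abbreviation e where "e \<equiv> \<one>\<^bsub>G\<^esub>"
abbreviation iv where "iv g \<equiv> inv\<^bsub>G\<^esub> g"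
abbreviation E where "E \<equiv> left_inv_field G T"

lemma atl: "smooth_atlas A"
  and smooth_mul: "smooth_map (prod_atlas A A) A (\<lambda>(g, h). g \<cdot> h)"
  and smooth_inv: "smooth_map A A (\<lambda>g. iv g)"
  and grp: "group G" and carr: "carrier G = UNIV"
  using lie by (auto simp: lie_group_def)

lemma grp_simps [simp]:
  "e \<cdot> g = g" "g \<cdot> e = g" "iv g \<cdot> g = e" "g \<cdot> iv g = e" "iv (iv g) = g" "iv e = e"
  "iv g \<cdot> (g \<cdot> h) = h" "g \<cdot> (iv g \<cdot> h) = h"
  and mul_assoc: "(g \<cdot> h) \<cdot> k = g \<cdot> (h \<cdot> k)"
proof -
  interpret group G by (rule grp)
  show as: "(g \<cdot> h) \<cdot> k = g \<cdot> (h \<cdot> k)" for g h k using m_assoc[of g h k] carr by simp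
  show "e \<cdot> g = g" "g \<cdot> e = g" "iv g \<cdot> g = e" "g \<cdot> iv g = e" "iv (iv g) = g" "iv e = e" for g
    using carr by auto
  then show "iv g \<cdot> (g \<cdot> h) = h" "g \<cdot> (iv g \<cdot> h) = h" for g h by (simp_all add: as[symmetric])
qed

text \<open>Smoothness of the multiplication refers to charts of the product manifold. It is applied
  here to the pair of coordinate expressions of \<open>\<sigma>\<close> and \<open>\<tau>\<close>,
  after which product charts need not be touched again.\<close>

lemma plot_mul:
  assumes p: "plot A \<sigma> S" and q: "plot A \<tau> S"
  shows "plot A (\<lambda>x. \<sigma> x \<cdot> \<tau> x) S"
proof (rule plotI[OF atl])
  have cm: "continuous_on UNIV (\<lambda>(g, h). g \<cdot> h)" using smooth_mul by (simp add: smooth_map_def)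
  have cm2: "continuous_on X (\<lambda>x. f x \<cdot> g x)" if "continuous_on X f" "continuous_on X g" for X :: "'z::topological_space set" and f g
    using continuous_on_compose2[OF cm continuous_on_Pair[OF that]] by simp
  show S: "open S" using p by (simp add: plot_def)
  show cst: "continuous_on S (\<lambda>x. \<sigma> x \<cdot> \<tau> x)" using p q by (intro cm2) (simp_all add: plot_def)
  fix x W d assume x: "x \<in> S" and W: "(W, d) \<in> A" "\<sigma> x \<cdot> \<tau> x \<in> W"
  have oW: "open W" by (rule smooth_atlas_is_chart(1)[OF atl W(1)])
  obtain U c where U: "(U, c) \<in> A" "\<sigma> x \<in> U" using smooth_atlas_cover[OF atl] by blast
  obtain V b where V: "(V, b) \<in> A" "\<tau> x \<in> V" using smooth_atlas_cover[OF atl] by blast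
  note chU = smooth_atlas_is_chart[OF atl U(1)] and chV = smooth_atlas_is_chart[OF atl V(1)]
  let ?UV = "U \<times> V" and ?m = "\<lambda>(g, h). g \<cdot> h"
  let ?i = "\<lambda>z. inv_into U c (fst z) \<cdot> inv_into V b (snd z)"
  let ?D = "map_prod c b ` (?UV \<inter> ?m -` W)"
  have inj: "inj_on (map_prod c b) ?UV" using chU(3) chV(3) by (rule map_prod_inj_on)
  \<comment> \<open>Written as a preimage under the continuous product of the two inverse charts,
    the domain is seen to be open.\<close>
  have Deq: "?D = (c ` U \<times> b ` V) \<inter> ?i -` W"
  proof
    show "?D \<subseteq> (c ` U \<times> b ` V) \<inter> ?i -` W" using chU(3) chV(3) by auto
    show "(c ` U \<times> b ` V) \<inter> ?i -` W \<subseteq> ?D" using chU(3) chV(3) by (auto intro!: rev_image_eqI)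
  qed
  have ci: "continuous_on (c ` U \<times> b ` V) ?i"
    by (rule cm2) (rule continuous_on_compose2[OF chU(5) continuous_on_fst[OF continuous_on_id]], fastforce,
      rule continuous_on_compose2[OF chV(5) continuous_on_snd[OF continuous_on_id]], fastforce)
  have D: "open ?D"
    unfolding Deq by (rule continuous_open_preimage[OF ci open_Times[OF chU(2) chV(2)] oW])
  have "(?UV, map_prod c b) \<in> prod_atlas A A" using U V unfolding prod_atlas_def by blast
  then have sm: "smooth_on (\<lambda>z. d (?m (inv_into ?UV (map_prod c b) z))) ?D"
    using smooth_mul W(1) unfolding smooth_map_def comp_def by fast
  let ?N = "(S \<inter> \<sigma> -` U) \<inter> (S \<inter> \<tau> -` V) \<inter> (S \<inter> (\<lambda>x. \<sigma> x \<cdot> \<tau> x) -` W)"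
  have N: "open ?N"
    by (intro open_Int plot_open_preimage[OF p chU(1)] plot_open_preimage[OF q chV(1)]
        continuous_open_preimage[OF cst S oW])
  have sP: "smooth_on (\<lambda>x. (c (\<sigma> x), b (\<tau> x))) ?N"
    by (rule smooth_on_Pair[OF N smooth_on_subset[OF plot_smooth[OF p U(1)]] smooth_on_subset[OF plot_smooth[OF q V(1)]]]) auto
  have iP: "inv_into ?UV (map_prod c b) (c (\<sigma> x), b (\<tau> x)) = (\<sigma> x, \<tau> x)" if "x \<in> ?N" for x
    using inv_into_f_f[OF inj, of "(\<sigma> x, \<tau> x)"] that by simp
  have "smooth_on (\<lambda>x. d (?m (inv_into ?UV (map_prod c b) (c (\<sigma> x), b (\<tau> x))))) ?N"
    by (rule smooth_on_compose[OF N D _ sP sm]) (auto intro!: rev_image_eqI)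
  then have "smooth_on (\<lambda>x. d (\<sigma> x \<cdot> \<tau> x)) ?N"
    by (rule smooth_on_cong[OF N, rotated]) (simp only: iP split_conv)
  then show "\<exists>N. open N \<and> x \<in> N \<and> N \<subseteq> S \<and> N \<subseteq> (\<lambda>x. \<sigma> x \<cdot> \<tau> x) -` W \<and> smooth_on (\<lambda>x. d (\<sigma> x \<cdot> \<tau> x)) N"
    using N x U(2) V(2) W(2) by (intro exI[of _ ?N]) auto
qed

lemma plot_iv: "plot A \<sigma> S \<Longrightarrow> plot A (\<lambda>x. iv (\<sigma> x)) S"
  by (rule plot_smooth_map[OF atl atl smooth_inv])

text \<open>Inverse charts are plots, so a map that takes plots to plots pulls smooth functions back
  to smooth functions. Plots on the model space \<open>'v\<close> suffice.\<close>

lemma C_compose: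
  assumes "f \<in> C" "\<And>\<sigma> S. plot A \<sigma> S \<Longrightarrow> plot A (\<lambda>x::'v. \<phi> (\<sigma> x)) S"
  shows "(\<lambda>q. f (\<phi> q)) \<in> C"
  by (rule C_infI[OF atl], rule C_inf_plot[OF atl assms(1)], rule assms(2), rule plot_inv_chart[OF atl])

lemma C_left: "f \<in> C \<Longrightarrow> (\<lambda>h. f (g \<cdot> h)) \<in> C"
  by (erule C_compose) (rule plot_mul, rule plot_const, erule plot_open)

lemma C_right: "f \<in> C \<Longrightarrow> (\<lambda>h. f (h \<cdot> g)) \<in> C"
  by (erule C_compose) (rule plot_mul, assumption, rule plot_const, erule plot_open)

section \<open>Tangent vectors at the identity and their chart expressions\<close>

lemma T_tangent: "T y \<in> tangent_space A e"
  using tangent unfolding tangent_identification_def bij_betw_def by blast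

lemma T_surj: "D \<in> tangent_space A e \<Longrightarrow> \<exists>y. T y = D"
  using tangent unfolding tangent_identification_def bij_betw_def by (metis rangeE)

lemma T_notC: "f \<notin> C \<Longrightarrow> T y f = 0"
  using T_tangent[of y] by (simp add: tangent_space_def)

lemma T_inj: assumes "\<And>f. f \<in> C \<Longrightarrow> T y f = T z f" shows "y = z"
proof -
  have "T y = T z" using assms T_notC by (metis ext)
  then show ?thesis using tangent unfolding tangent_identification_def bij_betw_def inj_on_def by blast
qed

lemma T_linear: "linear (\<lambda>y. T y f)"
  using tangent unfolding tangent_identification_def by (intro linearI) auto

lemma T_add: "f \<in> C \<Longrightarrow> h \<in> C \<Longrightarrow> T y (\<lambda>q. f q + h q) = T y f + T y h"
  and T_cmult: "f \<in> C \<Longrightarrow> T y (\<lambda>q. r * f q) = r * T y f"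
  and T_mult: "f \<in> C \<Longrightarrow> h \<in> C \<Longrightarrow> T y (\<lambda>q. f q * h q) = T y f * h e + f e * T y h"
  using T_tangent[of y] by (simp_all add: tangent_space_def)

lemma T_zero: "T y (\<lambda>q. 0) = 0"
  using T_cmult[OF C_inf_const[OF atl, of 0], of y 0] by simp

lemma T_sum: "(\<And>i. i \<in> I \<Longrightarrow> f i \<in> C) \<Longrightarrow> T y (\<lambda>q. \<Sum>i\<in>I. f i q) = (\<Sum>i\<in>I. T y (f i))"
  by (induction I rule: infinite_finite_induct) (simp_all add: T_zero T_add C_inf_sum[OF atl])

text \<open>The chart derivations at the identity depend injectively on the direction, because coordinates extend
  to global smooth functions. Since the model space has the dimension of the tangent space, every
  tangent vector is such a derivation.\<close>

lemma ex_chart_T: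
  "\<exists>U c \<phi>. (U, c) \<in> A \<and> e \<in> U \<and> linear \<phi> \<and> bij \<phi> \<and>
    (\<forall>v. \<forall>f\<in>C. T (\<phi> v) f = frechet_derivative (\<lambda>x. f (inv_into U c x)) (at (c e)) v)"
proof -
  obtain U c where U: "(U, c) \<in> A" "e \<in> U" using smooth_atlas_cover[OF atl] by blast
  note ch = smooth_atlas_is_chart[OF atl U(1)]
  let ?d = "\<lambda>f. frechet_derivative (\<lambda>x. f (inv_into U c x)) (at (c e))"
  have hd: "((\<lambda>x. f (inv_into U c x)) has_derivative ?d f) (at (c e))" if "f \<in> C" for f
    by (rule smooth_on_has_derivative[OF C_inf_smooth_on[OF that U(1)]]) (use U in simp)
  \<comment> \<open>The value 0 outside \<open>C\<close> is demanded by
    \<open>tangent_space\<close>, so that \<open>T\<close> can hit \<open>D v\<close>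
    exactly.\<close>
  define D where "D = (\<lambda>v f. if f \<in> C then ?d f v else 0)"
  have inve: "inv_into U c (c e) = e" using ch(3) U(2) by simp
  have Dt: "D v \<in> tangent_space A e" for v
  proof -
    have 1: "?d (\<lambda>q. f q + h q) v = ?d f v + ?d h v" if "f \<in> C" "h \<in> C" for f h
      by (rule frechet_derivative_eqI[OF has_derivative_add[OF hd[OF that(1)] hd[OF that(2)]]])
    have 2: "?d (\<lambda>q. r * f q) v = r * ?d f v" if "f \<in> C" for f r
      by (rule frechet_derivative_eqI[OF has_derivative_mult_right[OF hd[OF that]]])
    have 3: "?d (\<lambda>q. f q * h q) v = f (inv_into U c (c e)) * ?d h v + ?d f v * h (inv_into U c (c e))" if "f \<in> C" "h \<in> C" for f h
      by (rule frechet_derivative_eqI[OF has_derivative_mult[OF hd[OF that(1)] hd[OF that(2)]]])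
    show ?thesis
      unfolding tangent_space_def D_def
      by (simp add: C_inf_add[OF atl] C_inf_mult[OF atl] C_inf_cmult[OF atl] 1 2 3 inve)
  qed
  define \<phi> where "\<phi> v = (SOME y. T y = D v)" for v
  have \<phi>: "T (\<phi> v) = D v" for v unfolding \<phi>_def using T_surj[OF Dt] by (rule someI_ex)
  have D_lin: "D (v + w) f = D v f + D w f" "D (r *\<^sub>R v) f = r * D v f" for v w f r
    using linear_add[OF has_derivative_linear[OF hd[of f]]] linear_scale[OF has_derivative_linear[OF hd[of f]]]
    by (auto simp: D_def)
  have "linear \<phi>"
  proof (rule linearI)
    show "\<phi> (v + w) = \<phi> v + \<phi> w" for v w
      by (rule T_inj) (simp add: \<phi> D_lin linear_add[OF T_linear])
    show "\<phi> (r *\<^sub>R v) = r *\<^sub>R \<phi> v" for r v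
      by (rule T_inj) (simp add: \<phi> D_lin linear_scale[OF T_linear])
  qed
  moreover have "inj \<phi>"
  proof (rule injI)
    fix v w assume eq: "\<phi> v = \<phi> w"
    obtain B :: "'v set" where B: "is_basis B" using ex_is_basis by blast
    have "representation B v b = representation B w b" for b
    proof -
      let ?l = "\<lambda>x. representation B x b"
      have l: "bounded_linear ?l" by (rule linear_imp_bounded_linear[OF linear_representation[OF B]])
      obtain f W where f: "f \<in> C" "open W" "c e \<in> W" "W \<subseteq> c ` U" "\<And>x. x \<in> W \<Longrightarrow> f (inv_into U c x) = ?l x"
        using ex_C_inf_extension[OF atl U smooth_on_bounded_linear[OF open_UNIV l]] by blast
      have "((\<lambda>x. f (inv_into U c x)) has_derivative ?l) (at (c e))"
        by (rule has_derivative_transform_within_open[OF bounded_linear_imp_has_derivative[OF l] f(2,3)]) (simp add: f(5))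
      then have "D v f = ?l v" for v using f(1) by (simp add: D_def frechet_derivative_eqI)
      then show ?thesis using eq \<phi> by metis
    qed
    then have "(\<Sum>b\<in>B. representation B v b *\<^sub>R b) = (\<Sum>b\<in>B. representation B w b *\<^sub>R b)" by simp
    then show "v = w" by (simp only: is_basis_sum_representation[OF B])
  qed
  ultimately have "linear \<phi>" "bij \<phi>"
    using linear_inj_imp_surj_fin_dim[of \<phi>] by (auto simp: bij_def)
  then show ?thesis
    using U \<phi> by (intro exI[of _ U] exI[of _ c] exI[of _ \<phi>]) (simp add: D_def)
qed

text \<open>Read in the chart through \<open>\<phi>\<close>, the functional is linear and extends to
  a global smooth function. Covectors at the identity can thus be represented by functions, to which
  \<open>P\<close> and vector fields apply.\<close>

lemma ex_C_differential:
  assumes "linear l" shows "\<exists>f\<in>C. \<forall>y. T y f = l y"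
proof -
  obtain U c \<phi> where U: "(U, c) \<in> A" "e \<in> U" and \<phi>: "linear \<phi>" "bij \<phi>"
    and T: "\<And>v f. f \<in> C \<Longrightarrow> T (\<phi> v) f = frechet_derivative (\<lambda>x. f (inv_into U c x)) (at (c e)) v"
    using ex_chart_T by blast
  let ?l = "\<lambda>x. l (\<phi> x)"
  have l: "bounded_linear ?l"
    by (rule linear_imp_bounded_linear) (rule linear_compose[OF \<phi>(1) assms, unfolded comp_def])
  obtain f W where f: "f \<in> C" "open W" "c e \<in> W" "W \<subseteq> c ` U" "\<And>x. x \<in> W \<Longrightarrow> f (inv_into U c x) = ?l x"
    using ex_C_inf_extension[OF atl U smooth_on_bounded_linear[OF open_UNIV l]] by blast
  have "((\<lambda>x. f (inv_into U c x)) has_derivative ?l) (at (c e))"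
    by (rule has_derivative_transform_within_open[OF bounded_linear_imp_has_derivative[OF l] f(2,3)]) (simp add: f(5))
  then have "T (\<phi> v) f = l (\<phi> v)" for v by (simp add: T[OF f(1)] frechet_derivative_eqI)
  then have "T y f = l y" for y using \<phi>(2) by (metis bij_pointE)
  then show ?thesis using f(1) by blast
qed

text \<open>In the chart at the identity, \<open>T y\<close> acts as a partial derivative of a
  smooth function of parameter and point, and such a derivative is again smooth in the
  parameter.\<close>

lemma T_smooth_param:
  fixes F :: "'u::fin_dim_normed_vector \<Rightarrow> 'm \<Rightarrow> real"
  assumes S: "open S" and F: "\<And>u. u \<in> S \<Longrightarrow> F u \<in> C"
    and sm: "\<And>U c. (U, c) \<in> A \<Longrightarrow> smooth_on (\<lambda>z. F (fst z) (inv_into U c (snd z))) (S \<times> c ` U)"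
  shows "smooth_on (\<lambda>u. T y (F u)) S"
proof -
  obtain U c \<phi> where U: "(U, c) \<in> A" "e \<in> U" and \<phi>: "linear \<phi>" "bij \<phi>"
    and T: "\<And>v f. f \<in> C \<Longrightarrow> T (\<phi> v) f = frechet_derivative (\<lambda>x. f (inv_into U c x)) (at (c e)) v"
    using ex_chart_T by blast
  obtain v where v: "y = \<phi> v" using \<phi>(2) by (metis bij_pointE)
  note ch = smooth_atlas_is_chart[OF atl U(1)]
  let ?H = "\<lambda>z. F (fst z) (inv_into U c (snd z))"
  have o: "open (S \<times> c ` U)" using S ch(2) by (rule open_Times)
  have sP: "smooth_on (\<lambda>u. (u, c e)) S"
    by (rule smooth_on_Pair[OF S smooth_on_bounded_linear[OF S bounded_linear_ident] smooth_on_const[OF S]])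
  have "smooth_on (\<lambda>u. frechet_derivative ?H (at (u, c e)) (0, v)) S"
    by (rule smooth_on_compose[OF S o _ sP smooth_on_derivative[OF sm[OF U(1)]]]) (use U(2) in auto)
  moreover have "frechet_derivative ?H (at (u, c e)) (0, v) = T y (F u)" if u: "u \<in> S" for u
    using frechet_derivative_Pair_snd[OF smooth_on_has_derivative[OF sm[OF U(1)]], of u "c e" v] u U(2)
    by (simp add: v T[OF F[OF u]])
  ultimately show ?thesis by (rule smooth_on_cong[OF S, rotated]) simp
qed

text \<open>In the chart at the identity the two sides are the mixed second derivatives of one
  function of two variables, in the directions (v, 0) and (0, w), so
  \<open>frechet_derivative_commute\<close> applies.\<close>

lemma T_commute:
  assumes F: "\<And>k. F k \<in> C" "\<And>h. (\<lambda>k. F k h) \<in> C" "(\<lambda>k. T y (F k)) \<in> C" "(\<lambda>h. T x (\<lambda>k. F k h)) \<in> C"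
    and sm: "\<And>U c. (U, c) \<in> A \<Longrightarrow> smooth_on (\<lambda>z. F (inv_into U c (fst z)) (inv_into U c (snd z))) (c ` U \<times> c ` U)"
  shows "T x (\<lambda>k. T y (F k)) = T y (\<lambda>h. T x (\<lambda>k. F k h))"
proof -
  obtain U c \<phi> where U: "(U, c) \<in> A" "e \<in> U" and \<phi>: "linear \<phi>" "bij \<phi>"
    and T: "\<And>v f. f \<in> C \<Longrightarrow> T (\<phi> v) f = frechet_derivative (\<lambda>x. f (inv_into U c x)) (at (c e)) v"
    using ex_chart_T by blast
  obtain v w where v: "x = \<phi> v" "y = \<phi> w" using \<phi>(2) by (metis bij_pointE)
  note ch = smooth_atlas_is_chart[OF atl U(1)]
  let ?S = "c ` U" and ?H = "\<lambda>z. F (inv_into U c (fst z)) (inv_into U c (snd z))"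
  let ?p = "(c e, c e)"
  have o: "open (?S \<times> ?S)" using ch(2) ch(2) by (rule open_Times)
  have p: "c e \<in> ?S" "?p \<in> ?S \<times> ?S" using U(2) by auto
  note H = sm[OF U(1)]
  have inve: "inv_into U c (c e) = e" using ch(3) U(2) by simp
  have H1: "T y (F (inv_into U c u)) = frechet_derivative ?H (at (u, c e)) (0, w)" if "u \<in> ?S" for u
    using frechet_derivative_Pair_snd[OF smooth_on_has_derivative[OF H], of u "c e" w] that U(2)
    by (simp add: v T[OF F(1)])
  have H2: "T x (\<lambda>k. F k (inv_into U c u)) = frechet_derivative ?H (at (c e, u)) (v, 0)" if "u \<in> ?S" for u
    using frechet_derivative_Pair_fst[OF smooth_on_has_derivative[OF H], of "c e" u v] that U(2)
    by (simp add: v T[OF F(2)])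
  \<comment> \<open>Replacing the inner tangent vector by a partial derivative of \<open>?H\<close>
    under the outer derivative requires differentiability at \<open>c e\<close>; the last two
    membership assumptions on F supply it.\<close>
  have d3: "(\<lambda>u. T y (F (inv_into U c u))) differentiable at (c e)"
    by (rule differentiableI[OF smooth_on_has_derivative[OF C_inf_smooth_on[OF F(3) U(1)] p(1)]])
  have d4: "(\<lambda>u. T x (\<lambda>k. F k (inv_into U c u))) differentiable at (c e)"
    by (rule differentiableI[OF smooth_on_has_derivative[OF C_inf_smooth_on[OF F(4) U(1)] p(1)]])
  have "T x (\<lambda>k. T y (F k)) = frechet_derivative (\<lambda>u. T y (F (inv_into U c u))) (at (c e)) v"
    by (simp only: v(1) T[OF F(3)])
  also have "\<dots> = frechet_derivative (\<lambda>u. frechet_derivative ?H (at (u, c e)) (0, w)) (at (c e)) v"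
    by (rule arg_cong[where f = "\<lambda>f. f v"], rule frechet_derivative_transform_within_open[OF d3 ch(2) p(1) H1])
  also have "\<dots> = frechet_derivative (\<lambda>z. frechet_derivative ?H (at z) (0, w)) (at ?p) (v, 0)"
    by (rule frechet_derivative_Pair_fst[OF smooth_on_has_derivative[OF smooth_on_derivative[OF H] p(2)]])
  also have "\<dots> = frechet_derivative (\<lambda>z. frechet_derivative ?H (at z) (v, 0)) (at ?p) (0, w)"
    by (rule frechet_derivative_commute[OF smooth_on_Suc[OF H] o p(2)])
  also have "\<dots> = frechet_derivative (\<lambda>u. frechet_derivative ?H (at (c e, u)) (v, 0)) (at (c e)) w"
    by (rule sym, rule frechet_derivative_Pair_snd[OF smooth_on_has_derivative[OF smooth_on_derivative[OF H] p(2)]])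
  also have "\<dots> = frechet_derivative (\<lambda>u. T x (\<lambda>k. F k (inv_into U c u))) (at (c e)) w"
    by (rule arg_cong[where f = "\<lambda>f. f w"], rule sym, rule frechet_derivative_transform_within_open[OF d4 ch(2) p(1) H2])
  also have "\<dots> = T y (\<lambda>h. T x (\<lambda>k. F k h))"
    by (simp only: v(2) T[OF F(4)])
  finally show ?thesis .
qed

end

section \<open>Left-invariant fields and coefficients of vector fields\<close>

context lie_group_tangent
begin

lemma E_eq: "f \<in> C \<Longrightarrow> E x f g = T x (\<lambda>h. f (g \<cdot> h))"
  by (simp add: left_inv_field_def)

lemma E_notC: "f \<notin> C \<Longrightarrow> E x f = (\<lambda>g. 0)"
  by (simp add: left_inv_field_def)

lemma E_unit: "f \<in> C \<Longrightarrow> E x f e = T x f"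
  by (simp add: E_eq)

lemma E_left_translate: "f \<in> C \<Longrightarrow> E x (\<lambda>h. f (g \<cdot> h)) k = E x f (g \<cdot> k)"
  by (simp add: E_eq C_left mul_assoc)

lemma E_linear: "linear (\<lambda>x. E x f g)"
  by (cases "f \<in> C") (simp_all add: E_eq E_notC T_linear linear_zero)

lemma plot_chart_fst:
  fixes S :: "'u::fin_dim_normed_vector set"
  assumes "(U, c) \<in> A" "open S"
  shows "plot A (\<lambda>z. inv_into U c (fst z)) (c ` U \<times> S)"
  by (rule plot_compose[OF atl plot_inv_chart[OF atl assms(1)] open_Times smooth_on_fst[OF open_Times]])
     (use assms smooth_atlas_is_chart(2)[OF atl assms(1)] in auto)

lemma plot_chart_snd:
  fixes S :: "'u::fin_dim_normed_vector set"
  assumes "(U, c) \<in> A" "open S"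
  shows "plot A (\<lambda>z. inv_into U c (snd z)) (S \<times> c ` U)"
  by (rule plot_compose[OF atl plot_inv_chart[OF atl assms(1)] open_Times smooth_on_snd[OF open_Times]])
     (use assms smooth_atlas_is_chart(2)[OF atl assms(1)] in auto)

lemma T_param_C:
  assumes F: "\<And>k. F k \<in> C"
    and pl: "\<And>U c V d. (U, c) \<in> A \<Longrightarrow> (V, d) \<in> A \<Longrightarrow>
      smooth_on (\<lambda>z. F (inv_into V d (fst z)) (inv_into U c (snd z))) (d ` V \<times> c ` U)"
  shows "(\<lambda>k. T y (F k)) \<in> C"
proof (rule C_infI[OF atl])
  fix V d assume V: "(V, d) \<in> A"
  show "smooth_on (\<lambda>u. T y (F (inv_into V d u))) (d ` V)"
    by (rule T_smooth_param[OF smooth_atlas_is_chart(2)[OF atl V] F pl[OF _ V]])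
qed

text \<open>Meant for words m in the group operations and constants: the plot rules discharge the
  last premise, and f evaluated on such a word is smooth in both chart variables.\<close>

lemma smooth_chart_pair:
  assumes "f \<in> C" "(U, c) \<in> A" "(V, d) \<in> A"
    and "\<And>\<sigma> \<tau>. plot A \<sigma> (d ` V \<times> c ` U) \<Longrightarrow> plot A \<tau> (d ` V \<times> c ` U) \<Longrightarrow> plot A (\<lambda>z. m (\<sigma> z) (\<tau> z)) (d ` V \<times> c ` U)"
  shows "smooth_on (\<lambda>z. f (m (inv_into V d (fst z)) (inv_into U c (snd z)))) (d ` V \<times> c ` U)"
  by (rule C_inf_plot[OF atl assms(1) assms(4)[OF plot_chart_fst[OF assms(3) smooth_atlas_is_chart(2)[OF atl assms(2)]]
          plot_chart_snd[OF assms(2) smooth_atlas_is_chart(2)[OF atl assms(3)]]]])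

lemma E_C: assumes f: "f \<in> C" shows "E x f \<in> C"
proof -
  have "(\<lambda>g. T x (\<lambda>h. f (g \<cdot> h))) \<in> C"
    by (rule T_param_C[OF C_left[OF f]], rule smooth_chart_pair[OF f]) (assumption | rule plot_mul)+
  moreover have "E x f = (\<lambda>g. T x (\<lambda>h. f (g \<cdot> h)))" by (rule ext) (rule E_eq[OF f])
  ultimately show ?thesis by simp
qed

lemma E_vector_field: "vector_field A (E x)"
  unfolding vector_field_def
  by (auto simp: E_C E_notC E_eq C_inf_add[OF atl] C_inf_mult[OF atl] C_inf_cmult[OF atl] C_left T_add T_mult T_cmult
      intro!: ext)

lemma E_inj: assumes "\<And>f. f \<in> C \<Longrightarrow> E y f g = E z f g" shows "y = z"
proof (rule T_inj)
  fix f assume "f \<in> C"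
  then show "T y f = T z f" using assms[OF C_left[of f "iv g"]] by (simp add: E_left_translate E_unit)
qed

text \<open>Left translation by \<open>iv g\<close> moves the derivation to the identity, where
  \<open>T\<close> is onto. This is the left trivialisation of the tangent bundle.\<close>

lemma tangent_space_E:
  assumes D: "D \<in> tangent_space A g" shows "\<exists>y. \<forall>f\<in>C. D f = E y f g"
proof -
  let ?D = "\<lambda>f. if f \<in> C then D (\<lambda>h. f (iv g \<cdot> h)) else 0"
  have "?D \<in> tangent_space A e"
    using D unfolding tangent_space_def
    by (simp add: C_left C_inf_add[OF atl] C_inf_mult[OF atl] C_inf_cmult[OF atl])
  then obtain y where y: "T y = ?D" using T_surj by blast
  have "D f = E y f g" if "f \<in> C" for f
    using that by (simp add: E_eq y C_left)
  then show ?thesis by blast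
qed

text \<open>This is the left Maurer-Cartan form evaluated on X, a function from the group to its Lie
  algebra.\<close>

definition vcoef :: "'m vfield \<Rightarrow> 'm \<Rightarrow> 'v" where
  "vcoef X g = (THE y. \<forall>f\<in>C. X f g = E y f g)"

lemma vcoef_unique: "(\<And>f. f \<in> C \<Longrightarrow> X f g = E y f g) \<Longrightarrow> vcoef X g = y"
  unfolding vcoef_def by (rule the_equality) (auto intro: E_inj)

lemma vcoef_eq:
  assumes X: "vector_field A X" and f: "f \<in> C" shows "X f g = E (vcoef X g) f g"
proof -
  have "(\<lambda>f. X f g) \<in> tangent_space A g"
    using X unfolding vector_field_def tangent_space_def by simp
  from tangent_space_E[OF this] obtain y where y: "\<And>f. f \<in> C \<Longrightarrow> X f g = E y f g" by blast
  then have "vcoef X g = y" by (rule vcoef_unique)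
  then show ?thesis using y f by simp
qed

lemma vcoef_E: "vcoef (E x) g = x"
  by (rule vcoef_unique) simp

lemma vcoef_add:
  "vector_field A X \<Longrightarrow> vector_field A Y \<Longrightarrow> vcoef (\<lambda>f q. X f q + Y f q) g = vcoef X g + vcoef Y g"
  by (rule vcoef_unique) (simp add: vcoef_eq linear_add[OF E_linear])

lemma vcoef_scale: "vector_field A X \<Longrightarrow> vcoef (\<lambda>f q. a q * X f q) g = a g *\<^sub>R vcoef X g"
  by (rule vcoef_unique) (simp add: vcoef_eq linear_scale[OF E_linear])

text \<open>Left translation by g is differentiable between a chart at the identity and a chart at
  g; the chain rule pushes the chart derivation that represents y at the identity forward to
  g.\<close>

lemma E_chart:
  assumes V: "(V, d) \<in> A" "g \<in> V"
  shows "\<exists>w. \<forall>f\<in>C. E y f g = frechet_derivative (\<lambda>x. f (inv_into V d x)) (at (d g)) w"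
proof -
  obtain U c \<phi> where U: "(U, c) \<in> A" "e \<in> U" and \<phi>: "linear \<phi>" "bij \<phi>"
    and T: "\<And>v f. f \<in> C \<Longrightarrow> T (\<phi> v) f = frechet_derivative (\<lambda>x. f (inv_into U c x)) (at (c e)) v"
    using ex_chart_T by blast
  obtain v where v: "y = \<phi> v" using \<phi>(2) by (metis bij_pointE)
  note ch = smooth_atlas_is_chart[OF atl U(1)] and chV = smooth_atlas_is_chart[OF atl V(1)]
  have inve: "inv_into U c (c e) = e" using ch(3) U(2) by simp
  have pl: "plot A (\<lambda>x. g \<cdot> inv_into U c x) (c ` U)"
    by (rule plot_mul[OF plot_const[OF ch(2)] plot_inv_chart[OF atl U(1)]])
  let ?N = "c ` U \<inter> (\<lambda>x. g \<cdot> inv_into U c x) -` V"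
  let ?\<psi> = "\<lambda>x. d (g \<cdot> inv_into U c x)"
  have N: "open ?N" "c e \<in> ?N" using plot_open_preimage[OF pl chV(1)] U(2) V(2) inve by auto
  have \<psi>: "(?\<psi> has_derivative frechet_derivative ?\<psi> (at (c e))) (at (c e))"
    by (rule smooth_on_has_derivative[OF plot_smooth[OF pl V(1)] N(2)])
  have dg: "?\<psi> (c e) = d g" by (simp add: inve)
  have "E y f g = frechet_derivative (\<lambda>x. f (inv_into V d x)) (at (d g)) (frechet_derivative ?\<psi> (at (c e)) v)" if f: "f \<in> C" for f
  proof -
    have "((\<lambda>x. f (inv_into V d x)) has_derivative frechet_derivative (\<lambda>x. f (inv_into V d x)) (at (d g))) (at (?\<psi> (c e)))"
      using smooth_on_has_derivative[OF C_inf_smooth_on[OF f V(1)]] V(2) dg by auto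
    from has_derivative_compose[OF \<psi> this]
    have "((\<lambda>x. f (inv_into V d (?\<psi> x))) has_derivative
        (\<lambda>v. frechet_derivative (\<lambda>x. f (inv_into V d x)) (at (d g)) (frechet_derivative ?\<psi> (at (c e)) v))) (at (c e))" .
    then have "((\<lambda>x. f (g \<cdot> inv_into U c x)) has_derivative
        (\<lambda>v. frechet_derivative (\<lambda>x. f (inv_into V d x)) (at (d g)) (frechet_derivative ?\<psi> (at (c e)) v))) (at (c e))"
      by (rule has_derivative_transform_within_open[OF _ N]) (use chV(3) in auto)
    from frechet_derivative_eqI[OF this] show ?thesis
      by (simp add: E_eq[OF f] v T[OF C_left[OF f]])
  qed
  then show ?thesis by blast
qed

text \<open>X acts on global functions only, so the chart coordinates are replaced by global
  functions \<open>c b\<close> that agree with them near p. The components of X are then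
  \<open>X (c b)\<close>, smooth on the whole group.\<close>

lemma vector_field_chart:
  assumes X: "vector_field A X" and V: "(V, d) \<in> A" "p \<in> V" and B: "is_basis B"
  shows "\<exists>W \<xi>. open W \<and> d p \<in> W \<and> W \<subseteq> d ` V \<and> (\<forall>b\<in>B. \<xi> b \<in> C) \<and>
    (\<forall>x\<in>W. \<forall>f\<in>C. X f (inv_into V d x) =
       (\<Sum>b\<in>B. \<xi> b (inv_into V d x) * frechet_derivative (\<lambda>x. f (inv_into V d x)) (at x) b))"
proof -
  note chV = smooth_atlas_is_chart[OF atl V(1)]
  have l: "bounded_linear (\<lambda>x. representation B x b)" for b
    by (rule linear_imp_bounded_linear[OF linear_representation[OF B]])
  have "\<forall>b. \<exists>f W. f \<in> C \<and> open W \<and> d p \<in> W \<and> W \<subseteq> d ` V \<and> (\<forall>x\<in>W. f (inv_into V d x) = representation B x b)"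
    using ex_C_inf_extension[OF atl V smooth_on_bounded_linear[OF open_UNIV l]] by blast
  then obtain c W where c: "\<And>b. c b \<in> C" and W: "\<And>b. open (W b)" "\<And>b. d p \<in> W b" "\<And>b. W b \<subseteq> d ` V"
    "\<And>b x. x \<in> W b \<Longrightarrow> c b (inv_into V d x) = representation B x b"
    by metis
  let ?W = "d ` V \<inter> (\<Inter>b\<in>B. W b)"
  have "open ?W" using chV(2) W(1) B by (intro open_Int open_INT) (auto simp: is_basis_def)
  moreover have "d p \<in> ?W" using V(2) W(2) by auto
  moreover have "X f (inv_into V d x) =
       (\<Sum>b\<in>B. X (c b) (inv_into V d x) * frechet_derivative (\<lambda>x. f (inv_into V d x)) (at x) b)"
    if x: "x \<in> ?W" and f: "f \<in> C" for x f
  proof -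
    have V': "inv_into V d x \<in> V" "d (inv_into V d x) = x" using x by (auto intro: inv_into_into f_inv_into_f)
    obtain w where w: "\<And>f. f \<in> C \<Longrightarrow> X f (inv_into V d x) = frechet_derivative (\<lambda>x. f (inv_into V d x)) (at x) w"
      using E_chart[OF V(1) V'(1), of "vcoef X (inv_into V d x)"] vcoef_eq[OF X] V'(2) by auto
    have r: "X (c b) (inv_into V d x) = representation B w b" if b: "b \<in> B" for b
    proof -
      have "((\<lambda>x. c b (inv_into V d x)) has_derivative (\<lambda>x. representation B x b)) (at x)"
        by (rule has_derivative_transform_within_open[OF bounded_linear_imp_has_derivative[OF l] W(1)[of b]])
           (use x b W(4) in auto)
      from frechet_derivative_eqI[OF this] show ?thesis by (simp only: w[OF c])
    qed
    have xV: "x \<in> d ` V" using x by blast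
    have "linear (frechet_derivative (\<lambda>x. f (inv_into V d x)) (at x))"
      by (rule has_derivative_linear[OF smooth_on_has_derivative[OF C_inf_smooth_on[OF f V(1)] xV]])
    from linear_is_basis_eq[OF B this, of w] show ?thesis by (simp add: w[OF f] r)
  qed
  moreover have "\<And>b. X (c b) \<in> C" using X c by (simp add: vector_field_def)
  ultimately show ?thesis by (intro exI[of _ ?W] exI[of _ "\<lambda>b. X (c b)"]) simp
qed

text \<open>In a chart, X differentiates the second argument with smooth coefficients, and parameter
  and point are both set to g afterwards: the value is a partial derivative restricted to the
  diagonal.\<close>

lemma vector_field_param_C:
  assumes X: "vector_field A X" and F: "\<And>k. F k \<in> C"
    and sm: "\<And>V d. (V, d) \<in> A \<Longrightarrow> smooth_on (\<lambda>z. F (inv_into V d (fst z)) (inv_into V d (snd z))) (d ` V \<times> d ` V)"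
  shows "(\<lambda>g. X (F g) g) \<in> C"
proof (rule C_infI_local[OF atl])
  fix p
  obtain V d where V: "(V, d) \<in> A" "p \<in> V" using smooth_atlas_cover[OF atl] by blast
  note chV = smooth_atlas_is_chart[OF atl V(1)]
  obtain B :: "'v set" where B: "is_basis B" using ex_is_basis by blast
  obtain W \<xi> where W: "open W" "d p \<in> W" "W \<subseteq> d ` V" "\<And>b. b \<in> B \<Longrightarrow> \<xi> b \<in> C"
    and X': "\<And>x f. x \<in> W \<Longrightarrow> f \<in> C \<Longrightarrow> X f (inv_into V d x) =
       (\<Sum>b\<in>B. \<xi> b (inv_into V d x) * frechet_derivative (\<lambda>x. f (inv_into V d x)) (at x) b)"
    using vector_field_chart[OF X V B] by blast
  let ?H = "\<lambda>z. F (inv_into V d (fst z)) (inv_into V d (snd z))"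
  have o: "open (d ` V \<times> d ` V)" using chV(2) chV(2) by (rule open_Times)
  have diag: "smooth_on (\<lambda>x::'v. (x, x)) W"
    by (rule smooth_on_Pair[OF W(1) smooth_on_bounded_linear[OF W(1) bounded_linear_ident] smooth_on_bounded_linear[OF W(1) bounded_linear_ident]])
  have H: "smooth_on (\<lambda>x. frechet_derivative ?H (at (x, x)) (0, b)) W" for b
    by (rule smooth_on_compose[OF W(1) o _ diag smooth_on_derivative[OF sm[OF V(1)]]]) (use W(3) in auto)
  have "smooth_on (\<lambda>x. \<Sum>b\<in>B. \<xi> b (inv_into V d x) * frechet_derivative ?H (at (x, x)) (0, b)) W"
    by (rule smooth_on_sum[OF W(1)],
        rule smooth_on_mult[OF W(1) smooth_on_subset[OF C_inf_smooth_on[OF W(4) V(1)] W(3)] H])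
  moreover have "(\<Sum>b\<in>B. \<xi> b (inv_into V d x) * frechet_derivative ?H (at (x, x)) (0, b)) =
      X (F (inv_into V d x)) (inv_into V d x)" if x: "x \<in> W" for x
  proof -
    have "(x, x) \<in> d ` V \<times> d ` V" using x W(3) by blast
    from frechet_derivative_Pair_snd[OF smooth_on_has_derivative[OF sm[OF V(1)] this]]
    show ?thesis by (simp add: X'[OF x F])
  qed
  ultimately have "smooth_on (\<lambda>x. X (F (inv_into V d x)) (inv_into V d x)) W"
    by (rule smooth_on_cong[OF W(1), rotated])
  then show "\<exists>U c W. (U, c) \<in> A \<and> p \<in> U \<and> open W \<and> c p \<in> W \<and> W \<subseteq> c ` U \<and>
      smooth_on (\<lambda>x. X (F (inv_into U c x)) (inv_into U c x)) W"
    using V W(1-3) by (intro exI[of _ V] exI[of _ d] exI[of _ W]) simp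
qed

text \<open>If l is the differential of f at the identity, its value on the coefficient at g is X
  applied at g to the left translate k -> f (g^-1 k), a function that itself depends smoothly on
  g.\<close>

lemma vcoef_C:
  assumes X: "vector_field A X" and l: "linear l"
  shows "(\<lambda>g. l (vcoef X g)) \<in> C"
proof -
  obtain f where f: "f \<in> C" "\<And>y. T y f = l y" using ex_C_differential[OF l] by blast
  have "(\<lambda>g. X (\<lambda>k. f (iv g \<cdot> k)) g) \<in> C"
    by (rule vector_field_param_C[OF X C_left[OF f(1)]], rule smooth_chart_pair[OF f(1)])
       (assumption | rule plot_mul plot_iv)+
  moreover have "X (\<lambda>k. f (iv g \<cdot> k)) g = l (vcoef X g)" for g
    by (simp add: vcoef_eq[OF X C_left[OF f(1)]] E_left_translate f E_unit)
  ultimately show ?thesis by simp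
qed

lemma vector_field_basis:
  assumes X: "vector_field A X" and B: "is_basis B" and f: "f \<in> C"
  shows "X f g = (\<Sum>b\<in>B. representation B (vcoef X g) b * E b f g)"
  using linear_is_basis_eq[OF B E_linear[of f g], of "vcoef X g"] by (simp only: vcoef_eq[OF X f] real_scaleR_def)

end

section \<open>The Poisson tensor of a Poisson-Lie group\<close>

locale poisson_lie_tangent = lie_group_tangent G T
  for G :: "('m::{t2_space, second_countable_topology}, 'v::fin_dim_normed_vector) lie_group_data" and T +
  fixes P :: "'m fn_bracket"
  assumes plg: "poisson_lie_group G P"
begin

lemma P_C: "f \<in> C \<Longrightarrow> h \<in> C \<Longrightarrow> P f h \<in> C"
  using plg unfolding poisson_lie_group_def poisson_bracket_def by blast

lemma
  shows P_antisym_fun: "f \<in> C \<Longrightarrow> h \<in> C \<Longrightarrow> P f h = (\<lambda>q. - P h f q)"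
    and P_add_fun: "f \<in> C \<Longrightarrow> h \<in> C \<Longrightarrow> k \<in> C \<Longrightarrow> P f (\<lambda>q. h q + k q) = (\<lambda>q. P f h q + P f k q)"
    and P_cmult_fun: "f \<in> C \<Longrightarrow> h \<in> C \<Longrightarrow> P f (\<lambda>q. r * h q) = (\<lambda>q. r * P f h q)"
    and P_mult_fun: "f \<in> C \<Longrightarrow> h \<in> C \<Longrightarrow> k \<in> C \<Longrightarrow> P f (\<lambda>q. h q * k q) = (\<lambda>q. P f h q * k q + h q * P f k q)"
    and P_Jacobi_fun: "f \<in> C \<Longrightarrow> h \<in> C \<Longrightarrow> k \<in> C \<Longrightarrow> (\<lambda>q. P f (P h k) q + P h (P k f) q + P k (P f h) q) = (\<lambda>q. 0)"
  using plg unfolding poisson_lie_group_def poisson_bracket_def by blast+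

lemma P_antisym: "f \<in> C \<Longrightarrow> h \<in> C \<Longrightarrow> P f h g = - P h f g"
  by (rule fun_cong[OF P_antisym_fun])

lemma P_add_right: "f \<in> C \<Longrightarrow> h \<in> C \<Longrightarrow> k \<in> C \<Longrightarrow> P f (\<lambda>q. h q + k q) g = P f h g + P f k g"
  by (rule fun_cong[OF P_add_fun])

lemma P_cmult_right: "f \<in> C \<Longrightarrow> h \<in> C \<Longrightarrow> P f (\<lambda>q. r * h q) g = r * P f h g"
  by (rule fun_cong[OF P_cmult_fun])

lemma P_mult_right: "f \<in> C \<Longrightarrow> h \<in> C \<Longrightarrow> k \<in> C \<Longrightarrow> P f (\<lambda>q. h q * k q) g = P f h g * k g + h g * P f k g"
  by (rule fun_cong[OF P_mult_fun])

lemma P_Jacobi: "f \<in> C \<Longrightarrow> h \<in> C \<Longrightarrow> k \<in> C \<Longrightarrow> P f (P h k) g + P h (P k f) g + P k (P f h) g = 0"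
  by (rule fun_cong[OF P_Jacobi_fun])

lemma P_add_left: "f \<in> C \<Longrightarrow> h \<in> C \<Longrightarrow> k \<in> C \<Longrightarrow> P (\<lambda>q. h q + k q) f g = P h f g + P k f g"
  by (simp add: P_antisym[of _ f] P_add_right C_inf_add[OF atl])

lemma P_cmult_left: "f \<in> C \<Longrightarrow> h \<in> C \<Longrightarrow> P (\<lambda>q. r * h q) f g = r * P h f g"
  by (simp add: P_antisym[of _ f] P_cmult_right C_inf_cmult[OF atl])

lemma P_mult_left: "f \<in> C \<Longrightarrow> h \<in> C \<Longrightarrow> k \<in> C \<Longrightarrow> P (\<lambda>q. h q * k q) f g = P h f g * k g + h g * P k f g"
  by (simp add: P_antisym[of _ f] P_mult_right C_inf_mult[OF atl])

lemma P_zero_right: "f \<in> C \<Longrightarrow> P f (\<lambda>q. 0) g = 0"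
  using P_cmult_right[of f "\<lambda>q. 0" 0] C_inf_const[OF atl] by simp

lemma P_sum_right: "f \<in> C \<Longrightarrow> (\<And>i. i \<in> I \<Longrightarrow> h i \<in> C) \<Longrightarrow> P f (\<lambda>q. \<Sum>i\<in>I. h i q) g = (\<Sum>i\<in>I. P f (h i) g)"
  by (induction I rule: infinite_finite_induct) (simp_all add: P_zero_right P_add_right C_inf_sum[OF atl])

lemma P_multiplicative:
  assumes "f \<in> C" "h \<in> C"
  shows "P f h (g \<cdot> k) = P (\<lambda>p. f (p \<cdot> k)) (\<lambda>p. h (p \<cdot> k)) g + P (\<lambda>q. f (g \<cdot> q)) (\<lambda>q. h (g \<cdot> q)) k"
proof -
  have "(\<lambda>(g, k). P f h (g \<cdot> k)) = prod_poisson P P (\<lambda>(g, k). f (g \<cdot> k)) (\<lambda>(g, k). h (g \<cdot> k))"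
    using plg assms unfolding poisson_lie_group_def by blast
  from fun_cong[OF this, of "(g, k)"] show ?thesis by (simp add: prod_poisson_def)
qed

text \<open>Multiplicativity at the pair (e, e) says that the value equals its own double.\<close>

lemma P_unit: "f \<in> C \<Longrightarrow> h \<in> C \<Longrightarrow> P f h e = 0"
  using P_multiplicative[of f h e e] by simp

text \<open>The cut-off is there for \<open>vector_field\<close>, which demands 0 outside
  \<open>C\<close>, whereas \<open>P\<close> is unconstrained there.\<close>

definition ham :: "('m \<Rightarrow> real) \<Rightarrow> 'm vfield" where
  "ham f h = (if h \<in> C then P f h else (\<lambda>q. 0))"

lemma ham_vector_field: "f \<in> C \<Longrightarrow> vector_field A (ham f)"
  unfolding vector_field_def ham_def
  by (auto simp: P_C P_add_right P_cmult_right P_mult_right C_inf_add[OF atl] C_inf_mult[OF atl] C_inf_cmult[OF atl] intro!: ext)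

lemma ham_E: "f \<in> C \<Longrightarrow> h \<in> C \<Longrightarrow> P f h g = E (vcoef (ham f) g) h g"
  using vcoef_eq[OF ham_vector_field] by (simp add: ham_def)

text \<open>The coefficients of the Hamiltonian field of \<open>f\<close> are themselves derivations in \<open>f\<close>, hence
  vector fields, so that the Poisson tensor has smooth coefficients.\<close>

lemma ham_coef_vector_field:
  assumes l: "linear l"
  shows "vector_field A (\<lambda>f. if f \<in> C then \<lambda>g. l (vcoef (ham f) g) else (\<lambda>q. 0))"
proof -
  have 1: "vcoef (ham (\<lambda>q. f q + h q)) g = vcoef (ham f) g + vcoef (ham h) g" if "f \<in> C" "h \<in> C" for f h g
    by (rule vcoef_unique) (use that in \<open>simp add: ham_def P_add_left ham_E linear_add[OF E_linear]\<close>)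
  have 2: "vcoef (ham (\<lambda>q. r * f q)) g = r *\<^sub>R vcoef (ham f) g" if "f \<in> C" for f r g
    by (rule vcoef_unique) (use that in \<open>simp add: ham_def P_cmult_left ham_E linear_scale[OF E_linear]\<close>)
  have 3: "vcoef (ham (\<lambda>q. f q * h q)) g = h g *\<^sub>R vcoef (ham f) g + f g *\<^sub>R vcoef (ham h) g" if "f \<in> C" "h \<in> C" for f h g
    by (rule vcoef_unique)
      (use that in \<open>simp add: ham_def P_mult_left ham_E linear_scale[OF E_linear] linear_add[OF E_linear]\<close>)
  show ?thesis
    unfolding vector_field_def
    by (auto simp: vcoef_C[OF ham_vector_field l] C_inf_add[OF atl] C_inf_mult[OF atl] C_inf_cmult[OF atl] 1 2 3
        linear_add[OF l] linear_scale[OF l] intro!: ext)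
qed

text \<open>These are the components of the Poisson bivector in the left-invariant frame of
  \<open>B\<close>.\<close>

definition poisson_coeffs :: "'v set \<Rightarrow> ('v \<Rightarrow> 'v \<Rightarrow> 'm \<Rightarrow> real) \<Rightarrow> bool" where
  "poisson_coeffs B \<pi> \<longleftrightarrow> (\<forall>a b. \<pi> a b \<in> C) \<and>
    (\<forall>f\<in>C. \<forall>h\<in>C. \<forall>g. P f h g = (\<Sum>a\<in>B. \<Sum>b\<in>B. \<pi> a b g * (E a f g * E b h g)))"

lemma poisson_coeffsD:
  assumes "poisson_coeffs B \<pi>"
  shows "\<pi> a b \<in> C" "f \<in> C \<Longrightarrow> h \<in> C \<Longrightarrow> P f h g = (\<Sum>a\<in>B. \<Sum>b\<in>B. \<pi> a b g * (E a f g * E b h g))"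
  using assms unfolding poisson_coeffs_def by blast+

text \<open>The frame expansion is used twice: for the Hamiltonian field of f, and for its
  coefficients \<open>Y b\<close>, which are vector fields in their own right.\<close>

lemma ex_poisson_coeffs:
  assumes B: "is_basis B"
  shows "\<exists>\<pi>. poisson_coeffs B \<pi>"
proof -
  define Y where "Y b = (\<lambda>f. if f \<in> C then \<lambda>g. representation B (vcoef (ham f) g) b else (\<lambda>q. 0))" for b
  have Y: "vector_field A (Y b)" for b
    unfolding Y_def by (rule ham_coef_vector_field[OF linear_representation[OF B]])
  define \<pi> where "\<pi> a b = (\<lambda>g. representation B (vcoef (Y b) g) a)" for a b
  have "\<pi> a b \<in> C" for a b unfolding \<pi>_def by (rule vcoef_C[OF Y linear_representation[OF B]])
  moreover have "P f h g = (\<Sum>a\<in>B. \<Sum>b\<in>B. \<pi> a b g * (E a f g * E b h g))" if f: "f \<in> C" and h: "h \<in> C" for f h g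
  proof -
    have "P f h g = (\<Sum>b\<in>B. Y b f g * E b h g)"
      using vector_field_basis[OF ham_vector_field[OF f] B h, of g] f h by (simp add: ham_def Y_def)
    also have "\<dots> = (\<Sum>b\<in>B. \<Sum>a\<in>B. \<pi> a b g * (E a f g * E b h g))"
      by (simp add: vector_field_basis[OF Y B f] \<pi>_def sum_distrib_right mult.assoc)
    also have "\<dots> = (\<Sum>a\<in>B. \<Sum>b\<in>B. \<pi> a b g * (E a f g * E b h g))" by (rule sum.swap)
    finally show ?thesis .
  qed
  ultimately show ?thesis unfolding poisson_coeffs_def by blast
qed

text \<open>Two functions whose differentials at the identity are dual basis vectors single out one
  coefficient of the bracket, and \<open>P_unit\<close> makes it vanish.\<close>

lemma poisson_coeffs_unit:
  assumes B: "is_basis B" and co: "poisson_coeffs B \<pi>"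
    and ab: "a \<in> B" "b \<in> B"
  shows "\<pi> a b e = 0"
proof -
  have fin: "finite B" and ind: "independent B" using B by (auto simp: is_basis_def)
  obtain f where f: "f \<in> C" "\<And>y. T y f = representation B y a" using ex_C_differential[OF linear_representation[OF B]] by blast
  obtain h where h: "h \<in> C" "\<And>y. T y h = representation B y b" using ex_C_differential[OF linear_representation[OF B]] by blast
  have r: "representation B x y = (if y = x then 1 else 0)" if "x \<in> B" for x y
    by (simp add: representation_basis[OF ind that])
  have "0 = P f h e" by (simp add: P_unit f h)
  also have "\<dots> = (\<Sum>a'\<in>B. \<Sum>b'\<in>B. \<pi> a' b' e * ((if a = a' then 1 else 0) * (if b = b' then 1 else 0)))"
    by (simp add: poisson_coeffsD(2)[OF co f(1) h(1)] E_unit f h r cong: sum.cong)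
  also have "\<dots> = (\<Sum>a'\<in>B. \<Sum>b'\<in>B. if a = a' then if b = b' then \<pi> a' b' e else 0 else 0)"
    by (intro sum.cong refl) simp
  also have "\<dots> = (\<Sum>a'\<in>B. if a = a' then \<pi> a' b e else 0)"
  proof (rule sum.cong[OF refl])
    show "(\<Sum>b'\<in>B. if a = a' then if b = b' then \<pi> a' b' e else 0 else 0) = (if a = a' then \<pi> a' b e else 0)" for a'
      using fin ab by (cases "a = a'") simp_all
  qed
  also have "\<dots> = \<pi> a b e" using fin ab by (simp add: sum.delta')
  finally show ?thesis by simp
qed

text \<open>The Leibniz rule in a form that shows what survives where the coefficients vanish at the
  identity: only the terms with a derivative of \<open>\<pi>\<close>.\<close>

lemma T_sum_mult3:
  assumes "finite B" "\<And>a b. a \<in> B \<Longrightarrow> b \<in> B \<Longrightarrow> \<pi> a b \<in> C" "\<And>a. a \<in> B \<Longrightarrow> u a \<in> C" "\<And>a. a \<in> B \<Longrightarrow> w a \<in> C"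
  shows "T x (\<lambda>g. \<Sum>a\<in>B. \<Sum>b\<in>B. \<pi> a b g * (u a g * w b g)) =
    (\<Sum>a\<in>B. \<Sum>b\<in>B. T x (\<pi> a b) * (u a e * w b e) + \<pi> a b e * (T x (u a) * w b e + u a e * T x (w b)))"
  using assms by (simp add: T_sum T_mult C_inf_sum[OF atl] C_inf_mult[OF atl])

text \<open>Since the Poisson tensor vanishes at the identity, its derivative there does not see the
  translation.\<close>

lemma T_right_translated_bracket:
  assumes f: "f \<in> C" and h: "h \<in> C"
  shows "T x (\<lambda>g. P (\<lambda>k. f (k \<cdot> iv g)) (\<lambda>k. h (k \<cdot> iv g)) g) = T x (P f h)"
proof -
  obtain B :: "'v set" where B: "is_basis B" using ex_is_basis by blast
  then have fin: "finite B" by (simp add: is_basis_def)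
  obtain \<pi> where co: "poisson_coeffs B \<pi>" using ex_poisson_coeffs[OF B] by blast
  note \<pi> = poisson_coeffsD(1)[OF co] and P = poisson_coeffsD(2)[OF co]
  note \<pi>0 = poisson_coeffs_unit[OF B co]
  \<comment> \<open>The left-invariant derivative at g of the right translate of f is
    \<open>T a\<close> of f after conjugation by g; at the identity it reduces to
    \<open>T a f\<close>.\<close>
  define u where "u f a = (\<lambda>g. T a (\<lambda>k. f (g \<cdot> k \<cdot> iv g)))" for f a
  have uC: "u f a \<in> C" if f: "f \<in> C" for f a
    unfolding u_def
    by (rule T_param_C, rule C_compose[OF f], (assumption | rule plot_mul plot_const plot_iv plot_open)+,
        rule smooth_chart_pair[OF f]) (assumption | rule plot_mul plot_iv)+
  have uE: "E a (\<lambda>k. f (k \<cdot> iv g)) g = u f a g" if "f \<in> C" for f a g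
    by (simp add: u_def E_eq C_right that)
  have ue: "u f a e = T a f" for f a by (simp add: u_def)
  have "P (\<lambda>k. f (k \<cdot> iv g)) (\<lambda>k. h (k \<cdot> iv g)) g = (\<Sum>a\<in>B. \<Sum>b\<in>B. \<pi> a b g * (u f a g * u h b g))" for g
    by (simp add: P C_right f h uE)
  moreover have "T x (\<lambda>g. \<Sum>a\<in>B. \<Sum>b\<in>B. \<pi> a b g * (u f a g * u h b g)) = (\<Sum>a\<in>B. \<Sum>b\<in>B. T x (\<pi> a b) * (T a f * T b h))"
    by (simp add: T_sum_mult3[OF fin \<pi> uC[OF f] uC[OF h]] ue \<pi>0 cong: sum.cong)
  moreover have "P f h = (\<lambda>g. \<Sum>a\<in>B. \<Sum>b\<in>B. \<pi> a b g * (E a f g * E b h g))"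
    by (rule ext) (rule P[OF f h])
  moreover have "T x (\<lambda>g. \<Sum>a\<in>B. \<Sum>b\<in>B. \<pi> a b g * (E a f g * E b h g)) = (\<Sum>a\<in>B. \<Sum>b\<in>B. T x (\<pi> a b) * (T a f * T b h))"
    by (simp add: T_sum_mult3[OF fin \<pi> E_C[OF f] E_C[OF h]] E_unit f h \<pi>0 cong: sum.cong)
  ultimately show ?thesis by simp
qed

text \<open>In \<open>P_multiplicative\<close> at (g, k) the first summand depends on k only through
  the translated functions, so its derivative at k = e falls on f and h while the tensor stays
  frozen at g. The second summand, a bracket of left translates, contributes the last term.\<close>

lemma E_poisson:
  assumes f: "f \<in> C" and h: "h \<in> C"
  shows "E x (P f h) g = P (E x f) h g + P f (E x h) g + T x (P (\<lambda>q. f (g \<cdot> q)) (\<lambda>q. h (g \<cdot> q)))"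
proof -
  obtain B :: "'v set" where B: "is_basis B" using ex_is_basis by blast
  then have fin: "finite B" by (simp add: is_basis_def)
  obtain \<pi> where co: "poisson_coeffs B \<pi>" using ex_poisson_coeffs[OF B] by blast
  note \<pi> = poisson_coeffsD(1)[OF co] and P = poisson_coeffsD(2)[OF co]
  define u where "u f a = (\<lambda>k. T a (\<lambda>m. f (g \<cdot> m \<cdot> k)))" for f a
  have F: "(\<lambda>m. f (g \<cdot> m \<cdot> k)) \<in> C" "(\<lambda>k. f (g \<cdot> m \<cdot> k)) \<in> C" if "f \<in> C" for f k m
    by (rule C_compose[OF that], (assumption | rule plot_mul plot_const plot_open)+)+
  have uC: "u f a \<in> C" if f: "f \<in> C" for f a
    unfolding u_def
    by (rule T_param_C[OF F(1)[OF f]], rule smooth_chart_pair[OF f]) (assumption | rule plot_mul plot_const plot_open)+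
  have uE: "E a (\<lambda>p. f (p \<cdot> k)) g = u f a k" if "f \<in> C" for f a k
    by (simp add: u_def E_eq C_right that)
  have ue: "u f a e = E a f g" if "f \<in> C" for f a using that by (simp add: u_def E_eq)
  \<comment> \<open>As k stands to the right of m, the derivative in k turns f into
    \<open>E x f\<close> before \<open>E a\<close> acts. The opposite order would produce
    commutators of frame fields.\<close>
  have uT: "T x (u f a) = E a (E x f) g" if f: "f \<in> C" for f a
  proof -
    have eq: "(\<lambda>m. T x (\<lambda>k. f (g \<cdot> m \<cdot> k))) = (\<lambda>m. E x f (g \<cdot> m))"
      by (simp add: E_eq f)
    have "T x (u f a) = T a (\<lambda>m. T x (\<lambda>k. f (g \<cdot> m \<cdot> k)))"
      unfolding u_def
    proof (rule T_commute[OF F[OF f] uC[OF f, unfolded u_def]])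
      show "(\<lambda>m. T x (\<lambda>k. f (g \<cdot> m \<cdot> k))) \<in> C" unfolding eq by (rule C_left[OF E_C[OF f]])
      show "smooth_on (\<lambda>z. f (g \<cdot> inv_into U c (snd z) \<cdot> inv_into U c (fst z))) (c ` U \<times> c ` U)"
        if "(U, c) \<in> A" for U c
        by (rule smooth_chart_pair[OF f that that]) (assumption | rule plot_mul plot_const plot_open)+
    qed
    then show ?thesis by (simp add: eq E_eq[OF E_C[OF f]])
  qed
  have eq: "P (\<lambda>p. f (p \<cdot> k)) (\<lambda>p. h (p \<cdot> k)) g = (\<Sum>a\<in>B. \<Sum>b\<in>B. \<pi> a b g * (u f a k * u h b k))" for k
    by (simp add: P C_right f h uE)
  have sC: "(\<lambda>k. \<Sum>a\<in>B. \<Sum>b\<in>B. \<pi> a b g * (u f a k * u h b k)) \<in> C"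
    by (intro C_inf_sum[OF atl] C_inf_cmult[OF atl] C_inf_mult[OF atl] uC f h)
  have "T x (\<lambda>k. \<Sum>a\<in>B. \<Sum>b\<in>B. \<pi> a b g * (u f a k * u h b k)) =
    (\<Sum>a\<in>B. \<Sum>b\<in>B. \<pi> a b g * (E a (E x f) g * E b h g + E a f g * E b (E x h) g))"
    by (simp add: T_sum T_cmult T_mult C_inf_sum[OF atl] C_inf_mult[OF atl] C_inf_cmult[OF atl] uC f h ue uT)
  also have "\<dots> = P (E x f) h g + P f (E x h) g"
    by (simp add: P E_C f h sum.distrib distrib_left)
  finally have 1: "T x (\<lambda>k. P (\<lambda>p. f (p \<cdot> k)) (\<lambda>p. h (p \<cdot> k)) g) = P (E x f) h g + P f (E x h) g"
    by (simp only: eq)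
  have "E x (P f h) g = T x (\<lambda>k. P (\<lambda>p. f (p \<cdot> k)) (\<lambda>p. h (p \<cdot> k)) g + P (\<lambda>q. f (g \<cdot> q)) (\<lambda>q. h (g \<cdot> q)) k)"
    by (simp add: E_eq P_C f h P_multiplicative)
  also have "\<dots> = T x (\<lambda>k. P (\<lambda>p. f (p \<cdot> k)) (\<lambda>p. h (p \<cdot> k)) g) + T x (P (\<lambda>q. f (g \<cdot> q)) (\<lambda>q. h (g \<cdot> q)))"
    by (rule T_add) (simp_all add: eq sC P_C C_left f h)
  finally show ?thesis by (simp only: 1)
qed

end

section \<open>Dual pairs\<close>

lemma dual_pairing_linear:
  assumes "dual_pairing pair"
  shows "linear (pair \<phi>)" "linear (\<lambda>\<phi>. pair \<phi> x)"
  using assms by (auto simp: dual_pairing_def bilinear_def)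

lemma dual_pairing_flip: "dual_pairing pair \<Longrightarrow> dual_pairing (\<lambda>x \<phi>. pair \<phi> x)"
  by (auto simp: dual_pairing_def bilinear_def)

lemma dual_pairing_eqI:
  assumes "dual_pairing pair" "\<And>x. pair \<phi> x = pair \<psi> x" shows "\<phi> = \<psi>"
proof -
  have "pair (\<phi> - \<psi>) x = 0" for x
    using linear_diff[OF dual_pairing_linear(2)[OF assms(1)]] assms(2) by simp
  then have "\<phi> - \<psi> = 0" using assms(1) unfolding dual_pairing_def by blast
  then show ?thesis by simp
qed

text \<open>Values on a basis of \<open>'v\<close>, used as coordinates, embed the dual type into
  \<open>'v\<close> itself, and independence of the basis lets them be read back. Functionals and
  elements of \<open>'d\<close> become comparable there.\<close>

lemma dual_pairing_embedding:
  assumes pair: "dual_pairing pair" and B: "is_basis B"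
  shows "linear (\<lambda>\<phi>. \<Sum>b\<in>B. pair \<phi> b *\<^sub>R b)" "inj (\<lambda>\<phi>. \<Sum>b\<in>B. pair \<phi> b *\<^sub>R b)"
    and "(\<Sum>b\<in>B. pair \<phi> b *\<^sub>R b) = (\<Sum>b\<in>B. l b *\<^sub>R b) \<Longrightarrow> linear l \<Longrightarrow> pair \<phi> x = l x"
proof -
  have fin: "finite B" and ind: "independent B" using B by (auto simp: is_basis_def)
  show "linear (\<lambda>\<phi>. \<Sum>b\<in>B. pair \<phi> b *\<^sub>R b)"
    by (intro linear_compose_sum ballI linearI)
       (simp_all add: linear_add[OF dual_pairing_linear(2)[OF pair]] linear_scale[OF dual_pairing_linear(2)[OF pair]] scaleR_add_left)
  show *: "pair \<phi> x = l x" if "(\<Sum>b\<in>B. pair \<phi> b *\<^sub>R b) = (\<Sum>b\<in>B. l b *\<^sub>R b)" "linear l" for \<phi> x l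
  proof -
    have "(\<Sum>b\<in>B. (pair \<phi> b - l b) *\<^sub>R b) = 0"
      using that(1) by (simp add: scaleR_diff_left sum_subtractf)
    then have "pair \<phi> b = l b" if "b \<in> B" for b
      using independentD[OF ind fin, of "\<lambda>b. pair \<phi> b - l b" b] that by simp
    then show ?thesis
      using linear_is_basis_eq[OF B that(2), of x] linear_is_basis_eq[OF B dual_pairing_linear(1)[OF pair], of \<phi> x] by simp
  qed
  show "inj (\<lambda>\<phi>. \<Sum>b\<in>B. pair \<phi> b *\<^sub>R b)"
    by (rule injI) (intro dual_pairing_eqI[OF pair] * dual_pairing_linear(1)[OF pair])
qed

text \<open>The embeddings of \<open>'v\<close> into \<open>'d\<close> and of \<open>'d\<close> into
  \<open>'v\<close> compose to an injective endomorphism of \<open>'v\<close>, which is onto; so the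
  coordinate vector of any functional is attained by an element of \<open>'d\<close>.\<close>

lemma dual_pairing_ex:
  fixes pair :: "'d::fin_dim_normed_vector \<Rightarrow> 'v::fin_dim_normed_vector \<Rightarrow> real"
  assumes pair: "dual_pairing pair" and l: "linear l"
  shows "\<exists>\<phi>. \<forall>x. pair \<phi> x = l x"
proof -
  obtain B :: "'v set" where B: "is_basis B" using ex_is_basis by blast
  obtain D :: "'d set" where D: "is_basis D" using ex_is_basis by blast
  let ?J = "\<lambda>\<phi>. \<Sum>b\<in>B. pair \<phi> b *\<^sub>R b" and ?K = "\<lambda>x. \<Sum>d\<in>D. pair d x *\<^sub>R d"
  note J = dual_pairing_embedding[OF pair B]
  note K = dual_pairing_embedding[OF dual_pairing_flip[OF pair] D]
  have "linear (?J \<circ> ?K)" by (rule linear_compose[OF K(1) J(1)])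
  moreover have "inj (?J \<circ> ?K)" by (rule inj_compose[OF J(2) K(2)])
  ultimately have s: "surj (?J \<circ> ?K)" by (rule linear_inj_imp_surj_fin_dim)
  obtain z where z: "(\<Sum>b\<in>B. l b *\<^sub>R b) = (?J \<circ> ?K) z" using surjD[OF s] by blast
  have "pair (?K z) x = l x" for x
    by (rule J(3)[OF _ l]) (simp only: z comp_def)
  then show ?thesis by blast
qed

lemma of_functional_unique:
  assumes "dual_pairing pair" "\<And>x. pair \<phi> x = l x" shows "of_functional pair l = \<phi>"
  unfolding of_functional_def
  by (rule the_equality) (use assms in \<open>auto intro: dual_pairing_eqI[OF assms(1)]\<close>)

lemma of_functional_eq:
  fixes pair :: "'d::fin_dim_normed_vector \<Rightarrow> 'v::fin_dim_normed_vector \<Rightarrow> real"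
  assumes "dual_pairing pair" "linear l" shows "pair (of_functional pair l) x = l x"
  using dual_pairing_ex[OF assms] of_functional_unique[OF assms(1), of _ l] by metis

lemma dual_basis_eq:
  fixes pair :: "'d::fin_dim_normed_vector \<Rightarrow> 'v::fin_dim_normed_vector \<Rightarrow> real"
  assumes "dual_pairing pair" "is_basis B" shows "pair (dual_basis pair B b) x = representation B x b"
  unfolding dual_basis_def by (rule of_functional_eq[OF assms(1) linear_representation[OF assms(2)]])

section \<open>The preconnection of a pre-Lie structure\<close>

locale poisson_lie_bialgebra = poisson_lie_tangent G T P
  for G :: "('m::{t2_space, second_countable_topology}, 'v::fin_dim_normed_vector) lie_group_data" and T P +
  fixes pair :: "'d::fin_dim_normed_vector \<Rightarrow> 'v \<Rightarrow> real"
    and br :: "'v \<Rightarrow> 'v \<Rightarrow> 'v" and \<delta> :: "'v \<Rightarrow> 'd \<Rightarrow> 'd \<Rightarrow> real"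
  assumes bialg: "has_lie_bialgebra G P T pair br \<delta>"
begin

lemma pairing: "dual_pairing pair"
  using bialg by (simp add: has_lie_bialgebra_def)

lemmas pair_linear = dual_pairing_linear[OF pairing]
lemmas pair_eqI = dual_pairing_eqI[OF pairing]

lemma pair_simps [simp]:
  "pair (\<phi> + \<psi>) x = pair \<phi> x + pair \<psi> x" "pair (\<phi> - \<psi>) x = pair \<phi> x - pair \<psi> x"
  "pair (r *\<^sub>R \<phi>) x = r * pair \<phi> x" "pair 0 x = 0"
  "pair (sum s I) x = (\<Sum>i\<in>I. pair (s i) x)"
  using linear_add[OF pair_linear(2)] linear_diff[OF pair_linear(2)] linear_scale[OF pair_linear(2)]
    linear_0[OF pair_linear(2)] linear_sum[OF pair_linear(2)] by auto

text \<open>Once the right translations have dropped out, the cobracket is the linearisation of the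
  Poisson bracket at the identity.\<close>

lemma delta_eq:
  assumes f: "f \<in> C" and h: "h \<in> C" and "\<And>y. pair \<phi> y = T y f" "\<And>y. pair \<psi> y = T y h"
  shows "\<delta> x \<phi> \<psi> = T x (P f h)"
proof -
  have "\<delta> x \<phi> \<psi> = T x (\<lambda>g. P (\<lambda>k. f (k \<cdot> iv g)) (\<lambda>k. h (k \<cdot> iv g)) g)"
    using bialg assms unfolding has_lie_bialgebra_def by blast
  then show ?thesis by (simp only: T_right_translated_bracket[OF f h])
qed

text \<open>Representing both covectors by functions turns the cobracket into \<open>T x\<close> of
  one fixed function, hence makes it linear in x; that is what \<open>of_functional\<close>
  needs.\<close>

lemma dual_bracket_eq: "pair (dual_bracket pair \<delta> \<phi> \<psi>) x = \<delta> x \<phi> \<psi>"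
proof -
  obtain f where f: "f \<in> C" "\<And>y. T y f = pair \<phi> y" using ex_C_differential[OF pair_linear(1)] by blast
  obtain h where h: "h \<in> C" "\<And>y. T y h = pair \<psi> y" using ex_C_differential[OF pair_linear(1)] by blast
  have "\<delta> x \<phi> \<psi> = T x (P f h)" for x using f h by (intro delta_eq) auto
  then have "linear (\<lambda>x. \<delta> x \<phi> \<psi>)" using T_linear by simp
  then show ?thesis unfolding dual_bracket_def by (rule of_functional_eq[OF pairing])
qed

section \<open>Differentials and 1-forms in the left trivialisation\<close>

definition df :: "('m \<Rightarrow> real) \<Rightarrow> 'm \<Rightarrow> 'd" where
  "df f g = of_functional pair (\<lambda>x. E x f g)"

lemma pair_df [simp]: "pair (df f g) x = E x f g"
  unfolding df_def by (rule of_functional_eq[OF pairing E_linear])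

text \<open>The left translates of f and h by g have the differentials \<open>df f g\<close> and
  \<open>df h g\<close> at the identity, so \<open>delta_eq\<close> identifies the last term of
  \<open>E_poisson\<close>.\<close>

lemma E_poisson_dual_bracket:
  assumes f: "f \<in> C" and h: "h \<in> C"
  shows "E x (P f h) g = P (E x f) h g + P f (E x h) g + pair (dual_bracket pair \<delta> (df f g) (df h g)) x"
proof -
  have "\<delta> x (df f g) (df h g) = T x (P (\<lambda>q. f (g \<cdot> q)) (\<lambda>q. h (g \<cdot> q)))"
    by (rule delta_eq) (simp_all add: C_left E_eq f h)
  then show ?thesis by (simp only: E_poisson[OF f h] dual_bracket_eq)
qed

text \<open>Smoothness is tested through the pairing, which reduces every question to scalar
  functions in \<open>C\<close>.\<close>

definition smooth_dual :: "('m \<Rightarrow> 'd) \<Rightarrow> bool" where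
  "smooth_dual s \<longleftrightarrow> (\<forall>x. (\<lambda>q. pair (s q) x) \<in> C)"

definition dual_form :: "('m \<Rightarrow> 'd) \<Rightarrow> 'm form" where
  "dual_form s = (\<lambda>X. if vector_field A X then (\<lambda>q. pair (s q) (vcoef X q)) else (\<lambda>q. 0))"

definition form_coef :: "'m form \<Rightarrow> 'm \<Rightarrow> 'd" where
  "form_coef \<tau> q = of_functional pair (\<lambda>x. \<tau> (E x) q)"

lemma form_coef_unique: "(\<And>x. \<tau> (E x) q = pair \<phi> x) \<Longrightarrow> form_coef \<tau> q = \<phi>"
  unfolding form_coef_def by (rule of_functional_unique[OF pairing]) simp

lemma pair_dual_basis [simp]: "is_basis B \<Longrightarrow> pair (dual_basis pair B b) x = representation B x b"
  by (rule dual_basis_eq[OF pairing])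

lemma smooth_dualD: "smooth_dual s \<Longrightarrow> (\<lambda>q. pair (s q) x) \<in> C"
  by (simp add: smooth_dual_def)

lemma smooth_dual_df: "f \<in> C \<Longrightarrow> smooth_dual (df f)"
  by (simp add: smooth_dual_def E_C)

lemma smooth_dual_add: "smooth_dual s \<Longrightarrow> smooth_dual t \<Longrightarrow> smooth_dual (\<lambda>q. s q + t q)"
  by (simp add: smooth_dual_def C_inf_add[OF atl])

lemma smooth_dual_scale: "a \<in> C \<Longrightarrow> smooth_dual s \<Longrightarrow> smooth_dual (\<lambda>q. a q *\<^sub>R s q)"
  by (simp add: smooth_dual_def C_inf_mult[OF atl])

lemma linear_on_dual:
  assumes "linear (l :: 'd \<Rightarrow> real)" obtains y where "\<And>\<phi>. l \<phi> = pair \<phi> y"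
  using dual_pairing_ex[OF dual_pairing_flip[OF pairing] assms] by metis

lemma smooth_dual_linear:
  assumes s: "smooth_dual s" and l: "linear (l :: 'd \<Rightarrow> real)" shows "(\<lambda>q. l (s q)) \<in> C"
proof -
  obtain y where "\<And>\<phi>. l \<phi> = pair \<phi> y" using linear_on_dual[OF l] by blast
  then show ?thesis using smooth_dualD[OF s] by simp
qed

lemma bilinear_expand:
  assumes D: "is_basis D" and \<beta>: "bilinear (\<beta> :: 'd \<Rightarrow> 'd \<Rightarrow> real)"
  shows "\<beta> \<phi> \<psi> = (\<Sum>d\<in>D. representation D \<phi> d * \<beta> d \<psi>)"
proof -
  have "linear (\<lambda>\<phi>. \<beta> \<phi> \<psi>)" using \<beta> by (simp add: bilinear_def)
  from linear_is_basis_eq[OF D this, of \<phi>] show ?thesis by (simp only: real_scaleR_def)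
qed

lemma smooth_dual_bilinear:
  assumes s: "smooth_dual s" and t: "smooth_dual t" and \<beta>: "bilinear (\<beta> :: 'd \<Rightarrow> 'd \<Rightarrow> real)"
  shows "(\<lambda>q. \<beta> (s q) (t q)) \<in> C"
proof -
  obtain D :: "'d set" where D: "is_basis D" using ex_is_basis by blast
  have l: "linear (\<beta> d)" for d using \<beta> by (simp add: bilinear_def)
  have "(\<lambda>q. \<Sum>d\<in>D. representation D (s q) d * \<beta> d (t q)) \<in> C"
    by (intro C_inf_sum[OF atl] C_inf_mult[OF atl] smooth_dual_linear[OF s linear_representation[OF D]] smooth_dual_linear[OF t l])
  then show ?thesis by (simp only: bilinear_expand[OF D \<beta>, symmetric])
qed

lemma dual_form_add: "form_add (dual_form s) (dual_form t) = dual_form (\<lambda>q. s q + t q)"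
  and dual_form_diff: "form_diff (dual_form s) (dual_form t) = dual_form (\<lambda>q. s q - t q)"
  and dual_form_scale: "form_scale a (dual_form s) = dual_form (\<lambda>q. a q *\<^sub>R s q)"
  by (auto simp: form_add_def form_diff_def form_scale_def dual_form_def intro!: ext)

lemma form_coef_dual_form [simp]: "form_coef (dual_form s) = s"
  by (rule ext, rule form_coef_unique) (simp add: dual_form_def E_vector_field vcoef_E)

lemma vector_field_add:
  "vector_field A X \<Longrightarrow> vector_field A Y \<Longrightarrow> vector_field A (\<lambda>f q. X f q + Y f q)"
  unfolding vector_field_def by (auto simp: C_inf_add[OF atl] algebra_simps intro!: ext)

lemma vector_field_scale:
  "vector_field A X \<Longrightarrow> a \<in> C \<Longrightarrow> vector_field A (\<lambda>f q. a q * X f q)"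
  unfolding vector_field_def by (auto simp: C_inf_mult[OF atl] algebra_simps intro!: ext)

lemma one_form_dual_form:
  assumes s: "smooth_dual s" shows "one_form A (dual_form s)"
proof -
  obtain B :: "'v set" where B: "is_basis B" using ex_is_basis by blast
  have C: "(\<lambda>q. pair (s q) (vcoef X q)) \<in> C" if X: "vector_field A X" for X
  proof -
    have "pair (s q) (vcoef X q) = (\<Sum>b\<in>B. representation B (vcoef X q) b * pair (s q) b)" for q
      using linear_is_basis_eq[OF B pair_linear(1), of "s q" "vcoef X q"] by (simp only: real_scaleR_def)
    then show ?thesis
      by (simp only:) (intro C_inf_sum[OF atl] C_inf_mult[OF atl] vcoef_C[OF X linear_representation[OF B]] smooth_dualD[OF s])
  qed
  show ?thesis
    unfolding one_form_def dual_form_def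
    by (auto simp: C vector_field_add vector_field_scale vcoef_add vcoef_scale linear_add[OF pair_linear(1)] linear_scale[OF pair_linear(1)])
qed

lemma one_form_C: "one_form A \<tau> \<Longrightarrow> vector_field A X \<Longrightarrow> \<tau> X \<in> C"
  and one_form_add: "one_form A \<tau> \<Longrightarrow> vector_field A X \<Longrightarrow> vector_field A Y \<Longrightarrow>
    \<tau> (\<lambda>f q. X f q + Y f q) = (\<lambda>q. \<tau> X q + \<tau> Y q)"
  and one_form_scale: "one_form A \<tau> \<Longrightarrow> a \<in> C \<Longrightarrow> vector_field A X \<Longrightarrow>
    \<tau> (\<lambda>f q. a q * X f q) = (\<lambda>q. a q * \<tau> X q)"
  by (simp_all add: one_form_def)

lemma one_form_linear:
  assumes \<tau>: "one_form A \<tau>" shows "linear (\<lambda>x. \<tau> (E x) q)"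
proof (rule linearI)
  fix x y r
  have "E (x + y) = (\<lambda>f q. E x f q + E y f q)" by (intro ext linear_add[OF E_linear])
  then show "\<tau> (E (x + y)) q = \<tau> (E x) q + \<tau> (E y) q"
    using one_form_add[OF \<tau> E_vector_field E_vector_field, of x y] by simp
  have "E (r *\<^sub>R x) = (\<lambda>f q. r * E x f q)" by (intro ext) (simp add: linear_scale[OF E_linear])
  moreover have "\<tau> (\<lambda>f q. (\<lambda>q. r) q * E x f q) = (\<lambda>q. (\<lambda>q. r) q * \<tau> (E x) q)"
    by (rule one_form_scale[OF \<tau> C_inf_const[OF atl] E_vector_field])
  ultimately show "\<tau> (E (r *\<^sub>R x)) q = r *\<^sub>R \<tau> (E x) q" by simp
qed

lemma pair_form_coef: "one_form A \<tau> \<Longrightarrow> pair (form_coef \<tau> q) x = \<tau> (E x) q"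
  unfolding form_coef_def by (rule of_functional_eq[OF pairing one_form_linear])

lemma smooth_form_coef: "one_form A \<tau> \<Longrightarrow> smooth_dual (form_coef \<tau>)"
  by (simp add: smooth_dual_def pair_form_coef one_form_C E_vector_field)

text \<open>X is a finite combination of frame fields with smooth coefficients, so
  function-linearity determines the form by its values on the frame. This is the bijection between
  1-forms and dual-valued functions on which the construction rests.\<close>

lemma one_form_eq:
  assumes \<tau>: "one_form A \<tau>" shows "\<tau> = dual_form (form_coef \<tau>)"
proof (intro ext)
  fix X q
  show "\<tau> X q = dual_form (form_coef \<tau>) X q"
  proof (cases "vector_field A X")
    case False
    then show ?thesis using \<tau> by (simp add: one_form_def dual_form_def)
  next
    case True
    obtain B :: "'v set" where B: "is_basis B" using ex_is_basis by blast
    then have fin: "finite B" by (simp add: is_basis_def)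
    let ?c = "\<lambda>b q. representation B (vcoef X q) b"
    have c: "?c b \<in> C" for b by (rule vcoef_C[OF True linear_representation[OF B]])
    \<comment> \<open>The induction must carry along that partial sums are vector fields, because
      forms are additive on vector fields only.\<close>
    have "vector_field A (\<lambda>f q. \<Sum>b\<in>I. ?c b q * E b f q) \<and>
        \<tau> (\<lambda>f q. \<Sum>b\<in>I. ?c b q * E b f q) = (\<lambda>q. \<Sum>b\<in>I. ?c b q * \<tau> (E b) q)" if "finite I" for I
      using that
    proof (induction I)
      case empty
      have z: "vector_field A (\<lambda>f q. 0)" unfolding vector_field_def by (simp add: C_inf_const[OF atl])
      have "\<tau> (\<lambda>f q. (\<lambda>q. 0) q * (\<lambda>f q. 0) f q) = (\<lambda>q. (\<lambda>q. 0) q * \<tau> (\<lambda>f q. 0) q)"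
        by (rule one_form_scale[OF \<tau> C_inf_const[OF atl] z])
      then show ?case using z by simp
    next
      case (insert a I)
      let ?Y = "\<lambda>f q. \<Sum>b\<in>I. ?c b q * E b f q" and ?Z = "\<lambda>f q. ?c a q * E a f q"
      have Z: "vector_field A ?Z"
        by (rule vector_field_scale[OF E_vector_field c])
      have Y: "vector_field A ?Y" using insert.IH by blast
      have "vector_field A (\<lambda>f q. ?Z f q + ?Y f q)"
        by (rule vector_field_add[OF Z Y])
      moreover have "\<tau> (\<lambda>f q. ?Z f q + ?Y f q) = (\<lambda>q. \<tau> ?Z q + \<tau> ?Y q)"
        by (rule one_form_add[OF \<tau> Z Y])
      moreover have "\<tau> ?Z = (\<lambda>q. ?c a q * \<tau> (E a) q)"
        by (rule one_form_scale[OF \<tau> c E_vector_field])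
      ultimately show ?case using insert.hyps insert.IH by simp
    qed
    from this[OF fin] have "\<tau> (\<lambda>f q. \<Sum>b\<in>B. ?c b q * E b f q) = (\<lambda>q. \<Sum>b\<in>B. ?c b q * \<tau> (E b) q)" by blast
    moreover have "(\<lambda>f q. \<Sum>b\<in>B. ?c b q * E b f q) = X"
    proof (rule ext)
      fix f
      \<comment> \<open>Outside \<open>C\<close> both sides are 0 by convention, so the two fields
        agree as functions on all arguments.\<close>
      show "(\<lambda>q. \<Sum>b\<in>B. ?c b q * E b f q) = X f"
        by (cases "f \<in> C") (use True vector_field_basis[OF True B] in \<open>auto simp: E_notC vector_field_def\<close>)
    qed
    ultimately have "\<tau> X q = (\<Sum>b\<in>B. ?c b q * \<tau> (E b) q)" by simp
    also have "\<dots> = pair (form_coef \<tau> q) (vcoef X q)"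
      using linear_is_basis_eq[OF B pair_linear(1), of "form_coef \<tau> q" "vcoef X q"] by (simp add: pair_form_coef[OF \<tau>])
    finally show ?thesis using True by (simp add: dual_form_def)
  qed
qed

lemma ext_d_eq: assumes "f \<in> C" shows "ext_d A f = dual_form (df f)"
  using vcoef_eq assms by (auto simp: ext_d_def dual_form_def intro!: ext)

text \<open>In the trivialisation the coframe consists of constant functions. Values on the frame
  determine a 1-form, which settles the uniqueness behind the description operator.\<close>

lemma left_coframe_eq:
  assumes B: "is_basis B" and b: "b \<in> B"
  shows "left_coframe G T B b = dual_form (\<lambda>q. dual_basis pair B b)"
  unfolding left_coframe_def
proof (rule the_equality)
  have ind: "independent B" using B by (simp add: is_basis_def)
  have *: "representation B c b = (if c = b then 1 else 0)" if "c \<in> B" for c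
    using representation_basis[OF ind that] by auto
  show "one_form A (dual_form (\<lambda>q. dual_basis pair B b)) \<and>
    (\<forall>c\<in>B. dual_form (\<lambda>q. dual_basis pair B b) (E c) = (\<lambda>g. if c = b then 1 else 0))"
    using one_form_dual_form[of "\<lambda>q. dual_basis pair B b"] *
    by (simp add: smooth_dual_def B C_inf_const[OF atl]) (simp add: dual_form_def E_vector_field vcoef_E B)
  fix \<omega> assume \<omega>: "one_form A \<omega> \<and> (\<forall>c\<in>B. \<omega> (E c) = (\<lambda>g. if c = b then 1 else 0))"
  have "form_coef \<omega> q = dual_basis pair B b" for q
  proof (rule pair_eqI)
    fix x
    have "pair (form_coef \<omega> q) x = (\<Sum>c\<in>B. representation B x c *\<^sub>R pair (form_coef \<omega> q) c)"
      by (rule linear_is_basis_eq[OF B pair_linear(1)])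
    also have "\<dots> = (\<Sum>c\<in>B. representation B x c *\<^sub>R pair (dual_basis pair B b) c)"
      using \<omega> by (intro sum.cong refl) (simp add: pair_form_coef B *)
    also have "\<dots> = pair (dual_basis pair B b) x"
      by (rule linear_is_basis_eq[OF B pair_linear(1), symmetric])
    finally show "pair (form_coef \<omega> q) x = pair (dual_basis pair B b) x" .
  qed
  then have "form_coef \<omega> = (\<lambda>q. dual_basis pair B b)" by (rule ext)
  then show "\<omega> = dual_form (\<lambda>q. dual_basis pair B b)" using one_form_eq[of \<omega>] \<omega> by simp
qed

section \<open>The Poisson bracket with dual-valued functions\<close>

definition P_dual :: "('m \<Rightarrow> real) \<Rightarrow> ('m \<Rightarrow> 'd) \<Rightarrow> 'm \<Rightarrow> 'd" where
  "P_dual a s q = of_functional pair (\<lambda>x. P a (\<lambda>g. pair (s g) x) q)"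

lemma pair_P_dual:
  assumes a: "a \<in> C" and s: "smooth_dual s" shows "pair (P_dual a s q) x = P a (\<lambda>g. pair (s g) x) q"
proof -
  have "linear (\<lambda>x. P a (\<lambda>g. pair (s g) x) q)"
    by (rule linearI)
       (simp_all add: linear_add[OF pair_linear(1)] linear_scale[OF pair_linear(1)] P_add_right P_cmult_right a smooth_dualD[OF s])
  then show ?thesis unfolding P_dual_def by (rule of_functional_eq[OF pairing])
qed

lemma P_linear:
  assumes a: "a \<in> C" and s: "smooth_dual s" and l: "linear (l :: 'd \<Rightarrow> real)"
  shows "P a (\<lambda>g. l (s g)) q = l (P_dual a s q)"
proof -
  obtain y where "\<And>\<phi>. l \<phi> = pair \<phi> y" using linear_on_dual[OF l] by blast
  then show ?thesis by (simp add: pair_P_dual[OF a s])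
qed

text \<open>Expanding the first argument in a basis yields products of scalar functions, to which
  the Leibniz rule of \<open>P\<close> applies. The case in view is the bracket of a with
  \<open>\<Theta>\<close> of a differential and a form.\<close>

lemma P_bilinear:
  assumes a: "a \<in> C" and s: "smooth_dual s" and t: "smooth_dual t" and \<beta>: "bilinear (\<beta> :: 'd \<Rightarrow> 'd \<Rightarrow> real)"
  shows "P a (\<lambda>g. \<beta> (s g) (t g)) q = \<beta> (P_dual a s q) (t q) + \<beta> (s q) (P_dual a t q)"
proof -
  obtain D :: "'d set" where D: "is_basis D" using ex_is_basis by blast
  have l: "linear (\<beta> d)" for d using \<beta> by (simp add: bilinear_def)
  note r = linear_representation[OF D]
  have "P a (\<lambda>g. \<beta> (s g) (t g)) q = P a (\<lambda>g. \<Sum>d\<in>D. representation D (s g) d * \<beta> d (t g)) q"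
    by (simp only: bilinear_expand[OF D \<beta>, symmetric])
  also have "\<dots> = (\<Sum>d\<in>D. representation D (P_dual a s q) d * \<beta> d (t q) + representation D (s q) d * \<beta> d (P_dual a t q))"
    by (simp add: P_sum_right P_mult_right C_inf_mult[OF atl] smooth_dual_linear[OF s r] smooth_dual_linear[OF t l] a
        P_linear[OF a s r] P_linear[OF a t l])
  also have "\<dots> = \<beta> (P_dual a s q) (t q) + \<beta> (s q) (P_dual a t q)"
    by (simp only: sum.distrib bilinear_expand[OF D \<beta>, symmetric])
  finally show ?thesis .
qed

text \<open>This is \<open>E_poisson_dual_bracket\<close> freed from x; antisymmetry moves the
  differentiated a into the second slot of \<open>P\<close>, whence the minus sign.\<close>

lemma df_poisson:
  assumes a: "a \<in> C" and b: "b \<in> C"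
  shows "df (P a b) q = P_dual a (df b) q - P_dual b (df a) q + dual_bracket pair \<delta> (df a q) (df b q)"
proof (rule pair_eqI)
  fix x
  show "pair (df (P a b) q) x = pair (P_dual a (df b) q - P_dual b (df a) q + dual_bracket pair \<delta> (df a q) (df b q)) x"
    using P_antisym[OF b E_C[OF a], of x q]
    by (simp add: E_poisson_dual_bracket[OF a b] pair_P_dual a b smooth_dual_df)
qed

end

locale poisson_lie_pre_lie = poisson_lie_bialgebra G T P pair br \<delta>
  for G :: "('m::{t2_space, second_countable_topology}, 'v::fin_dim_normed_vector) lie_group_data" and T P
    and pair :: "'d::fin_dim_normed_vector \<Rightarrow> 'v \<Rightarrow> real" and br \<delta> +
  fixes \<Theta> :: "'d \<Rightarrow> 'd \<Rightarrow> 'd"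
  assumes pre_lie: "pre_lie_structure (dual_bracket pair \<delta>) \<Theta>"
begin

lemma Theta_bilinear: "bilinear \<Theta>"
  and Theta_assoc: "\<Theta> (\<Theta> x y) z - \<Theta> (\<Theta> y x) z = \<Theta> x (\<Theta> y z) - \<Theta> y (\<Theta> x z)"
  and Theta_commutator: "dual_bracket pair \<delta> x y = \<Theta> x y - \<Theta> y x"
  using pre_lie by (simp_all add: pre_lie_structure_def)

lemma Theta_linear: "linear (\<Theta> \<phi>)" "linear (\<lambda>\<phi>. \<Theta> \<phi> \<psi>)"
  using Theta_bilinear by (auto simp: bilinear_def)

lemmas Theta_simps =
  linear_add[OF Theta_linear(1)] linear_add[OF Theta_linear(2)] linear_diff[OF Theta_linear(1)]
  linear_diff[OF Theta_linear(2)] linear_scale[OF Theta_linear(1)] linear_scale[OF Theta_linear(2)]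

lemma pair_Theta_bilinear: "bilinear (\<lambda>\<phi> \<psi>. pair (\<Theta> \<phi> \<psi>) x)"
  unfolding bilinear_def by (intro conjI allI linearI) (simp_all add: Theta_simps)

section \<open>The preconnection and its four properties\<close>

definition conn :: "('m \<Rightarrow> real) \<Rightarrow> ('m \<Rightarrow> 'd) \<Rightarrow> 'm \<Rightarrow> 'd" where
  "conn a s q = P_dual a s q + \<Theta> (df a q) (s q)"

definition preconn :: "'m preconn" where
  "preconn a \<tau> = dual_form (conn a (form_coef \<tau>))"

lemma pair_conn:
  "a \<in> C \<Longrightarrow> smooth_dual s \<Longrightarrow> pair (conn a s q) x = P a (\<lambda>g. pair (s g) x) q + pair (\<Theta> (df a q) (s q)) x"
  by (simp add: conn_def pair_P_dual)

lemma smooth_conn: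
  assumes a: "a \<in> C" and s: "smooth_dual s" shows "smooth_dual (conn a s)"
  unfolding smooth_dual_def
  using smooth_dual_bilinear[OF smooth_dual_df[OF a] s pair_Theta_bilinear]
  by (simp add: pair_conn[OF a s] C_inf_add[OF atl] P_C[OF a smooth_dualD[OF s]])

lemma df_algebra:
  shows "a \<in> C \<Longrightarrow> b \<in> C \<Longrightarrow> df (\<lambda>q. a q + b q) q = df a q + df b q"
    and "a \<in> C \<Longrightarrow> df (\<lambda>q. r * a q) q = r *\<^sub>R df a q"
    and "a \<in> C \<Longrightarrow> b \<in> C \<Longrightarrow> df (\<lambda>q. a q * b q) q = b q *\<^sub>R df a q + a q *\<^sub>R df b q"
  by (rule pair_eqI, simp add: E_eq C_inf_add[OF atl] C_inf_cmult[OF atl] C_inf_mult[OF atl] C_left T_add T_cmult T_mult)+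

text \<open>Both summands of \<open>conn\<close> are derivations in the function, by the Leibniz
  rules of \<open>P\<close> and \<open>df\<close>. In the form, \<open>\<Theta>\<close> is
  function-linear, so the extra term with \<open>P a b\<close> comes from the bracket alone.\<close>

lemma preconnection_preconn: "preconnection A P preconn"
  unfolding preconnection_def
proof (intro conjI ballI allI impI)
  fix a b c \<tau> \<sigma> assume a: "a \<in> C"
  {
    assume \<tau>: "one_form A \<tau>"
    note s = smooth_form_coef[OF \<tau>]
    show "one_form A (preconn a \<tau>)"
      unfolding preconn_def by (rule one_form_dual_form[OF smooth_conn[OF a s]])
    have "conn (\<lambda>q. c * a q) (form_coef \<tau>) = (\<lambda>q. c *\<^sub>R conn a (form_coef \<tau>) q)"
      by (rule ext, rule pair_eqI)
        (simp add: pair_conn a s C_inf_cmult[OF atl] P_cmult_left smooth_dualD df_algebra Theta_simps distrib_left)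
    then show "preconn (\<lambda>q. c * a q) \<tau> = form_scale (\<lambda>q. c) (preconn a \<tau>)"
      by (simp add: preconn_def dual_form_scale)
    have fc: "form_coef (form_scale (\<lambda>q. c) \<tau>) q = c *\<^sub>R form_coef \<tau> q" for q
      by (rule form_coef_unique) (simp add: form_scale_def pair_form_coef[OF \<tau>])
    then have fc': "form_coef (form_scale (\<lambda>q. c) \<tau>) = (\<lambda>q. c *\<^sub>R form_coef \<tau> q)" by (rule ext)
    have "conn a (\<lambda>q. c *\<^sub>R form_coef \<tau> q) = (\<lambda>q. c *\<^sub>R conn a (form_coef \<tau>) q)"
      by (rule ext, rule pair_eqI)
        (simp add: pair_conn a s smooth_dual_scale C_inf_const[OF atl] P_cmult_right smooth_dualD Theta_simps distrib_left)
    then show "preconn a (form_scale (\<lambda>q. c) \<tau>) = form_scale (\<lambda>q. c) (preconn a \<tau>)"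
      by (simp add: preconn_def dual_form_scale fc')
  }
  {
    assume \<tau>: "one_form A \<tau>" and \<sigma>: "one_form A \<sigma>"
    note s = smooth_form_coef[OF \<tau>] and t = smooth_form_coef[OF \<sigma>]
    have "form_coef (form_add \<tau> \<sigma>) q = form_coef \<tau> q + form_coef \<sigma> q" for q
      by (rule form_coef_unique) (simp add: form_add_def pair_form_coef[OF \<tau>] pair_form_coef[OF \<sigma>])
    then have fc: "form_coef (form_add \<tau> \<sigma>) = (\<lambda>q. form_coef \<tau> q + form_coef \<sigma> q)" by (rule ext)
    have "conn a (\<lambda>q. form_coef \<tau> q + form_coef \<sigma> q) = (\<lambda>q. conn a (form_coef \<tau>) q + conn a (form_coef \<sigma>) q)"
      by (rule ext, rule pair_eqI)
        (simp add: pair_conn a s t smooth_dual_add P_add_right smooth_dualD Theta_simps)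
    then show "preconn a (form_add \<tau> \<sigma>) = form_add (preconn a \<tau>) (preconn a \<sigma>)"
      by (simp add: preconn_def dual_form_add fc)
  }
  {
    assume b: "b \<in> C" and \<tau>: "one_form A \<tau>"
    note s = smooth_form_coef[OF \<tau>]
    have "conn (\<lambda>q. a q + b q) (form_coef \<tau>) = (\<lambda>q. conn a (form_coef \<tau>) q + conn b (form_coef \<tau>) q)"
      by (rule ext, rule pair_eqI)
        (simp add: pair_conn a b s C_inf_add[OF atl] P_add_left smooth_dualD df_algebra Theta_simps)
    then show "preconn (\<lambda>q. a q + b q) \<tau> = form_add (preconn a \<tau>) (preconn b \<tau>)"
      by (simp add: preconn_def dual_form_add)
    have "conn (\<lambda>q. a q * b q) (form_coef \<tau>) = (\<lambda>q. b q *\<^sub>R conn a (form_coef \<tau>) q + a q *\<^sub>R conn b (form_coef \<tau>) q)"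
      by (rule ext, rule pair_eqI)
        (simp add: pair_conn a b s C_inf_mult[OF atl] P_mult_left smooth_dualD df_algebra Theta_simps algebra_simps)
    then show "preconn (\<lambda>q. a q * b q) \<tau> = form_add (form_scale b (preconn a \<tau>)) (form_scale a (preconn b \<tau>))"
      by (simp add: preconn_def dual_form_add dual_form_scale)
    have "form_coef (form_scale b \<tau>) q = b q *\<^sub>R form_coef \<tau> q" for q
      by (rule form_coef_unique) (simp add: form_scale_def pair_form_coef[OF \<tau>])
    then have fc: "form_coef (form_scale b \<tau>) = (\<lambda>q. b q *\<^sub>R form_coef \<tau> q)" by (rule ext)
    have "conn a (\<lambda>q. b q *\<^sub>R form_coef \<tau> q) = (\<lambda>q. b q *\<^sub>R conn a (form_coef \<tau>) q + P a b q *\<^sub>R form_coef \<tau> q)"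
      by (rule ext, rule pair_eqI)
        (simp add: pair_conn a b s smooth_dual_scale P_mult_right smooth_dualD Theta_simps algebra_simps)
    moreover have "form_scale (P a b) \<tau> = dual_form (\<lambda>q. P a b q *\<^sub>R form_coef \<tau> q)"
      by (subst one_form_eq[OF \<tau>]) (rule dual_form_scale)
    ultimately show "preconn a (form_scale b \<tau>) = form_add (form_scale b (preconn a \<tau>)) (form_scale (P a b) \<tau>)"
      by (simp add: preconn_def dual_form_add dual_form_scale fc)
  }
qed

lemma poisson_compatible_preconn: "poisson_compatible A P preconn"
  unfolding poisson_compatible_def
proof (intro ballI)
  fix a b assume a: "a \<in> C" and b: "b \<in> C"
  have "df (P a b) q = conn a (df b) q - conn b (df a) q" for q
    by (simp add: conn_def df_poisson[OF a b] Theta_commutator)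
  then have "df (P a b) = (\<lambda>q. conn a (df b) q - conn b (df a) q)" by (rule ext)
  then show "ext_d A (P a b) = form_diff (preconn a (ext_d A b)) (preconn b (ext_d A a))"
    by (simp add: preconn_def ext_d_eq a b P_C dual_form_diff)
qed

text \<open>In the commutator the mixed terms, with \<open>\<Theta>\<close> of one differential and
  the bracket of s with the other function, are symmetric in a and b and cancel. The terms with
  \<open>P_dual a (df b)\<close> and \<open>P_dual b (df a)\<close> combine with the dual bracket of
  \<open>df a\<close> and \<open>df b\<close> into \<open>df (P a b)\<close>, by
  \<open>df_poisson\<close>.\<close>

lemma flat_preconn: "flat_preconnection A P preconn"
  unfolding flat_preconnection_def
proof (intro ballI allI impI)
  fix a b \<tau> assume a: "a \<in> C" and b: "b \<in> C" and \<tau>: "one_form A \<tau>"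
  define s where "s = form_coef \<tau>"
  have s: "smooth_dual s" unfolding s_def by (rule smooth_form_coef[OF \<tau>])
  have expand: "pair (conn a (conn b s) q) x = P a (P b (\<lambda>g. pair (s g) x)) q +
      pair (\<Theta> (P_dual a (df b) q) (s q) + \<Theta> (df b q) (P_dual a s q) + \<Theta> (df a q) (P_dual b s q) +
        \<Theta> (df a q) (\<Theta> (df b q) (s q))) x" if a: "a \<in> C" and b: "b \<in> C" for a b q x
  proof -
    have "P a (\<lambda>g. pair (conn b s g) x) q =
        P a (\<lambda>g. P b (\<lambda>g. pair (s g) x) g + pair (\<Theta> (df b g) (s g)) x) q"
      by (simp only: pair_conn[OF b s])
    also have "\<dots> = P a (P b (\<lambda>g. pair (s g) x)) q + P a (\<lambda>g. pair (\<Theta> (df b g) (s g)) x) q"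
      by (rule P_add_right[OF a P_C[OF b smooth_dualD[OF s]] smooth_dual_bilinear[OF smooth_dual_df[OF b] s pair_Theta_bilinear]])
    also have "P a (\<lambda>g. pair (\<Theta> (df b g) (s g)) x) q =
        pair (\<Theta> (P_dual a (df b) q) (s q)) x + pair (\<Theta> (df b q) (P_dual a s q)) x"
      by (rule P_bilinear[OF a smooth_dual_df[OF b] s pair_Theta_bilinear])
    finally show ?thesis
      using pair_conn[OF a smooth_conn[OF b s], of q x] by (simp add: conn_def[of b s q] Theta_simps)
  qed
  have "conn a (conn b s) q - conn b (conn a s) q = conn (P a b) s q" for q
  proof (rule pair_eqI)
    fix x
    let ?sx = "\<lambda>g. pair (s g) x"
    note sx = smooth_dualD[OF s, of x]
    have "P a (P b ?sx) q - P b (P a ?sx) q = P (P a b) ?sx q"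
    proof -
      have "P b (P ?sx a) q = - P b (P a ?sx) q"
        using P_cmult_right[OF b P_C[OF a sx], of "-1" q] by (simp add: P_antisym_fun[OF sx a])
      moreover have "P ?sx (P a b) q = - P (P a b) ?sx q" by (rule P_antisym[OF sx P_C[OF a b]])
      ultimately show ?thesis using P_Jacobi[OF a b sx, of q] by simp
    qed
    \<comment> \<open>Read with the commutator, the pre-Lie identity says that left multiplication
      by \<open>\<Theta>\<close> is a representation of the dual Lie algebra.\<close>
    moreover have "\<Theta> (dual_bracket pair \<delta> (df a q) (df b q)) (s q) =
        \<Theta> (df a q) (\<Theta> (df b q) (s q)) - \<Theta> (df b q) (\<Theta> (df a q) (s q))"
      by (simp add: Theta_commutator Theta_simps Theta_assoc)
    ultimately show "pair (conn a (conn b s) q - conn b (conn a s) q) x = pair (conn (P a b) s q) x"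
      by (simp add: expand a b pair_conn[OF P_C[OF a b] s] df_poisson[OF a b] Theta_simps)
  qed
  then have "(\<lambda>q. conn a (conn b s) q - conn b (conn a s) q) = conn (P a b) s" by (rule ext)
  then show "form_diff (preconn a (preconn b \<tau>)) (preconn b (preconn a \<tau>)) = preconn (P a b) \<tau>"
    by (simp add: preconn_def dual_form_diff s_def)
qed

text \<open>In the frame of B the form has the coefficients \<open>\<tau> k\<close> and
  \<open>df a\<close> the coefficients \<open>E i a\<close>, so bilinearity of
  \<open>\<Theta>\<close> spreads \<open>conn\<close> into the required sum. As \<open>conn\<close>
  refers to no basis, one \<open>\<Theta>\<close> serves them all.\<close>

lemma left_covariant_preconn: "left_covariant G P T pair preconn"
  unfolding left_covariant_def
proof (intro exI[of _ \<Theta>] conjI Theta_bilinear allI impI)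
  fix B :: "'v set" assume B: "is_basis B"
  have fin: "finite B" and ind: "independent B" using B by (auto simp: is_basis_def)
  let ?f = "dual_basis pair B"
  have fc: "pair (?f b) c = (if c = b then 1 else 0)" if "c \<in> B" for b c
    using representation_basis[OF ind that] B by simp
  show "let f = ?f; \<omega> = left_coframe G T B; E = E in
        \<forall>a\<in>C. \<forall>\<tau>. (\<forall>k\<in>B. \<tau> k \<in> C) \<longrightarrow>
          preconn a (\<lambda>X q. \<Sum>k\<in>B. \<tau> k q * \<omega> k X q) =
          (\<lambda>X q. \<Sum>k\<in>B. (P a (\<tau> k) q +
             (\<Sum>i\<in>B. \<Sum>j\<in>B. pair (\<Theta> (f i) (f j)) k * E i a q * \<tau> j q)) * \<omega> k X q)"
    unfolding Let_def
  proof (intro ballI allI impI)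
    fix a \<tau> assume a: "a \<in> C" and \<tau>: "\<forall>k\<in>B. \<tau> k \<in> C"
    have sum_form: "(\<lambda>X q. \<Sum>k\<in>B. c k q * left_coframe G T B k X q) = dual_form (\<lambda>q. \<Sum>k\<in>B. c k q *\<^sub>R ?f k)" for c
      by (intro ext) (simp add: left_coframe_eq[OF B] dual_form_def)
    let ?s = "\<lambda>q. \<Sum>k\<in>B. \<tau> k q *\<^sub>R ?f k"
    let ?c = "\<lambda>k q. P a (\<tau> k) q + (\<Sum>i\<in>B. \<Sum>j\<in>B. pair (\<Theta> (?f i) (?f j)) k * E i a q * \<tau> j q)"
    have s: "smooth_dual ?s"
      unfolding smooth_dual_def using \<tau> B
      by (simp add: C_inf_sum[OF atl] C_inf_mult[OF atl] C_inf_const[OF atl])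
    have sk: "pair (?s q) k = \<tau> k q" if "k \<in> B" for k q
      using fin that by (simp add: fc if_distrib cong: if_cong)
    have basis_eqI: "\<phi> = \<psi>" if "\<And>k. k \<in> B \<Longrightarrow> pair \<phi> k = pair \<psi> k" for \<phi> \<psi>
    proof (rule pair_eqI)
      show "pair \<phi> x = pair \<psi> x" for x
        using linear_is_basis_eq[OF B pair_linear(1), of \<phi> x] linear_is_basis_eq[OF B pair_linear(1), of \<psi> x] that
        by simp
    qed
    have df_sum: "df a q = (\<Sum>i\<in>B. E i a q *\<^sub>R ?f i)" for q
      by (rule basis_eqI) (use fin in \<open>simp add: fc if_distrib cong: if_cong\<close>)
    have "conn a ?s q = (\<Sum>k\<in>B. ?c k q *\<^sub>R ?f k)" for q
    proof (rule basis_eqI)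
      fix k assume k: "k \<in> B"
      have "pair (\<Theta> (df a q) (?s q)) k = (\<Sum>i\<in>B. \<Sum>j\<in>B. pair (\<Theta> (?f i) (?f j)) k * E i a q * \<tau> j q)"
        by (simp add: df_sum linear_sum[OF Theta_linear(1)] linear_sum[OF Theta_linear(2)] Theta_simps sum_distrib_left mult_ac)
           (subst sum.swap, simp)
      then have "pair (conn a ?s q) k = ?c k q"
        by (simp only: pair_conn[OF a s] sk[OF k])
      also have "\<dots> = pair (\<Sum>k\<in>B. ?c k q *\<^sub>R ?f k) k"
        using fin k by (simp add: fc if_distrib cong: if_cong)
      finally show "pair (conn a ?s q) k = pair (\<Sum>k\<in>B. ?c k q *\<^sub>R ?f k) k" .
    qed
    then have "conn a ?s = (\<lambda>q. \<Sum>k\<in>B. ?c k q *\<^sub>R ?f k)" by (rule ext)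
    then show "preconn a (\<lambda>X q. \<Sum>k\<in>B. \<tau> k q * left_coframe G T B k X q) =
        (\<lambda>X q. \<Sum>k\<in>B. ?c k q * left_coframe G T B k X q)"
      by (simp only: sum_form preconn_def form_coef_dual_form)
  qed
qed

end

section \<open>The semidirect product pre-Lie structure\<close>

text \<open>Bilinearity, antisymmetry and the Jacobi identity of the bracket all follow from the
  product, so a semidirect bracket needs no verification of its own.\<close>

lemma pre_lie_structureI:
  assumes m: "bilinear m" and br: "\<And>x y. br x y = m x y - m y x"
    and assoc: "\<And>x y z. m (m x y) z - m (m y x) z = m x (m y z) - m y (m x z)"
  shows "pre_lie_structure br m"
proof -
  have l: "linear (m x)" "linear (\<lambda>x. m x y)" for x y using m by (auto simp: bilinear_def)
  note simps = linear_add[OF l(1)] linear_add[OF l(2)] linear_diff[OF l(1)] linear_diff[OF l(2)]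
    linear_scale[OF l(1)] linear_scale[OF l(2)]
  have "bilinear br"
    unfolding bilinear_def by (intro conjI allI linearI) (simp_all add: br simps scaleR_diff_right)
  moreover have "br x (br y z) + br y (br z x) + br z (br x y) = 0" for x y z
  proof -
    \<comment> \<open>In this orientation the identity could rewrite forever, so below it is
      instantiated at the three cyclic triples only.\<close>
    have *: "m (m x y) z = m (m y x) z + (m x (m y z) - m y (m x z))" for x y z
      by (simp only: assoc[symmetric]) simp
    show ?thesis by (simp add: br simps *[of x y z] *[of y z x] *[of z x y])
  qed
  ultimately show ?thesis
    unfolding pre_lie_structure_def lie_algebra_def using m assoc by (simp add: br)
qed

text \<open>The right-hand side is linear in \<open>\<psi>\<close>, hence evaluation at a unique
  vector, by duality with the two spaces exchanged; the description operator picks this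
  vector.\<close>

lemma pair_Xi_act:
  fixes pair :: "'d::fin_dim_normed_vector \<Rightarrow> 'v::fin_dim_normed_vector \<Rightarrow> real"
  assumes pair: "dual_pairing pair" and \<Xi>: "bilinear \<Xi>"
  shows "pair \<psi> (Xi_act pair \<Xi> \<phi> x) = - pair (\<Xi> \<phi> \<psi>) x"
proof -
  have "linear (\<lambda>\<psi>. - pair (\<Xi> \<phi> \<psi>) x)"
    using \<Xi> linear_compose_neg[OF linear_compose[of "\<Xi> \<phi>" "\<lambda>\<zeta>. pair \<zeta> x"]] dual_pairing_linear(2)[OF pair]
    by (simp add: bilinear_def comp_def)
  then obtain y where y: "\<And>\<psi>. pair \<psi> y = - pair (\<Xi> \<phi> \<psi>) x"
    using dual_pairing_ex[OF dual_pairing_flip[OF pair]] by blast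
  have "Xi_act pair \<Xi> \<phi> x = y"
    unfolding Xi_act_def
    by (rule the_equality) (use y in \<open>auto intro: dual_pairing_eqI[OF dual_pairing_flip[OF pair]]\<close>)
  then show ?thesis by (simp add: y)
qed

context
  fixes pair :: "'d::fin_dim_normed_vector \<Rightarrow> 'v::fin_dim_normed_vector \<Rightarrow> real" and \<Xi> and lie_br :: "'d \<Rightarrow> 'd \<Rightarrow> 'd"
  assumes pair: "dual_pairing pair" and \<Xi>: "pre_lie_structure lie_br \<Xi>"
begin

lemma Xi_bilinear: "bilinear \<Xi>"
  using \<Xi> by (simp add: pre_lie_structure_def)

lemma Xi_linear: "linear (\<Xi> \<phi>)" "linear (\<lambda>\<phi>. \<Xi> \<phi> \<psi>)"
  using Xi_bilinear by (auto simp: bilinear_def)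

lemmas pair_simps =
  linear_add[OF dual_pairing_linear(1)[OF pair]] linear_add[OF dual_pairing_linear(2)[OF pair]]
  linear_diff[OF dual_pairing_linear(1)[OF pair]] linear_diff[OF dual_pairing_linear(2)[OF pair]]
  linear_scale[OF dual_pairing_linear(1)[OF pair]] linear_scale[OF dual_pairing_linear(2)[OF pair]]
  pair_Xi_act[OF pair Xi_bilinear]

lemmas Xi_simps =
  linear_add[OF Xi_linear(1)] linear_add[OF Xi_linear(2)] linear_diff[OF Xi_linear(2)]
  linear_scale[OF Xi_linear(1)] linear_scale[OF Xi_linear(2)]

lemma Xi_act_bilinear: "bilinear (Xi_act pair \<Xi>)"
  unfolding bilinear_def
  by (intro conjI allI linearI; rule dual_pairing_eqI[OF dual_pairing_flip[OF pair]])
     (simp_all add: pair_simps Xi_simps)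

text \<open>By the pre-Lie identity, left multiplication by \<open>\<Xi>\<close> is a
  representation; the action is its negative transpose, the contragredient representation.\<close>

lemma Xi_act_commutator:
  "Xi_act pair \<Xi> (lie_br \<phi> \<psi>) x = Xi_act pair \<Xi> \<phi> (Xi_act pair \<Xi> \<psi> x) - Xi_act pair \<Xi> \<psi> (Xi_act pair \<Xi> \<phi> x)"
proof (rule dual_pairing_eqI[OF dual_pairing_flip[OF pair]])
  fix \<zeta>
  have "\<Xi> (lie_br \<phi> \<psi>) \<zeta> = \<Xi> \<phi> (\<Xi> \<psi> \<zeta>) - \<Xi> \<psi> (\<Xi> \<phi> \<zeta>)"
    using \<Xi> unfolding pre_lie_structure_def by (metis linear_diff[OF Xi_linear(2)])
  then show "pair \<zeta> (Xi_act pair \<Xi> (lie_br \<phi> \<psi>) x) =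
      pair \<zeta> (Xi_act pair \<Xi> \<phi> (Xi_act pair \<Xi> \<psi> x) - Xi_act pair \<Xi> \<psi> (Xi_act pair \<Xi> \<phi> x))"
    by (simp add: pair_simps)
qed

end

text \<open>The second component is the identity for \<open>circ\<close>. In the first, the terms in
  \<open>ast\<close> obey their own identity, the derivation rule cancels those mixing
  \<open>ast\<close> with the action, and the rest says that the action is a representation.\<close>

lemma pre_lie_semidirect:
  fixes pair :: "'d::fin_dim_normed_vector \<Rightarrow> 'v::fin_dim_normed_vector \<Rightarrow> real"
  assumes pair: "dual_pairing pair"
    and \<Xi>: "pre_lie_structure (dual_bracket pair \<delta>) \<Xi>"
    and circ: "pre_lie_structure (dual_bracket pair \<delta>) circ"
    and ast: "pre_lie_structure br ast"
    and der: "\<And>\<phi> x y. Xi_act pair \<Xi> \<phi> (ast x y) = ast (Xi_act pair \<Xi> \<phi> x) y + ast x (Xi_act pair \<Xi> \<phi> y)"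
  shows "pre_lie_structure (dual_semidirect_bracket pair br \<delta> \<Xi>)
           (\<lambda>(x, \<phi>) (y, \<psi>). (ast x y + Xi_act pair \<Xi> \<phi> y, circ \<phi> \<psi>))"
proof -
  let ?a = "Xi_act pair \<Xi>"
  have "linear (?a \<phi>)" "linear (\<lambda>\<phi>. ?a \<phi> x)" "linear (ast x)" "linear (\<lambda>x. ast x y)"
    "linear (circ \<phi>)" "linear (\<lambda>\<phi>. circ \<phi> \<psi>)" for \<phi> \<psi> x y
    using Xi_act_bilinear[OF pair \<Xi>] ast circ by (auto simp: bilinear_def pre_lie_structure_def)
  note simps = this[THEN linear_add] this[THEN linear_diff] this[THEN linear_scale]
  have ast': "ast (ast x y) z - ast (ast y x) z = ast x (ast y z) - ast y (ast x z)" "br x y = ast x y - ast y x" for x y z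
    using ast by (simp_all add: pre_lie_structure_def)
  have circ': "circ (circ \<phi> \<psi>) \<zeta> - circ (circ \<psi> \<phi>) \<zeta> = circ \<phi> (circ \<psi> \<zeta>) - circ \<psi> (circ \<phi> \<zeta>)"
    "dual_bracket pair \<delta> \<phi> \<psi> = circ \<phi> \<psi> - circ \<psi> \<phi>" for \<phi> \<psi> \<zeta>
    using circ by (simp_all add: pre_lie_structure_def)
  \<comment> \<open>\<open>\<Xi>\<close> and \<open>circ\<close> share their commutator, so the
    representation property, which stems from \<open>\<Xi>\<close>, can be stated with products of
    \<open>circ\<close>.\<close>
  have act: "?a (circ \<phi> \<psi>) x - ?a (circ \<psi> \<phi>) x = ?a \<phi> (?a \<psi> x) - ?a \<psi> (?a \<phi> x)" for \<phi> \<psi> x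
    using Xi_act_commutator[OF pair \<Xi>, of \<phi> \<psi> x] by (simp only: circ'(2) simps)
  show ?thesis
  proof (rule pre_lie_structureI)
    show "bilinear (\<lambda>(x, \<phi>) (y, \<psi>). (ast x y + ?a \<phi> y, circ \<phi> \<psi>))"
      unfolding bilinear_def
      by (intro conjI allI linearI) (auto simp: simps scaleR_add_right algebra_simps split: prod.splits)
    show "dual_semidirect_bracket pair br \<delta> \<Xi> p q =
      (\<lambda>(x, \<phi>) (y, \<psi>). (ast x y + ?a \<phi> y, circ \<phi> \<psi>)) p q - (\<lambda>(x, \<phi>) (y, \<psi>). (ast x y + ?a \<phi> y, circ \<phi> \<psi>)) q p" for p q
      by (cases p; cases q) (simp add: dual_semidirect_bracket_def ast'(2) circ'(2))
  next
    fix p q r :: "'v \<times> 'd"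
    obtain x \<phi> y \<psi> z \<zeta> where pqr: "p = (x, \<phi>)" "q = (y, \<psi>)" "r = (z, \<zeta>)" by (metis surj_pair)
    have "ast (ast x y + ?a \<phi> y) z + ?a (circ \<phi> \<psi>) z - (ast (ast y x + ?a \<psi> x) z + ?a (circ \<psi> \<phi>) z) =
      ast x (ast y z + ?a \<psi> z) + ?a \<phi> (ast y z + ?a \<psi> z) - (ast y (ast x z + ?a \<phi> z) + ?a \<psi> (ast x z + ?a \<phi> z))"
      using ast'(1)[of x y z] act[of \<phi> \<psi> z] by (simp add: simps der algebra_simps)
    then show "(\<lambda>(x, \<phi>) (y, \<psi>). (ast x y + ?a \<phi> y, circ \<phi> \<psi>)) ((\<lambda>(x, \<phi>) (y, \<psi>). (ast x y + ?a \<phi> y, circ \<phi> \<psi>)) p q) r -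
        (\<lambda>(x, \<phi>) (y, \<psi>). (ast x y + ?a \<phi> y, circ \<phi> \<psi>)) ((\<lambda>(x, \<phi>) (y, \<psi>). (ast x y + ?a \<phi> y, circ \<phi> \<psi>)) q p) r =
        (\<lambda>(x, \<phi>) (y, \<psi>). (ast x y + ?a \<phi> y, circ \<phi> \<psi>)) p ((\<lambda>(x, \<phi>) (y, \<psi>). (ast x y + ?a \<phi> y, circ \<phi> \<psi>)) q r) -
        (\<lambda>(x, \<phi>) (y, \<psi>). (ast x y + ?a \<phi> y, circ \<phi> \<psi>)) q ((\<lambda>(x, \<phi>) (y, \<psi>). (ast x y + ?a \<phi> y, circ \<phi> \<psi>)) p r)"
      by (simp add: pqr circ'(1))
  qed
qed

text \<open>Paired with (\<open>\<mu>\<close>, z), the term in \<open>\<delta>\<close> yields the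
  dual bracket and the term in \<open>br\<close> yields \<open>br\<close>;
  \<open>pair_Xi_act\<close> recognises the two terms in \<open>Xi_alpha\<close> as pairings of
  \<open>\<mu>\<close> with the action terms of the semidirect bracket.\<close>

lemma dual_bracket_cotangent_cobracket:
  fixes pair :: "'d::fin_dim_normed_vector \<Rightarrow> 'v::fin_dim_normed_vector \<Rightarrow> real"
  assumes pair: "dual_pairing pair" and pair': "dual_pairing (cotangent_pair pair)" and \<Xi>: "bilinear \<Xi>"
    and \<delta>: "\<And>\<phi> \<psi> x. pair (dual_bracket pair \<delta> \<phi> \<psi>) x = \<delta> x \<phi> \<psi>"
  shows "dual_bracket (cotangent_pair pair) (cotangent_cobracket pair br \<delta> \<Xi>) = dual_semidirect_bracket pair br \<delta> \<Xi>"
proof (intro ext)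
  fix p q :: "'v \<times> 'd"
  obtain x \<phi> y \<psi> where pq: "p = (x, \<phi>)" "q = (y, \<psi>)" by (metis surj_pair)
  show "dual_bracket (cotangent_pair pair) (cotangent_cobracket pair br \<delta> \<Xi>) p q = dual_semidirect_bracket pair br \<delta> \<Xi> p q"
    unfolding dual_bracket_def[of "cotangent_pair pair"]
  proof (rule of_functional_unique[OF pair'])
    fix w :: "'d \<times> 'v"
    obtain \<mu> z where w: "w = (\<mu>, z)" by (metis surj_pair)
    show "cotangent_pair pair (dual_semidirect_bracket pair br \<delta> \<Xi> p q) w = cotangent_cobracket pair br \<delta> \<Xi> w p q"
      by (simp add: pq w cotangent_pair_def dual_semidirect_bracket_def cotangent_cobracket_def Xi_alpha_def
          dual_cobracket_def \<delta> linear_add[OF dual_pairing_linear(1)[OF pair]]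
          linear_diff[OF dual_pairing_linear(1)[OF pair]] pair_Xi_act[OF pair \<Xi>])
  qed
qed

theorem theorem6p6:
  fixes G :: "('m::{t2_space, second_countable_topology}, 'v::fin_dim_normed_vector) lie_group_data"
    and P :: "'m fn_bracket"
    and T :: "'v \<Rightarrow> ('m \<Rightarrow> real) \<Rightarrow> real"
    and pair :: "'d::fin_dim_normed_vector \<Rightarrow> 'v \<Rightarrow> real"
    and br :: "'v \<Rightarrow> 'v \<Rightarrow> 'v"
    and \<delta> :: "'v \<Rightarrow> 'd \<Rightarrow> 'd \<Rightarrow> real"
    and \<Xi> circ :: "'d \<Rightarrow> 'd \<Rightarrow> 'd"
    and ast :: "'v \<Rightarrow> 'v \<Rightarrow> 'v"
  assumes "poisson_lie_group G P"
    and "connected (UNIV :: 'm set)"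
    and "simply_connected (UNIV :: 'm set)"
    and "has_lie_bialgebra G P T pair br \<delta>"
    and "pre_lie_structure (dual_bracket pair \<delta>) \<Xi>"
    and "pre_lie_structure (dual_bracket pair \<delta>) circ"
    and "Xi_conditions pair br \<Xi>"
    and "pre_lie_structure br ast"
    and "\<forall>\<phi> x y. Xi_act pair \<Xi> \<phi> (ast x y) =
           ast (Xi_act pair \<Xi> \<phi> x) y + ast x (Xi_act pair \<Xi> \<phi> y)"
  shows "pre_lie_structure (dual_semidirect_bracket pair br \<delta> \<Xi>)
           (\<lambda>(x, \<phi>) (y, \<psi>). (ast x y + Xi_act pair \<Xi> \<phi> y, circ \<phi> \<psi>)) \<and>
         (let K = cotangent_group G T pair; T' = cotangent_tangent G T;
              pair' = cotangent_pair pair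
          in \<forall>Q. poisson_lie_group K Q \<and>
               has_lie_bialgebra K Q T' pair' (cotangent_bracket pair br)
                 (cotangent_cobracket pair br \<delta> \<Xi>) \<longrightarrow>
             (\<exists>\<gamma>. preconnection (atlas K) Q \<gamma> \<and>
                  poisson_compatible (atlas K) Q \<gamma> \<and>
                  left_covariant K Q T' pair' \<gamma> \<and>
                  flat_preconnection (atlas K) Q \<gamma>))"
proof -
  \<comment> \<open>For the base group the locale supplies the duality and the relation between
    \<open>dual_bracket\<close> and \<open>\<delta>\<close>.\<close>
  interpret G: poisson_lie_bialgebra G T P pair br \<delta>
    using assms(1,4)
    by unfold_locales (auto simp: poisson_lie_group_def has_lie_bialgebra_def)
  let ?m = "\<lambda>(x, \<phi>) (y, \<psi>). (ast x y + Xi_act pair \<Xi> \<phi> y, circ \<phi> \<psi>)"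
  let ?K = "cotangent_group G T pair" and ?T = "cotangent_tangent G T" and ?pair = "cotangent_pair pair"
  let ?\<delta> = "cotangent_cobracket pair br \<delta> \<Xi>"
  have m: "pre_lie_structure (dual_semidirect_bracket pair br \<delta> \<Xi>) ?m"
    using assms(9) by (intro pre_lie_semidirect[OF G.pairing assms(5,6,8)]) blast
  have "\<exists>\<gamma>. preconnection (atlas ?K) Q \<gamma> \<and> poisson_compatible (atlas ?K) Q \<gamma> \<and>
      left_covariant ?K Q ?T ?pair \<gamma> \<and> flat_preconnection (atlas ?K) Q \<gamma>"
    if Q: "poisson_lie_group ?K Q" "has_lie_bialgebra ?K Q ?T ?pair (cotangent_bracket pair br) ?\<delta>" for Q
  proof -
    have pair': "dual_pairing ?pair" using Q(2) by (simp add: has_lie_bialgebra_def)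
    have "bilinear \<Xi>" using assms(5) by (simp add: pre_lie_structure_def)
    \<comment> \<open>The bracket dual to the cobracket of the cotangent group is the semidirect
      one, so \<open>?m\<close> can take the role of \<open>\<Theta>\<close> in the general
      construction.\<close>
    then have "pre_lie_structure (dual_bracket ?pair ?\<delta>) ?m"
      using m by (simp only: dual_bracket_cotangent_cobracket[OF G.pairing pair' _ G.dual_bracket_eq])
    then interpret K: poisson_lie_pre_lie ?K ?T Q ?pair "cotangent_bracket pair br" ?\<delta> ?m
      using Q by unfold_locales (auto simp: poisson_lie_group_def has_lie_bialgebra_def)
    show ?thesis
      using K.preconnection_preconn K.poisson_compatible_preconn K.left_covariant_preconn K.flat_preconn by blast
  qed
  then show ?thesis using m unfolding Let_def by blast
qed

end
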